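(* Let $\Omega\subset\mathbb R^N$ be an exterior domain, $1<q<N$ and $q<p<s$. Then the differential inequality $$-\Delta_p u-\Delta_q u\ge u^{s-1}\quad\text{in }\Omega$$ has a positive solution if and only if $s>q_*:=\frac{q(N-1)}{N-q}$.
   Context: For $r>1$, $\Delta_r u=\operatorname{div}(|\nabla u|^{r-2}\nabla u)$. An exterior domain is a domain (connected open set) $\Omega\subset\mathbb R^N$ with $\Omega\supset\{x:|x|>R\}$ for some $R>0$. A positive solution of $-\Delta_p u-\Delta_q u\ge u^{s-1}$ in $\Omega$ is a function $u\in C(\Omega)\cap W^{1,p}_{loc}(\Omega)$, $u>0$, such that $$\int_\Omega |\nabla u|^{p-2}\nabla u\cdot\nabla\varphi\,dx+\int_\Omega |\nabla u|^{q-2}\nabla u\cdot\nabla\varphi\,dx\ge \int_\Omega u^{s-1}\varphi\,dx\quad\text{for all }\varphi\in C^1_c(\Omega),\ \varphi\ge 0.$$ *)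

theory Defs
  imports "HOL-Analysis.Analysis"
begin

definition exterior_domain :: "'a::euclidean_space set \<Rightarrow> bool" where
  "exterior_domain \<Omega> \<longleftrightarrow>
     open \<Omega> \<and> connected \<Omega> \<and> (\<exists>R>0. {x. norm x > R} \<subseteq> \<Omega>)"

definition gradient :: "('a::euclidean_space \<Rightarrow> real) \<Rightarrow> 'a \<Rightarrow> 'a" where
  "gradient f x = (THE D. GDERIV f x :> D)"

lemma gradient_eqI:
  assumes "GDERIV f x :> D"
  shows "gradient f x = D"
  unfolding gradient_def
proof (rule the_equality)
  show "GDERIV f x :> D" by fact
next
  fix E assume "GDERIV f x :> E"
  then have "(\<lambda>h. inner h E) = (\<lambda>h. inner h D)"
    using assms unfolding gderiv_def by (blast intro: has_derivative_unique)
  then have "inner h E = inner h D" for h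
    by meson
  then show "E = D"
    using vector_eq_ldot[of E D] by blast
qed

text \<open>
  The space \<open>C\<^sup>1\<^sub>c(\<Omega>)\<close>, for open \<open>\<Omega>\<close>. Its members are taken to be defined on the whole
  space, being extended by zero outside \<open>\<Omega>\<close>.
\<close>

definition C1_c :: "'a::euclidean_space set \<Rightarrow> ('a \<Rightarrow> real) set" where
  "C1_c \<Omega> = {\<phi>. (\<forall>x. \<phi> differentiable (at x)) \<and> continuous_on UNIV (gradient \<phi>) \<and>
     compact (closure {x. \<phi> x \<noteq> 0}) \<and> closure {x. \<phi> x \<noteq> 0} \<subseteq> \<Omega>}"

definition Lp_loc ::
  "real \<Rightarrow> 'a::euclidean_space set \<Rightarrow> ('a \<Rightarrow> 'b::euclidean_space) set" where
  "Lp_loc p \<Omega> = {f. set_borel_measurable lebesgue \<Omega> f \<and>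
     (\<forall>K. compact K \<and> K \<subseteq> \<Omega> \<longrightarrow> set_integrable lebesgue K (\<lambda>x. norm (f x) powr p))}"

text \<open>
  The distributional gradient, with test functions in \<open>C\<^sup>1\<^sub>c(\<Omega>)\<close>. The identity is
  vector valued; its components are the usual integration by parts formulas
  \<open>\<integral> u \<partial>\<^sub>i\<phi> = - \<integral> G\<^sub>i \<phi>\<close>.
\<close>

definition has_weak_gradient ::
  "'a::euclidean_space set \<Rightarrow> ('a \<Rightarrow> real) \<Rightarrow> ('a \<Rightarrow> 'a) \<Rightarrow> bool" where
  "has_weak_gradient \<Omega> u G \<longleftrightarrow> u \<in> Lp_loc 1 \<Omega> \<and> G \<in> Lp_loc 1 \<Omega> \<and>
     (\<forall>\<phi>\<in>C1_c \<Omega>. set_lebesgue_integral lebesgue \<Omega> (\<lambda>x. u x *\<^sub>R gradient \<phi> x) =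
       - set_lebesgue_integral lebesgue \<Omega> (\<lambda>x. \<phi> x *\<^sub>R G x))"

text \<open>
  \<open>W1p_loc p \<Omega> u G\<close> says that \<open>u\<close> belongs to \<open>W\<^sup>1\<^sup>,\<^sup>p\<close> locally in \<open>\<Omega>\<close> and that \<open>G\<close> is a
  representative of its weak gradient, which is unique up to null sets.
\<close>

definition W1p_loc ::
  "real \<Rightarrow> 'a::euclidean_space set \<Rightarrow> ('a \<Rightarrow> real) \<Rightarrow> ('a \<Rightarrow> 'a) \<Rightarrow> bool" where
  "W1p_loc p \<Omega> u G \<longleftrightarrow> has_weak_gradient \<Omega> u G \<and> u \<in> Lp_loc p \<Omega> \<and> G \<in> Lp_loc p \<Omega>"

text \<open>
  The vector field \<open>|v|\<^sup>r\<^sup>-\<^sup>2 v\<close> of the \<open>r\<close>-Laplacian. It vanishes at \<open>v = 0\<close> for every \<open>r\<close>,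
  which is its continuous value when \<open>r > 1\<close>.
\<close>

definition r_flux :: "real \<Rightarrow> 'a::euclidean_space \<Rightarrow> 'a" where
  "r_flux r v = (norm v powr (r - 2)) *\<^sub>R v"

text \<open>
  Positive solutions of \<open>- \<Delta>\<^sub>p u - \<Delta>\<^sub>q u \<ge> u\<^sup>s\<^sup>-\<^sup>1\<close> in \<open>\<Omega>\<close>, in the weak sense. The values of
  \<open>u\<close> outside \<open>\<Omega>\<close> play no role.
\<close>

definition positive_solution ::
  "real \<Rightarrow> real \<Rightarrow> real \<Rightarrow> 'a::euclidean_space set \<Rightarrow> ('a \<Rightarrow> real) \<Rightarrow> bool" where
  "positive_solution p q s \<Omega> u \<longleftrightarrow>
     continuous_on \<Omega> u \<and> (\<forall>x\<in>\<Omega>. u x > 0) \<and>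
     (\<exists>G. W1p_loc p \<Omega> u G \<and>
       (\<forall>\<phi>\<in>C1_c \<Omega>. (\<forall>x. \<phi> x \<ge> 0) \<longrightarrow>
          set_lebesgue_integral lebesgue \<Omega> (\<lambda>x. inner (r_flux p (G x)) (gradient \<phi> x)) +
          set_lebesgue_integral lebesgue \<Omega> (\<lambda>x. inner (r_flux q (G x)) (gradient \<phi> x))
          \<ge> set_lebesgue_integral lebesgue \<Omega> (\<lambda>x. u x powr (s - 1) * \<phi> x)))"

end

theory Submission
  imports Defs
begin

text \<open>
  For \<open>s > q\<^sub>*\<close> the function \<open>\<epsilon> (1 + |x|\<^sup>Q)\<^sup>-\<^sup>k\<close> with \<open>Q = q / (q - 1)\<close> and \<open>k = (q - 1) / (s - q)\<close> is a
  solution on the whole space when \<open>\<epsilon>\<close> is small: the gradient is then so small that the \<open>p\<close>-Laplacian is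
  a perturbation of the \<open>q\<close>-Laplacian.

  For \<open>s \<le> q\<^sub>*\<close> one uses test functions \<open>h(u) \<psi>\<close> with \<open>h\<close> decreasing, which mollification of \<open>u\<close>
  makes admissible. Young's inequality absorbs all gradient terms in \<open>h'(u) \<psi> (|\<nabla>u|\<^sup>p + |\<nabla>u|\<^sup>q)\<close>
  and leaves an integral inequality for \<open>u\<close> alone. Let \<open>m\<close> be a lower bound of \<open>u\<close> on an
  annulus around the hole of the domain, and take
  \<open>h(u) = ((m - u)\<^sup>+)\<^sup>2 (1 + (\<rho>\<^sup>\<kappa> u)\<^sup>-\<^sup>\<alpha>)\<close> with \<open>\<kappa> = q / (s - q)\<close> and a cutoff \<open>\<psi>\<close> at
  radius \<open>\<rho>\<close>. The truncation removes the contribution of the inner boundary. Scaling shows first that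
  \<open>u\<^sup>s\<^sup>-\<^sup>1 ((m - u)\<^sup>+)\<^sup>2\<close> is integrable near infinity, and then, since the cutoff gradient lives at distance
  of order \<open>\<rho>\<close>, that its integral vanishes. The weight \<open>1 + (\<rho>\<^sup>\<kappa> u)\<^sup>-\<^sup>\<alpha>\<close> is what makes the critical case
  \<open>s = q\<^sub>*\<close> work. Hence \<open>u \<ge> m\<close> near infinity, and testing with \<open>u\<^sup>1\<^sup>-\<^sup>s \<psi>\<close> on balls of radius \<open>\<rho>\<close>
  far away gives \<open>\<rho>\<^sup>N \<le> C \<rho>\<^sup>N\<^sup>-\<^sup>q\<close>, which fails for large \<open>\<rho>\<close>.
\<close>

subsection \<open>Test functions and integration by parts\<close>

text \<open>Existence: \<open>s > q_*\<close> is equivalent to \<open>q(s-1)/(s-q) < N\<close>, and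
  this is the sign condition for the divergence of the q-flux of the model function. Nonexistence:
  \<open>s <= q_*\<close> reads \<open>N <= \<kappa>(s-1)\<close>, so
  \<open>\<rho>^(-\<kappa>(s-1))\<close> times the volume of a ball of radius \<rho> stays bounded.
  At \<open>s = q_*\<close> this product has no decay, so one estimate yields integrability only,
  and a second must gain smallness elsewhere. With the truncation alone, Young's inequality leaves
  no power of the rescaled \<open>U = \<rho>^\<kappa> u\<close>. The singular weight gives an
  absorbing term whose Young remainders are strictly positive powers of \<open>U\<close>, each below
  \<open>\<eta> + C U^(s-1)\<close> with \<eta> arbitrarily small. The part with \<open>C\<close>
  carries the factor \<open>(|x|/\<rho>)^q\<close> from the cutoff gradient and disappears by
  dominated convergence. The summand 1 of the weight keeps \<open>h\<close> above the squared
  truncation, independently of \<rho>. The p-terms come with a more negative power of \<rho> and are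
  dominated once \<rho> >= 1, which is why only \<open>q\<close> enters the threshold.\<close>

definition supp :: "('a::euclidean_space \<Rightarrow> real) \<Rightarrow> 'a set" where
  "supp \<phi> = closure {x. \<phi> x \<noteq> 0}"

lemma closed_supp [simp]: "closed (supp \<phi>)"
  by (simp add: supp_def)

lemma not_in_supp: "x \<notin> supp \<phi> \<Longrightarrow> \<phi> x = 0"
  using closure_subset[of "{x. \<phi> x \<noteq> 0}"] by (auto simp: supp_def)

lemma GDERIV_gradient:
  fixes \<phi> :: "'a::euclidean_space \<Rightarrow> real"
  assumes "\<phi> differentiable (at x)"
  shows "GDERIV \<phi> x :> gradient \<phi> x"
proof -
  obtain D where D: "(\<phi> has_derivative D) (at x)"
    using assms by (auto simp: differentiable_def)
  have lin: "linear D" using D by (rule has_derivative_linear)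
  define g where "g = (\<Sum>b\<in>Basis. D b *\<^sub>R b)"
  have "D h = inner h g" for h
  proof -
    have "D h = D (\<Sum>b\<in>Basis. (h \<bullet> b) *\<^sub>R b)" by (simp add: euclidean_representation)
    also have "\<dots> = (\<Sum>b\<in>Basis. (h \<bullet> b) * D b)"
      by (simp add: linear_sum[OF lin] linear_cmul[OF lin])
    also have "\<dots> = inner h g" by (simp add: g_def inner_sum_right mult.commute)
    finally show ?thesis .
  qed
  then have "D = (\<lambda>h. inner h g)" by auto
  then have "GDERIV \<phi> x :> g" using D by (simp add: gderiv_def)
  with gradient_eqI show ?thesis by metis
qed

lemma GDERIV_zero_outside:
  fixes \<phi> :: "'a::euclidean_space \<Rightarrow> real"
  assumes "closed K" "\<And>x. x \<notin> K \<Longrightarrow> \<phi> x = 0" "x \<notin> K"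
  shows "GDERIV \<phi> x :> 0"
proof -
  have "((\<lambda>x. 0) has_derivative (\<lambda>h. 0)) (at x)" by simp
  then have "(\<phi> has_derivative (\<lambda>h. 0)) (at x)"
    by (rule has_derivative_transform_within_open[where s="-K"]) (use assms in auto)
  then show ?thesis by (simp add: gderiv_def)
qed

lemma GDERIV_continuous_on:
  fixes f :: "'a::real_inner \<Rightarrow> real"
  assumes "\<And>x. x \<in> A \<Longrightarrow> GDERIV f x :> F x"
  shows "continuous_on A f"
  using assms unfolding gderiv_def
  by (meson continuous_at_imp_continuous_on has_derivative_continuous)

lemma C1_cI:
  fixes \<phi> :: "'a::euclidean_space \<Rightarrow> real"
  assumes "\<And>x. GDERIV \<phi> x :> G x" "continuous_on UNIV G"
    and "compact K" "K \<subseteq> \<Omega>" "\<And>x. x \<notin> K \<Longrightarrow> \<phi> x = 0"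
  shows "\<phi> \<in> C1_c \<Omega>" "gradient \<phi> = G"
proof -
  show gr: "gradient \<phi> = G" using assms(1) gradient_eqI by blast
  have sub: "supp \<phi> \<subseteq> K"
    using assms(3,5) unfolding supp_def by (intro closure_minimal) (auto simp: compact_imp_closed)
  have "compact (supp \<phi>)" using sub assms(3) by (metis closed_supp closed_Int_compact inf.absorb_iff2 inf_commute)
  moreover have "\<phi> differentiable (at x)" for x
    using assms(1) unfolding gderiv_def differentiable_def by blast
  ultimately show "\<phi> \<in> C1_c \<Omega>" using sub assms(2,4) by (auto simp: C1_c_def gr supp_def)
qed

lemma C1_cD:
  assumes "\<phi> \<in> C1_c \<Omega>"
  shows "GDERIV \<phi> x :> gradient \<phi> x" "continuous_on UNIV (gradient \<phi>)"
    and "compact (supp \<phi>)" "supp \<phi> \<subseteq> \<Omega>"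
    and "continuous_on UNIV \<phi>" "\<phi> \<in> borel_measurable borel" "gradient \<phi> \<in> borel_measurable borel"
proof -
  show c: "continuous_on UNIV \<phi>" "continuous_on UNIV (gradient \<phi>)"
    using assms by (auto simp: C1_c_def
        intro!: continuous_at_imp_continuous_on differentiable_imp_continuous_within)
  show "\<phi> \<in> borel_measurable borel" "gradient \<phi> \<in> borel_measurable borel"
    by (rule borel_measurable_continuous_onI[OF c(1)] borel_measurable_continuous_onI[OF c(2)])+
qed (use assms GDERIV_gradient in \<open>auto simp: C1_c_def supp_def\<close>)

lemma gradient_outside_supp:
  fixes \<phi> :: "'a::euclidean_space \<Rightarrow> real"
  assumes "x \<notin> supp \<phi>"
  shows "gradient \<phi> x = 0"
  by (rule gradient_eqI, rule GDERIV_zero_outside[of "supp \<phi>"]) (use assms not_in_supp in auto)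

lemma C1_c_outside:
  assumes "\<phi> \<in> C1_c \<Omega>" "x \<notin> \<Omega>"
  shows "gradient \<phi> x = 0" "\<phi> x = 0"
  using C1_cD(4)[OF assms(1)] assms(2) gradient_outside_supp[of x \<phi>] not_in_supp[of x \<phi>] by auto

lemma C1_c_mono: "\<Omega> \<subseteq> \<Omega>' \<Longrightarrow> C1_c \<Omega> \<subseteq> C1_c \<Omega>'"
  by (auto simp: C1_c_def)

text \<open>The factor \<open>f\<close> has to be C1 only near the support of \<psi>: product and
  gradient vanish off \<open>supp \<psi>\<close>, and the open sets \<open>V\<close> and
  \<open>- supp \<psi>\<close> cover the space, so continuity can be glued. This admits factors such
  as \<open>h (w n x)\<close>, which are controlled only near the support.\<close>

lemma C1_c_mult:
  fixes \<psi> :: "'a::euclidean_space \<Rightarrow> real"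
  assumes psi: "\<psi> \<in> C1_c \<Omega>" and V: "open V" "supp \<psi> \<subseteq> V"
    and f: "\<And>x. x \<in> V \<Longrightarrow> GDERIV f x :> F x" "continuous_on V F"
  shows "(\<lambda>x. f x * \<psi> x) \<in> C1_c \<Omega>"
    and "gradient (\<lambda>x. f x * \<psi> x) = (\<lambda>x. f x *\<^sub>R gradient \<psi> x + \<psi> x *\<^sub>R F x)"
proof -
  let ?G = "\<lambda>x. f x *\<^sub>R gradient \<psi> x + \<psi> x *\<^sub>R F x"
  have out: "f x * \<psi> x = 0" "?G x = 0" if "x \<notin> supp \<psi>" for x
    using not_in_supp[OF that] gradient_outside_supp[OF that] by auto
  have G: "GDERIV (\<lambda>x. f x * \<psi> x) x :> ?G x" for x
  proof (cases "x \<in> V")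
    case True
    then show ?thesis using GDERIV_mult f(1) C1_cD(1)[OF psi] by blast
  next
    case False
    then have x: "x \<notin> supp \<psi>" using V by auto
    have "GDERIV (\<lambda>x. f x * \<psi> x) x :> 0"
      by (rule GDERIV_zero_outside[of "supp \<psi>"]) (use x out in auto)
    then show ?thesis using out(2)[OF x] by simp
  qed
  have fc: "continuous_on V f"
    by (rule GDERIV_continuous_on) (rule f(1))
  have cV: "continuous_on V ?G"
    using fc f(2) C1_cD(2,5)[OF psi] by (intro continuous_intros) (auto intro: continuous_on_subset)
  have "continuous_on (- supp \<psi>) (\<lambda>x. 0::'a)" by simp
  then have cO: "continuous_on (- supp \<psi>) ?G"
    using out(2) by (subst continuous_on_cong[OF refl]) auto
  have "continuous_on (V \<union> - supp \<psi>) ?G"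
    by (rule continuous_on_open_Un) (use V cV cO in auto)
  moreover have "V \<union> - supp \<psi> = UNIV" using V by auto
  ultimately have Gc: "continuous_on UNIV ?G" by simp
  show "(\<lambda>x. f x * \<psi> x) \<in> C1_c \<Omega>" "gradient (\<lambda>x. f x * \<psi> x) = ?G"
    using C1_cI[OF G Gc C1_cD(3,4)[OF psi]] out(1) by auto
qed

lemma integrable_continuous_compact_support:
  fixes f :: "'a::euclidean_space \<Rightarrow> 'b::euclidean_space"
  assumes "continuous_on UNIV f" "compact K" "\<And>x. x \<notin> K \<Longrightarrow> f x = 0"
  shows "integrable lborel f"
proof -
  have "(\<lambda>x. indicator K x *\<^sub>R f x) = f" using assms(3) by (auto simp: indicator_def)
  then show ?thesis
    using borel_integrable_compact[OF assms(2) continuous_on_subset[OF assms(1) subset_UNIV]] by simp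
qed

lemma C1_c_bounded:
  fixes \<phi> :: "'a::euclidean_space \<Rightarrow> real"
  assumes "\<phi> \<in> C1_c \<Omega>"
  obtains L where "L > 0" "\<And>x. norm (gradient \<phi> x) \<le> L" "\<And>x. \<bar>\<phi> x\<bar> \<le> L"
    "\<And>x y. \<bar>\<phi> x - \<phi> y\<bar> \<le> L * norm (x - y)"
proof -
  note C = C1_cD[OF assms]
  have "bounded (gradient \<phi> ` supp \<phi>)" "bounded (\<phi> ` supp \<phi>)"
    using C by (auto intro!: compact_imp_bounded compact_continuous_image intro: continuous_on_subset)
  then obtain B1 B2 where B: "\<And>x. x \<in> supp \<phi> \<Longrightarrow> norm (gradient \<phi> x) \<le> B1"
     "\<And>x. x \<in> supp \<phi> \<Longrightarrow> norm (\<phi> x) \<le> B2" unfolding bounded_iff by blast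
  define L where "L = \<bar>B1\<bar> + \<bar>B2\<bar> + 1"
  have 1: "norm (gradient \<phi> x) \<le> L" for x
    using B(1)[of x] gradient_outside_supp[of x \<phi>] by (cases "x \<in> supp \<phi>") (auto simp: L_def)
  have 2: "\<bar>\<phi> x\<bar> \<le> L" for x
    using B(2)[of x] not_in_supp[of x \<phi>] by (cases "x \<in> supp \<phi>") (auto simp: L_def)
  have "norm (\<phi> x - \<phi> y) \<le> L * norm (x - y)" for x y
  proof (rule differentiable_bound[of UNIV _ "\<lambda>x h. inner h (gradient \<phi> x)"])
    fix z :: 'a
    show "(\<phi> has_derivative (\<lambda>h. inner h (gradient \<phi> z))) (at z within UNIV)"
      using C(1) by (simp add: gderiv_def)
    show "onorm (\<lambda>h. inner h (gradient \<phi> z)) \<le> L"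
    proof (rule onorm_bound)
      fix h show "norm (h \<bullet> gradient \<phi> z) \<le> L * norm h"
        using Cauchy_Schwarz_ineq2[of h "gradient \<phi> z"] mult_left_mono[OF 1[of z] norm_ge_zero[of h]]
        by (simp add: mult.commute)
    qed (simp add: L_def)
  qed auto
  then show ?thesis using that[of L] 1 2 by (auto simp: L_def)
qed

lemma C1_c_integrable:
  fixes \<phi> :: "'a::euclidean_space \<Rightarrow> real"
  assumes "\<phi> \<in> C1_c \<Omega>"
  shows "integrable lborel (gradient \<phi>)" "integrable lborel \<phi>"
  using C1_cD[OF assms] not_in_supp gradient_outside_supp
  by (auto intro!: integrable_continuous_compact_support[where K="supp \<phi>"])

lemma lborel_integrable_translate:
  fixes f :: "'a::euclidean_space \<Rightarrow> 'b::{banach, second_countable_topology}"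
  assumes "integrable lborel f"
  shows "integrable lborel (\<lambda>x. f (x + c))"
proof -
  have "integrable (distr lborel borel ((+) c)) f" using assms by (simp add: lborel_distr_plus)
  then show ?thesis by (subst (asm) integrable_distr_eq) (auto simp: add.commute borel_measurable_integrable[OF assms, simplified])
qed

lemma lborel_integral_translate:
  fixes f :: "'a::euclidean_space \<Rightarrow> 'b::{banach, second_countable_topology}"
  assumes "f \<in> borel_measurable borel"
  shows "(LBINT x. f (x + c)) = (LBINT x. f x)"
proof -
  have "(LBINT x. f x) = (\<integral>x. f x \<partial>distr lborel borel ((+) c))" by (simp add: lborel_distr_plus)
  also have "\<dots> = (LBINT x. f (c + x))" using assms by (subst integral_distr) auto
  finally show ?thesis by (simp add: add.commute)
qed

text \<open>The difference quotients of a function of compact support have integral zero by translation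
  invariance, and they converge dominatedly.\<close>

lemma integral_gradient_eq_0:
  fixes \<phi> :: "'a::euclidean_space \<Rightarrow> real"
  assumes "\<phi> \<in> C1_c \<Omega>"
  shows "(LBINT x. gradient \<phi> x) = 0"
proof (rule euclidean_eqI)
  fix e :: 'a assume e: "e \<in> Basis"
  note C = C1_cD[OF assms] and I = C1_c_integrable[OF assms]
  obtain L where L: "L > 0" "\<And>x y. \<bar>\<phi> x - \<phi> y\<bar> \<le> L * norm (x - y)"
    using C1_c_bounded[OF assms] by metis
  obtain R where R: "\<And>x. x \<in> supp \<phi> \<Longrightarrow> norm x \<le> R"
    using C(3) compact_imp_bounded bounded_iff by metis
  define t where "t n = 1 / real (Suc n)" for n
  have t: "0 < t n" "t n \<le> 1" for n by (auto simp: t_def)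
  have t0: "t \<longlonglongrightarrow> 0" unfolding t_def by (rule LIMSEQ_Suc[OF lim_1_over_n])
  define s where "s n x = (\<phi> (x + t n *\<^sub>R e) - \<phi> x) / t n" for n x
  note m = C(6)
  \<comment> \<open>The shifts have length at most 1, so every quotient vanishes outside radius
    \<open>R + 1\<close>; inside, the Lipschitz constant bounds it.\<close>
  have "(\<lambda>n. \<integral>x. s n x \<partial>lborel) \<longlonglongrightarrow> (LBINT x. gradient \<phi> x \<bullet> e)"
  proof (rule integral_dominated_convergence[where w="\<lambda>x. indicator (cball 0 (R+1)) x *\<^sub>R L"])
    show "(\<lambda>x. gradient \<phi> x \<bullet> e) \<in> borel_measurable lborel"
      using I(1) by auto
    show "s n \<in> borel_measurable lborel" for n unfolding s_def using m by measurable
    show "integrable lborel (\<lambda>x::'a. indicator (cball 0 (R+1)) x *\<^sub>R L)"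
      by (rule borel_integrable_compact) auto
    show "AE x in lborel. (\<lambda>n. s n x) \<longlonglongrightarrow> gradient \<phi> x \<bullet> e"
    proof (rule AE_I2)
      fix x
      have "((\<lambda>r. \<phi> (x + r *\<^sub>R e)) has_derivative (\<lambda>r. inner (r *\<^sub>R e) (gradient \<phi> x))) (at 0)"
      proof -
        have 1: "((\<lambda>r. x + r *\<^sub>R e) has_derivative (\<lambda>r. r *\<^sub>R e)) (at 0)"
          by (auto intro!: derivative_eq_intros)
        have 2: "(\<phi> has_derivative (\<lambda>h. inner h (gradient \<phi> x))) (at (x + 0 *\<^sub>R e))"
          using C(1)[of x] by (simp add: gderiv_def)
        show ?thesis using has_derivative_compose[OF 1 2] .
      qed
      then have "((\<lambda>r. \<phi> (x + r *\<^sub>R e)) has_field_derivative (gradient \<phi> x \<bullet> e)) (at 0)"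
        by (simp add: has_field_derivative_def inner_commute mult.commute[of "e \<bullet> gradient \<phi> x"] mult_commute_abs)
      then have "((\<lambda>h. (\<phi> (x + h *\<^sub>R e) - \<phi> x) / h) \<longlongrightarrow> gradient \<phi> x \<bullet> e) (at 0)"
        by (simp add: DERIV_def)
      moreover have "filterlim t (at 0) sequentially"
        using t0 t(1) by (auto simp: filterlim_at intro!: eventuallyI) (metis less_irrefl)
      ultimately show "(\<lambda>n. s n x) \<longlonglongrightarrow> gradient \<phi> x \<bullet> e"
        unfolding s_def by (rule filterlim_compose)
    qed
    show "AE x in lborel. norm (s n x) \<le> indicator (cball 0 (R+1)) x *\<^sub>R L" for n
    proof (rule AE_I2)
      fix x
      show "norm (s n x) \<le> indicator (cball 0 (R+1)) x *\<^sub>R L"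
      proof (cases "norm x \<le> R + 1")
        case True
        have "\<bar>\<phi> (x + t n *\<^sub>R e) - \<phi> x\<bar> \<le> L * t n" using L(2)[of "x + t n *\<^sub>R e" x] t(1)[of n] e by simp
        then show ?thesis using True t(1)[of n] by (simp add: s_def field_simps)
      next
        case False
        then have 1: "x \<notin> supp \<phi>" using R[of x] by force
        have "norm x \<le> norm (x + t n *\<^sub>R e) + t n" using norm_triangle_ineq4[of "x + t n *\<^sub>R e" "t n *\<^sub>R e"] t(1)[of n] e by simp
        then have 2: "x + t n *\<^sub>R e \<notin> supp \<phi>" using R[of "x + t n *\<^sub>R e"] False t(2)[of n] by force
        show ?thesis using not_in_supp[OF 1] not_in_supp[OF 2] False by (simp add: s_def)
      qed
    qed
  qed
  moreover have "(LBINT x. s n x) = 0" for n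
    using lborel_integrable_translate[OF I(2), of "t n *\<^sub>R e"] I(2) lborel_integral_translate[OF m, of "t n *\<^sub>R e"]
    by (simp add: s_def)
  ultimately have "(LBINT x. gradient \<phi> x \<bullet> e) = 0"
    by (simp add: LIMSEQ_const_iff)
  then show "(LBINT x. gradient \<phi> x) \<bullet> e = 0 \<bullet> e"
    using I(1) by simp
qed

subsection \<open>Existence\<close>

lemma GDERIV_at_0_superlinear:
  fixes f :: "'a::euclidean_space \<Rightarrow> real"
  assumes "f 0 = 0" "\<gamma> > 1" "\<And>x. \<bar>f x\<bar> \<le> norm x powr \<gamma>"
  shows "GDERIV f 0 :> 0"
  unfolding gderiv_def
proof (rule has_derivativeI_sandwich[where e=1 and H="\<lambda>x. norm x powr (\<gamma> - 1)"])
  fix y :: 'a assume "y \<noteq> 0"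
  then show "norm (f y - f 0 - (y - 0) \<bullet> 0) / norm (y - 0) \<le> norm y powr (\<gamma> - 1)"
    using assms(1) divide_right_mono[OF assms(3)[of y], of "norm y"] by (simp add: powr_diff)
next
  have "((\<lambda>x::'a. norm x powr (\<gamma> - 1)) \<longlongrightarrow> norm (0::'a) powr (\<gamma> - 1)) (at 0)"
    using assms(2) by (intro tendsto_powr' tendsto_intros) auto
  then show "((\<lambda>x::'a. norm x powr (\<gamma> - 1)) \<longlongrightarrow> 0) (at 0)" by simp
qed auto

text \<open>The formula is also correct at the origin: the factor \<open>x\<close> makes the
  right-hand side 0 whatever the value of \<open>0 powr (\<gamma> - 2)\<close>.\<close>

lemma GDERIV_norm_powr:
  fixes x :: "'a::euclidean_space"
  assumes "x \<noteq> 0 \<or> \<gamma> > 1"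
  shows "GDERIV (\<lambda>x. norm x powr \<gamma>) x :> (\<gamma> * norm x powr (\<gamma> - 2)) *\<^sub>R x"
proof (cases "x = 0")
  case False
  have "GDERIV (\<lambda>x. norm x powr \<gamma>) x :> (\<gamma> * norm x powr (\<gamma> - 1)) *\<^sub>R sgn x"
    using GDERIV_DERIV_compose[OF GDERIV_norm has_real_derivative_powr] False by simp
  moreover have "(\<gamma> * norm x powr (\<gamma> - 1)) *\<^sub>R sgn x = (\<gamma> * norm x powr (\<gamma> - 2)) *\<^sub>R x"
    using False by (simp add: sgn_div_norm powr_diff power2_eq_square divide_simps)
  ultimately show ?thesis by simp
next
  case True
  then show ?thesis using GDERIV_at_0_superlinear[of "\<lambda>x. norm x powr \<gamma>" \<gamma>] assms by auto
qed

text \<open>The field has norm |x| to the power \<open>\<gamma> + 1\<close>, which tends to 0 at the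
  origin. Applied with \<open>\<gamma> = Q - 2\<close>, which may be negative.\<close>

lemma continuous_on_norm_powr_scaleR:
  assumes "\<gamma> > -1"
  shows "continuous_on UNIV (\<lambda>x::'a::euclidean_space. norm x powr \<gamma> *\<^sub>R x)"
proof (rule continuous_at_imp_continuous_on, rule ballI)
  fix x :: 'a
  show "isCont (\<lambda>x. norm x powr \<gamma> *\<^sub>R x) x"
  proof (cases "x = 0")
    case True
    have "((\<lambda>x::'a. norm x powr (\<gamma> + 1)) \<longlongrightarrow> norm (0::'a) powr (\<gamma> + 1)) (at 0)"
      using assms by (intro tendsto_powr' tendsto_intros) auto
    then have lim: "((\<lambda>x::'a. norm x powr (\<gamma> + 1)) \<longlongrightarrow> 0) (at 0)" by simp
    have eq: "norm x powr (\<gamma> + 1) = norm (norm x powr \<gamma> *\<^sub>R x)" for x :: 'a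
      by (cases "x = 0") (simp_all add: powr_add)
    from tendsto_norm_zero_cancel[OF lim[unfolded eq]] show ?thesis using True by (simp add: isCont_def)
  qed (auto intro!: continuous_intros)
qed

text \<open>Two powers of |x| compensate the exponent, one from the coordinate and one from the
  vector; hence the bound -2. Needed for \<open>\<gamma> = \<delta> - 2\<close>.\<close>

lemma continuous_on_component_norm_powr_scaleR:
  assumes "b \<in> Basis" "\<gamma> > -2"
  shows "continuous_on UNIV (\<lambda>x::'a::euclidean_space. ((x \<bullet> b) * norm x powr \<gamma>) *\<^sub>R x)"
proof (rule continuous_at_imp_continuous_on, rule ballI)
  fix x :: 'a
  show "isCont (\<lambda>x. ((x \<bullet> b) * norm x powr \<gamma>) *\<^sub>R x) x"
  proof (cases "x = 0")
    case True
    have "((\<lambda>x::'a. norm x powr (\<gamma> + 2)) \<longlongrightarrow> norm (0::'a) powr (\<gamma> + 2)) (at 0)"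
      using assms by (intro tendsto_powr' tendsto_intros) auto
    then have lim: "((\<lambda>x::'a. norm x powr (\<gamma> + 2)) \<longlongrightarrow> 0) (at 0)" by simp
    have le: "norm (((x \<bullet> b) * norm x powr \<gamma>) *\<^sub>R x) \<le> norm x powr (\<gamma> + 2)" for x :: 'a
    proof (cases "x = 0")
      case False
      have "norm (((x \<bullet> b) * norm x powr \<gamma>) *\<^sub>R x) = \<bar>x \<bullet> b\<bar> * (norm x powr \<gamma> * norm x)"
        by (simp add: abs_mult)
      also have "\<dots> \<le> norm x * (norm x powr \<gamma> * norm x)"
        by (rule mult_right_mono[OF Basis_le_norm[OF assms(1)]]) simp
      also have "\<dots> = norm x powr (\<gamma> + 2)" using False by (simp add: powr_add power2_eq_square)
      finally show ?thesis .
    qed simp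
    have "((\<lambda>x. ((x \<bullet> b) * norm x powr \<gamma>) *\<^sub>R x) \<longlongrightarrow> 0) (at 0)"
      by (rule Lim_null_comparison[OF _ lim]) (simp only: le eventually_True)
    then show ?thesis using True by (simp add: isCont_def)
  qed (auto intro!: continuous_intros)
qed

lemma GDERIV_inner_left: "GDERIV (\<lambda>x::'a::euclidean_space. x \<bullet> b) x :> b"
  unfolding gderiv_def by (auto intro!: derivative_eq_intros)

text \<open>For small \<delta> the factor \<open>norm x powr \<delta>\<close> is not differentiable
  at 0, but the coordinate raises the order of the product to 1 + \<delta>. Such products occur in
  the p-flux of the explicit solution.\<close>

lemma GDERIV_component_norm_powr:
  fixes x :: "'a::euclidean_space"
  assumes "\<delta> > 0" "b \<in> Basis"
  shows "GDERIV (\<lambda>x. (x \<bullet> b) * norm x powr \<delta>) x :>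
    norm x powr \<delta> *\<^sub>R b + ((x \<bullet> b) * (\<delta> * norm x powr (\<delta> - 2))) *\<^sub>R x"
proof (cases "x = 0")
  case False
  show ?thesis
    using GDERIV_mult[OF GDERIV_inner_left GDERIV_norm_powr[of x \<delta>], of b] False
    by (simp add: algebra_simps)
next
  case True
  have "\<bar>(x \<bullet> b) * norm x powr \<delta>\<bar> \<le> norm x powr (\<delta> + 1)" for x :: 'a
  proof (cases "x = 0")
    case False
    have "\<bar>(x \<bullet> b) * norm x powr \<delta>\<bar> = \<bar>x \<bullet> b\<bar> * norm x powr \<delta>" by (simp add: abs_mult)
    also have "\<dots> \<le> norm x * norm x powr \<delta>"
      by (rule mult_right_mono[OF Basis_le_norm[OF assms(2)]]) simp
    finally show ?thesis using False by (simp add: powr_add mult.commute)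
  qed simp
  then show ?thesis
    using GDERIV_at_0_superlinear[of "\<lambda>x. (x \<bullet> b) * norm x powr \<delta>" "\<delta> + 1"] True assms by auto
qed

text \<open>This is \<open>\<integral> div (\<phi> P K x) = 0\<close>. The factor \<open>P\<close> is kept apart because it need not be
  differentiable at the origin, in contrast to \<open>P x\<close>.\<close>

lemma integral_radial_divergence:
  fixes \<phi> K P Pd :: "'a::euclidean_space \<Rightarrow> real"
  assumes phi: "\<phi> \<in> C1_c \<Omega>"
    and P: "\<And>x b. b \<in> Basis \<Longrightarrow> GDERIV (\<lambda>x. (x \<bullet> b) * P x) x :> P x *\<^sub>R b + ((x \<bullet> b) * Pd x) *\<^sub>R x"
    and Pc: "continuous_on UNIV P" "\<And>b. b \<in> Basis \<Longrightarrow> continuous_on UNIV (\<lambda>x. ((x \<bullet> b) * Pd x) *\<^sub>R x)"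
    and K: "\<And>x. GDERIV K x :> K' x" "continuous_on UNIV K'"
  shows "(LBINT x. P x * K x * (x \<bullet> gradient \<phi> x)) =
    - (LBINT x. (real DIM('a) * P x * K x + Pd x * (x \<bullet> x) * K x + P x * (x \<bullet> K' x)) * \<phi> x)" (is ?eq)
    and "integrable lborel (\<lambda>x. P x * K x * (x \<bullet> gradient \<phi> x))" (is ?i1)
    and "integrable lborel (\<lambda>x. (real DIM('a) * P x * K x + Pd x * (x \<bullet> x) * K x + P x * (x \<bullet> K' x)) * \<phi> x)" (is ?i2)
proof -
  note C = C1_cD[OF phi]
  have Kc: "continuous_on UNIV K"
    by (rule GDERIV_continuous_on) (rule K(1))
  \<comment> \<open>\<open>f b\<close> is the b-component of the field \<phi> P K x and
    \<open>g b\<close> is its gradient. The divergence is the sum of the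
    \<open>g b x \<bullet> b\<close>, and each \<open>g b\<close> has integral 0.\<close>
  define f where "f b x = (x \<bullet> b) * P x * K x * \<phi> x" for b x
  define g where "g b x = ((x \<bullet> b) * P x * K x) *\<^sub>R gradient \<phi> x +
      \<phi> x *\<^sub>R (((x \<bullet> b) * P x) *\<^sub>R K' x + K x *\<^sub>R (P x *\<^sub>R b + ((x \<bullet> b) * Pd x) *\<^sub>R x))" for b x
  have fb: "f b \<in> C1_c UNIV" "gradient (f b) = g b" if "b \<in> Basis" for b
  proof -
    have D: "GDERIV (\<lambda>x. (x \<bullet> b) * P x * K x) x :>
       ((x \<bullet> b) * P x) *\<^sub>R K' x + K x *\<^sub>R (P x *\<^sub>R b + ((x \<bullet> b) * Pd x) *\<^sub>R x)" for x
      using GDERIV_mult[OF P[OF that] K(1)] by simp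
    have "\<phi> \<in> C1_c UNIV" using phi C1_c_mono by blast
    note M = C1_c_mult[OF this open_UNIV subset_UNIV D]
    have "continuous_on UNIV (\<lambda>x. ((x \<bullet> b) * P x) *\<^sub>R K' x + K x *\<^sub>R (P x *\<^sub>R b + ((x \<bullet> b) * Pd x) *\<^sub>R x))"
      by (rule Kc K(2) Pc(1) Pc(2)[OF that] continuous_intros)+
    then show "f b \<in> C1_c UNIV" "gradient (f b) = g b" unfolding f_def g_def by (rule M)+
  qed
  have I: "integrable lborel (g b)" "(LBINT x. g b x) = 0" if "b \<in> Basis" for b
    using C1_c_integrable(1)[OF fb(1)[OF that]] integral_gradient_eq_0[OF fb(1)[OF that]] fb(2)[OF that] by auto
  have "(LBINT x. (\<Sum>b\<in>Basis. g b x \<bullet> b)) = 0"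
    using I by (subst Bochner_Integration.integral_sum) (auto intro!: sum.neutral)
  moreover have "(\<Sum>b\<in>Basis. g b x \<bullet> b) = P x * K x * (x \<bullet> gradient \<phi> x) +
     (real DIM('a) * P x * K x + Pd x * (x \<bullet> x) * K x + P x * (x \<bullet> K' x)) * \<phi> x" for x
  proof -
    have e: "g b x \<bullet> b = P x * K x * ((x \<bullet> b) * (gradient \<phi> x \<bullet> b)) + P x * \<phi> x * ((x \<bullet> b) * (K' x \<bullet> b))
       + K x * P x * \<phi> x + K x * Pd x * \<phi> x * ((x \<bullet> b) * (x \<bullet> b))" if "b \<in> Basis" for b
      using that by (simp add: g_def inner_add_left algebra_simps)
    have "(\<Sum>b\<in>Basis. g b x \<bullet> b) = P x * K x * (x \<bullet> gradient \<phi> x) + P x * \<phi> x * (x \<bullet> K' x)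
       + real DIM('a) * (K x * P x * \<phi> x) + K x * Pd x * \<phi> x * (x \<bullet> x)"
      by (simp add: e sum.distrib flip: sum_distrib_left euclidean_inner[of x])
    then show ?thesis by (simp add: algebra_simps)
  qed
  ultimately have z: "(LBINT x. P x * K x * (x \<bullet> gradient \<phi> x) +
     (real DIM('a) * P x * K x + Pd x * (x \<bullet> x) * K x + P x * (x \<bullet> K' x)) * \<phi> x) = 0"
    by simp
  show i1: ?i1
  proof (rule integrable_continuous_compact_support[OF _ C(3)])
    show "continuous_on UNIV (\<lambda>x. P x * K x * (x \<bullet> gradient \<phi> x))"
      by (rule C(2) Pc(1) Kc continuous_intros)+
  qed (simp add: gradient_outside_supp[of _ \<phi>])
  show i2: ?i2
  proof (rule integrable_continuous_compact_support[OF _ C(3)])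
    have "continuous_on UNIV (\<lambda>x. \<Sum>b\<in>Basis. (((x \<bullet> b) * Pd x) *\<^sub>R x) \<bullet> b)"
      by (intro continuous_on_sum continuous_on_inner Pc(2) continuous_on_const)
    also have "(\<lambda>x. \<Sum>b\<in>Basis. (((x \<bullet> b) * Pd x) *\<^sub>R x) \<bullet> b) = (\<lambda>x. Pd x * (x \<bullet> x))"
      by (auto simp: euclidean_inner[of x x for x] sum_distrib_left mult_ac)
    finally have Pdc: "continuous_on UNIV (\<lambda>x. Pd x * (x \<bullet> x))" .
    have "continuous_on UNIV (\<lambda>x. (real DIM('a) * P x * K x + Pd x * (x \<bullet> x) * K x + P x * (x \<bullet> K' x)) * \<phi> x)"
      by (rule C(5) Pc(1) Kc K(2) Pdc continuous_intros)+
    then show "continuous_on UNIV (\<lambda>x. (real DIM('a) * P x * K x + Pd x * (x \<bullet> x) * K x + P x * (x \<bullet> K' x)) * \<phi> x)"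
      by simp
  qed (simp add: not_in_supp[of _ \<phi>])
  show ?eq using z unfolding Bochner_Integration.integral_add[OF i1 i2] by simp
qed

lemma continuous_imp_Lp_loc:
  fixes f :: "'a::euclidean_space \<Rightarrow> 'b::euclidean_space"
  assumes "continuous_on UNIV f" "r > 0" "open \<Omega>"
  shows "f \<in> Lp_loc r \<Omega>"
proof -
  have f: "f \<in> borel_measurable borel" using assms(1) by (rule borel_measurable_continuous_onI)
  have "set_integrable lebesgue K (\<lambda>x. norm (f x) powr r)" if "compact K" for K
  proof -
    have "continuous_on K (\<lambda>x. norm (f x) powr r)"
      using assms by (intro continuous_on_powr') (auto intro!: continuous_intros intro: continuous_on_subset)
    then have "integrable lborel (\<lambda>x. indicator K x *\<^sub>R norm (f x) powr r)"
      using borel_integrable_compact[OF that] by blast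
    then show ?thesis unfolding set_integrable_def
      using integrable_completion borel_measurable_integrable by blast
  qed
  moreover have "(\<lambda>x. indicator \<Omega> x *\<^sub>R f x) \<in> borel_measurable lborel"
    using f assms(3) by (intro borel_measurable_scaleR borel_measurable_indicator) auto
  then have "(\<lambda>x. indicator \<Omega> x *\<^sub>R f x) \<in> borel_measurable lebesgue"
    by (rule measurable_completion)
  ultimately show ?thesis by (simp add: Lp_loc_def set_borel_measurable_def)
qed

lemma set_integral_lebesgue_eq_lborel:
  fixes f :: "'a::euclidean_space \<Rightarrow> 'b::euclidean_space"
  assumes "f \<in> borel_measurable borel" "\<And>x. x \<notin> \<Omega> \<Longrightarrow> f x = 0"
  shows "set_lebesgue_integral lebesgue \<Omega> f = (LBINT x. f x)"
proof -
  have "indicator \<Omega> x *\<^sub>R f x = f x" for x using assms(2) by (simp add: indicator_def)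
  then have "set_lebesgue_integral lebesgue \<Omega> f = (\<integral>x. f x \<partial>lebesgue)"
    unfolding set_lebesgue_integral_def by (intro Bochner_Integration.integral_cong refl)
  also have "\<dots> = (LBINT x. f x)"
    by (rule integral_completion) (use assms(1) in simp)
  finally show ?thesis .
qed

text \<open>Integration by parts is the statement that the gradient of \<open>u \<phi>\<close>,
  again a test function, has integral 0.\<close>

lemma classical_gradient_W1p_loc:
  fixes u :: "'a::euclidean_space \<Rightarrow> real"
  assumes u: "\<And>x. GDERIV u x :> G x" "continuous_on UNIV G" and p: "p > 0" "open \<Omega>"
  shows "W1p_loc p \<Omega> u G"
proof -
  have uc: "continuous_on UNIV u"
    by (rule GDERIV_continuous_on) (rule u(1))
  have "set_lebesgue_integral lebesgue \<Omega> (\<lambda>x. u x *\<^sub>R gradient \<phi> x) =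
       - set_lebesgue_integral lebesgue \<Omega> (\<lambda>x. \<phi> x *\<^sub>R G x)" if phi: "\<phi> \<in> C1_c \<Omega>" for \<phi>
  proof -
    note C = C1_cD[OF phi]
    note o = C1_c_outside[OF phi]
    have M: "(\<lambda>x. u x * \<phi> x) \<in> C1_c \<Omega>"
      "gradient (\<lambda>x. u x * \<phi> x) = (\<lambda>x. u x *\<^sub>R gradient \<phi> x + \<phi> x *\<^sub>R G x)"
      by (rule C1_c_mult[where V=UNIV, OF phi open_UNIV subset_UNIV _ u(2)]; simp only: u(1))+
    have "(LBINT x. u x *\<^sub>R gradient \<phi> x + \<phi> x *\<^sub>R G x) = 0"
      using integral_gradient_eq_0[OF M(1)] by (simp only: M(2))
    moreover have c1: "continuous_on UNIV (\<lambda>x. u x *\<^sub>R gradient \<phi> x)"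
      by (rule uc C(2) continuous_intros)+
    have "integrable lborel (\<lambda>x. u x *\<^sub>R gradient \<phi> x)"
      by (rule integrable_continuous_compact_support[OF c1 C(3)]) (simp add: gradient_outside_supp[of _ \<phi>])
    moreover have c2: "continuous_on UNIV (\<lambda>x. \<phi> x *\<^sub>R G x)"
      by (rule u(2) C(5) continuous_intros)+
    have "integrable lborel (\<lambda>x. \<phi> x *\<^sub>R G x)"
      by (rule integrable_continuous_compact_support[OF c2 C(3)]) (simp add: not_in_supp[of _ \<phi>])
    ultimately have "(LBINT x. u x *\<^sub>R gradient \<phi> x) + (LBINT x. \<phi> x *\<^sub>R G x) = 0"
      by (metis (no_types) Bochner_Integration.integral_add)
    then have "(LBINT x. u x *\<^sub>R gradient \<phi> x) = - (LBINT x. \<phi> x *\<^sub>R G x)"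
      by (simp only: eq_neg_iff_add_eq_0)
    moreover have "set_lebesgue_integral lebesgue \<Omega> (\<lambda>x. u x *\<^sub>R gradient \<phi> x) = (LBINT x. u x *\<^sub>R gradient \<phi> x)"
      by (rule set_integral_lebesgue_eq_lborel[OF borel_measurable_continuous_onI[OF c1]]) (simp add: o)
    moreover have "set_lebesgue_integral lebesgue \<Omega> (\<lambda>x. \<phi> x *\<^sub>R G x) = (LBINT x. \<phi> x *\<^sub>R G x)"
      by (rule set_integral_lebesgue_eq_lborel[OF borel_measurable_continuous_onI[OF c2]]) (simp add: o)
    ultimately show ?thesis by (simp only:)
  qed
  then show ?thesis
    using continuous_imp_Lp_loc[OF uc _ p(2)] continuous_imp_Lp_loc[OF u(2) _ p(2)] p(1)
    by (auto simp: W1p_loc_def has_weak_gradient_def)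
qed

text \<open>Both powers tend to 0 with \<epsilon>; this fixes the amplitude of the explicit
  solution.\<close>

lemma eventually_small_amplitude:
  fixes \<alpha> \<beta> A B :: real
  assumes "\<alpha> > 0" "\<beta> > 0" "A > 0"
  obtains \<epsilon> where "\<epsilon> > 0" "B * \<epsilon> powr \<alpha> + \<epsilon> powr \<beta> \<le> A"
proof -
  have "((\<lambda>\<epsilon>. B * \<epsilon> powr \<alpha> + \<epsilon> powr \<beta>) \<longlongrightarrow> B * 0 powr \<alpha> + 0 powr \<beta>) (at_right 0)"
    using assms by (intro tendsto_intros tendsto_powr') (auto simp: eventually_at_right_less intro!: eventually_mono[OF eventually_at_right_less])
  then have "eventually (\<lambda>\<epsilon>. B * \<epsilon> powr \<alpha> + \<epsilon> powr \<beta> < A) (at_right 0)"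
    using assms by (intro order_tendstoD(2)) auto
  then have "eventually (\<lambda>\<epsilon>. \<epsilon> > 0 \<and> B * \<epsilon> powr \<alpha> + \<epsilon> powr \<beta> < A) (at_right 0)"
    using eventually_at_right_less by eventually_elim auto
  then obtain \<epsilon> where "\<epsilon> > 0 \<and> B * \<epsilon> powr \<alpha> + \<epsilon> powr \<beta> < A"
    using eventually_happens'[OF trivial_limit_at_right_real] by blast
  then show ?thesis by (intro that[of \<epsilon>]) auto
qed


lemma positive_solution_exists:
  fixes \<Omega> :: "'a::euclidean_space set"
  assumes \<Omega>: "open \<Omega>" and pqs: "1 < q" "q < p" "p < s" and qN: "q < real DIM('a)"
    and crit: "s > q * (real DIM('a) - 1) / (real DIM('a) - q)"
  shows "\<exists>u. positive_solution p q s \<Omega> (u :: 'a \<Rightarrow> real)"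
proof -
  text \<open>The conjugate exponent \<open>Q\<close> makes its \<open>q\<close>-flux smooth
    at the origin, and \<open>k\<close> is the exponent for which \<open>-\<Delta>\<^sub>q u\<close> and \<open>u\<^sup>s\<^sup>-\<^sup>1\<close> decay at the same rate.\<close>
  define N where "N = real DIM('a)"
  define Q where "Q = q / (q - 1)"
  define k where "k = (q - 1) / (s - q)"
  define a where "a = (k + 1) * (q - 1)"
  define b where "b = (k + 1) * (p - 1)"
  define \<delta> where "\<delta> = (p - q) / (q - 1)"
  have Q: "Q > 1" using pqs by (simp add: Q_def)
  have k: "k > 0" using pqs by (simp add: k_def)
  have a: "a > 0" and b: "b > 0" using k pqs by (simp_all add: a_def b_def)
  have \<delta>: "\<delta> > 0" using pqs by (simp add: \<delta>_def)
  have aQ: "a * Q = (k + 1) * q" using pqs by (simp add: a_def Q_def)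
  have k1: "k + 1 = (s - 1) / (s - q)" using pqs by (simp add: k_def field_simps)
  have ks: "k * (s - 1) = a" unfolding a_def k1 using pqs by (simp add: k_def)
  \<comment> \<open>The condition on \<open>s\<close> enters here: it is equivalent to
    \<open>a * Q < N\<close>, which makes the divergence of
    \<open>E x powr (- a) *\<^sub>R x\<close> positive.\<close>
  have "q * (N - 1) < s * (N - q)" using crit qN by (simp add: N_def pos_divide_less_eq)
  then have "q * (s - 1) < N * (s - q)" by (simp add: algebra_simps)
  moreover have "a * Q = q * (s - 1) / (s - q)" unfolding aQ k1 by simp
  ultimately have aQN: "a * Q < N" using pqs by (simp add: pos_divide_less_eq)
  \<comment> \<open>After division by \<open>\<epsilon> powr (q - 1)\<close> the q-term supplies the
    right-hand side, the p-term an error of order \<open>\<epsilon> powr (p - q)\<close>, and the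
    nonlinearity \<open>\<epsilon> powr (s - q)\<close>.\<close>
  obtain \<epsilon> where \<epsilon>: "\<epsilon> > 0"
    and small: "((k * Q) powr (p - 1) * (b * Q)) * \<epsilon> powr (p - q) + \<epsilon> powr (s - q)
      \<le> (k * Q) powr (q - 1) * (N - a * Q)"
    using eventually_small_amplitude[of "p - q" "s - q" "(k * Q) powr (q - 1) * (N - a * Q)"
      "(k * Q) powr (p - 1) * (b * Q)"] pqs aQN k Q by auto
  define c where "c = \<epsilon> * k * Q"
  have c: "c > 0" using \<epsilon> k Q by (simp add: c_def)
  define E where "E x = 1 + norm x powr Q" for x :: 'a
  have E1: "E x \<ge> 1" and E0: "E x > 0" and rE: "norm x powr Q \<le> E x" for x
    by (auto simp: E_def add_pos_nonneg)
  have Ec: "continuous_on UNIV (\<lambda>x. E x powr t)" for t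
    using E0 Q unfolding E_def
    by (intro continuous_intros continuous_on_powr') (auto simp: less_imp_neq[symmetric])
  have GE: "GDERIV (\<lambda>x. E x powr t) x :> (t * E x powr (t - 1) * Q) *\<^sub>R (norm x powr (Q - 2) *\<^sub>R x)" for t x
  proof -
    have "GDERIV E x :> 0 + (Q * norm x powr (Q - 2)) *\<^sub>R x"
      unfolding E_def using Q by (intro GDERIV_add GDERIV_const GDERIV_norm_powr) auto
    from GDERIV_DERIV_compose[OF this has_real_derivative_powr[OF E0, where r=t]] show ?thesis
      by (simp add: mult.assoc)
  qed
  have GEc: "continuous_on UNIV (\<lambda>x. (t * E x powr (t - 1) * Q) *\<^sub>R (norm x powr (Q - 2) *\<^sub>R (x::'a)))" for t
    by (rule continuous_on_scaleR[OF _ continuous_on_norm_powr_scaleR])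
       (use Q in \<open>auto intro!: continuous_on_mult continuous_on_const Ec\<close>)
  have xx: "norm x powr t * (x \<bullet> x) = norm x powr (t + 2)" for x :: 'a and t
    by (cases "x = 0") (simp_all add: powr_add dot_square_norm)
  define u where "u x = \<epsilon> * E x powr (- k)" for x
  define G where "G x = (- c * E x powr (- k - 1)) *\<^sub>R (norm x powr (Q - 2) *\<^sub>R x)" for x
  have Gu: "GDERIV u x :> G x" for x
    using GDERIV_mult[OF GDERIV_const[of \<epsilon>] GE[of "- k" x]]
    unfolding u_def G_def c_def by (simp add: mult_ac)
  have Gc: "continuous_on UNIV G"
    unfolding G_def
    by (rule continuous_on_scaleR[OF _ continuous_on_norm_powr_scaleR])
       (use Q in \<open>auto intro!: continuous_on_mult continuous_on_const continuous_on_minus Ec\<close>)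
  have flux: "r_flux r (G x) = (- (c powr (r - 1) * (E x powr (- ((k + 1) * (r - 1)))
       * norm x powr ((Q - 1) * (r - 1) - 1)))) *\<^sub>R x" for r x
  proof (cases "x = 0")
    case False
    have nG: "norm (G x) = c * (E x powr (- (k + 1)) * norm x powr (Q - 1))"
    proof -
      have "norm (G x) = c * E x powr (- k - 1) * (norm x powr (Q - 2) * norm x)"
        using c by (simp add: G_def abs_mult)
      also have "norm x powr (Q - 2) * norm x = norm x powr (Q - 1)"
        using False powr_add[of "norm x" "Q - 2" 1] by simp
      finally have "norm (G x) = c * E x powr (- k - 1) * norm x powr (Q - 1)" .
      moreover have "- k - 1 = - (k + 1)" by simp
      ultimately show ?thesis by (simp only: mult.assoc)
    qed
    have "norm (G x) powr (r - 2) * (c * E x powr (- k - 1) * norm x powr (Q - 2)) =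
       (c powr (r - 2) * c powr 1) * (E x powr (- (k + 1) * (r - 2)) * E x powr (- k - 1)) *
       (norm x powr ((Q - 1) * (r - 2)) * norm x powr (Q - 2))"
      unfolding nG using c E0[of x] by (simp add: powr_mult powr_powr)
    also have "\<dots> = c powr (r - 1) * E x powr (- ((k + 1) * (r - 1))) * norm x powr ((Q - 1) * (r - 1) - 1)"
      unfolding powr_add[symmetric] by (simp add: algebra_simps)
    finally show ?thesis unfolding r_flux_def by (simp add: G_def mult.assoc)
  qed (simp add: r_flux_def G_def)
  \<comment> \<open>For r = q the exponent of \<open>norm x\<close> is 0, because
    \<open>(Q - 1) * (q - 1) = 1\<close>. The origin is split off since
    \<open>0 powr 0 = 0\<close>.\<close>
  have fluxq: "r_flux q (G x) = (- (c powr (q - 1))) *\<^sub>R (E x powr (- a) *\<^sub>R x)" for x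
    unfolding flux using pqs by (cases "x = 0") (simp_all add: Q_def a_def field_simps)
  have "(Q - 1) * (p - 1) - 1 = \<delta>" using pqs by (simp add: Q_def \<delta>_def field_simps)
  then have fluxp: "r_flux p (G x) = (- (c powr (p - 1))) *\<^sub>R ((norm x powr \<delta> * E x powr (- b)) *\<^sub>R x)" for x
    unfolding flux b_def by (simp add: mult_ac)
  \<comment> \<open>\<open>Dq\<close> and \<open>Dp\<close> are the divergences of
    \<open>E^-a x\<close> and \<open>|x|^\<delta> E^-b x\<close>, so the negative q- and
    p-Laplacians of \<open>u\<close> are \<open>c^(q-1) Dq\<close> and
    \<open>c^(p-1) Dp\<close>.\<close>
  define Dq where "Dq x = N * E x powr (- a) - a * Q * (E x powr (- a - 1) * norm x powr Q)" for x
  define Dp where "Dp x = (N + \<delta>) * (norm x powr \<delta> * E x powr (- b))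
     - b * Q * (E x powr (- b - 1) * norm x powr Q * norm x powr \<delta>)" for x
  have D: "\<epsilon> powr (s - 1) * E x powr (- a) \<le> c powr (q - 1) * Dq x + c powr (p - 1) * Dp x" for x
  proof -
    have e1: "E x powr (- t - 1) * norm x powr Q \<le> E x powr (- t)" for t
    proof -
      have "E x powr (- t - 1) * norm x powr Q \<le> E x powr (- t - 1) * E x"
        using rE by (intro mult_left_mono) auto
      also have "\<dots> = E x powr (- t)" using powr_add[of "E x" "- t - 1" 1] E0[of x] by simp
      finally show ?thesis .
    qed
    \<comment> \<open>The p-part must decay at least as fast as \<open>E^-a\<close>, so that one
      small amplitude serves all x. This amounts to \<open>\<delta> / Q <= b - a\<close>.\<close>
    have "norm x powr \<delta> * E x powr (- b) \<le> E x powr (\<delta> / Q) * E x powr (- b)"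
    proof (intro mult_right_mono)
      have "norm x powr \<delta> = (norm x powr Q) powr (\<delta> / Q)" using Q by (simp add: powr_powr)
      also have "\<dots> \<le> E x powr (\<delta> / Q)" using rE[of x] Q \<delta> by (intro powr_mono2) auto
      finally show "norm x powr \<delta> \<le> E x powr (\<delta> / Q)" .
    qed auto
    also have "\<dots> = E x powr (\<delta> / Q - b)" by (simp flip: powr_add)
    also have "\<dots> \<le> E x powr (- a)"
    proof (rule powr_mono[OF _ E1])
      have "\<delta> / Q = (p - q) / q" using pqs by (simp add: \<delta>_def Q_def)
      also have "\<dots> \<le> (p - q) * (k + 1)"
      proof -
        have "1 / q \<le> k + 1" using pqs k by (simp add: divide_le_eq_1 order_trans[of _ 1])
        from mult_left_mono[OF this, of "p - q"] show ?thesis using pqs by simp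
      qed
      also have "\<dots> = b - a" by (simp add: a_def b_def algebra_simps)
      finally show "\<delta> / Q - b \<le> - a" by simp
    qed
    finally have e2: "norm x powr \<delta> * E x powr (- b) \<le> E x powr (- a)" .
    have "Dq x \<ge> N * E x powr (- a) - a * Q * E x powr (- a)"
      unfolding Dq_def using a Q e1[of a] by simp
    then have 1: "c powr (q - 1) * ((N - a * Q) * E x powr (- a)) \<le> c powr (q - 1) * Dq x"
      by (intro mult_left_mono) (auto simp: algebra_simps)
    have "E x powr (- b - 1) * norm x powr Q * norm x powr \<delta> \<le> E x powr (- b) * norm x powr \<delta>"
      using e1[of b] by (intro mult_right_mono) auto
    also have "\<dots> \<le> E x powr (- a)" using e2 by (simp add: mult.commute)
    finally have "b * Q * (E x powr (- b - 1) * norm x powr Q * norm x powr \<delta>) \<le> b * Q * E x powr (- a)"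
      using b Q by (intro mult_left_mono) auto
    moreover have "(N + \<delta>) * (norm x powr \<delta> * E x powr (- b)) \<ge> 0" using \<delta> by (simp add: N_def)
    ultimately have "Dp x \<ge> - (b * Q * E x powr (- a))" unfolding Dp_def by linarith
    then have 2: "c powr (p - 1) * (- (b * Q * E x powr (- a))) \<le> c powr (p - 1) * Dp x"
      by (intro mult_left_mono) auto
    have cr: "c powr (r - 1) = \<epsilon> powr (q - 1) * \<epsilon> powr (r - q) * (k * Q) powr (r - 1)" for r
      using \<epsilon> k Q by (simp add: c_def mult.assoc powr_mult flip: powr_add)
    have "\<epsilon> powr (s - 1) = \<epsilon> powr (q - 1) * \<epsilon> powr (s - q)" by (simp flip: powr_add)
    also have "\<dots> \<le> \<epsilon> powr (q - 1) * ((k * Q) powr (q - 1) * (N - a * Q) - ((k * Q) powr (p - 1) * (b * Q)) * \<epsilon> powr (p - q))"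
      using small by (intro mult_left_mono) auto
    also have "\<dots> = c powr (q - 1) * (N - a * Q) - (c powr (p - 1)) * (b * Q)"
      unfolding cr[of p] cr[of q] using \<epsilon> by (simp add: algebra_simps)
    finally have "\<epsilon> powr (s - 1) * E x powr (- a) \<le> (c powr (q - 1) * (N - a * Q) - (c powr (p - 1)) * (b * Q)) * E x powr (- a)"
      by (intro mult_right_mono) auto
    then show ?thesis using 1 2 by (simp add: algebra_simps)
  qed
  have upow: "u x powr (s - 1) = \<epsilon> powr (s - 1) * E x powr (- a)" for x
    unfolding u_def using \<epsilon> ks by (simp add: powr_mult powr_powr)
  have "continuous_on \<Omega> u"
    by (rule GDERIV_continuous_on) (rule Gu)
  moreover have "u x > 0" for x using \<epsilon> E0[of x] by (simp add: u_def)
  moreover have "W1p_loc p \<Omega> u G"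
    using classical_gradient_W1p_loc[OF Gu Gc] pqs \<Omega> by simp
  moreover have "set_lebesgue_integral lebesgue \<Omega> (\<lambda>x. inner (r_flux p (G x)) (gradient \<phi> x)) +
          set_lebesgue_integral lebesgue \<Omega> (\<lambda>x. inner (r_flux q (G x)) (gradient \<phi> x))
          \<ge> set_lebesgue_integral lebesgue \<Omega> (\<lambda>x. u x powr (s - 1) * \<phi> x)"
    if phi: "\<phi> \<in> C1_c \<Omega>" and pos: "\<And>x. \<phi> x \<ge> 0" for \<phi>
  proof -
    note C = C1_cD[OF phi]
    note o = C1_c_outside[OF phi]
    \<comment> \<open>The q-flux is the case P = 1 with \<open>Pd = 0\<close>; the p-flux takes
      \<open>P = |x|^\<delta>\<close>. In both, \<open>K\<close> is a power of
      \<open>E\<close>.\<close>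
    have Pq: "GDERIV (\<lambda>x. (x \<bullet> e) * 1) x :> 1 *\<^sub>R e + ((x \<bullet> e) * 0) *\<^sub>R x" for e x :: 'a
      using GDERIV_inner_left[of e x] by simp
    have cd: "continuous_on UNIV (\<lambda>x::'a. ((x \<bullet> e) * (\<delta> * norm x powr (\<delta> - 2))) *\<^sub>R x)" if "e \<in> Basis" for e
      using continuous_on_scaleR[OF continuous_on_const continuous_on_component_norm_powr_scaleR[OF that, of "\<delta> - 2"], of \<delta>] \<delta>
      by (simp add: mult_ac)
    have cr: "continuous_on UNIV (\<lambda>x::'a. norm x powr \<delta>)"
      using \<delta> by (intro continuous_on_powr' continuous_intros) auto
    note Ip = integral_radial_divergence[OF phi GDERIV_component_norm_powr[OF \<delta>] cr cd GE GEc, of "- b"]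
    have dq: "(real DIM('a) * 1 * E x powr (- a) + 0 * (x \<bullet> x) * E x powr (- a) +
        1 * (x \<bullet> (- a * E x powr (- a - 1) * Q) *\<^sub>R norm x powr (Q - 2) *\<^sub>R x)) = Dq x" for x
    proof -
      have "x \<bullet> (- a * E x powr (- a - 1) * Q) *\<^sub>R norm x powr (Q - 2) *\<^sub>R x
          = - a * E x powr (- a - 1) * Q * (norm x powr (Q - 2) * (x \<bullet> x))" by simp
      then show ?thesis unfolding xx Dq_def N_def by simp
    qed
    have dp: "real DIM('a) * norm x powr \<delta> * E x powr (- b) + \<delta> * norm x powr (\<delta> - 2) * (x \<bullet> x) * E x powr (- b) +
        norm x powr \<delta> * (x \<bullet> (- b * E x powr (- b - 1) * Q) *\<^sub>R norm x powr (Q - 2) *\<^sub>R x) = Dp x" for x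
    proof -
      have e1: "x \<bullet> (- b * E x powr (- b - 1) * Q) *\<^sub>R norm x powr (Q - 2) *\<^sub>R x
          = - b * E x powr (- b - 1) * Q * norm x powr Q"
        using xx[of x "Q - 2"] by simp
      have e2: "\<delta> * norm x powr (\<delta> - 2) * (x \<bullet> x) = \<delta> * norm x powr \<delta>"
        using xx[of x "\<delta> - 2"] by (simp add: mult.assoc)
      show ?thesis unfolding e1 e2 Dp_def N_def by (simp add: algebra_simps)
    qed
    have IP: "(LBINT x. norm x powr \<delta> * E x powr (- b) * (x \<bullet> gradient \<phi> x)) = - (LBINT x. Dp x * \<phi> x)"
      "integrable lborel (\<lambda>x. Dp x * \<phi> x)"
      using Ip(1,3) unfolding dp by auto
    have IQ: "(LBINT x. E x powr (- a) * (x \<bullet> gradient \<phi> x)) = - (LBINT x. Dq x * \<phi> x)"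
      "integrable lborel (\<lambda>x. Dq x * \<phi> x)"
      using integral_radial_divergence(1,3)[OF phi Pq _ _ GE GEc, of "- a"] unfolding dq by auto
    have c1: "continuous_on UNIV (\<lambda>x. u x powr (s - 1) * \<phi> x)"
      unfolding upow by (intro continuous_on_mult continuous_on_const Ec C(5))
    have c2: "continuous_on UNIV (\<lambda>x. inner (r_flux p (G x)) (gradient \<phi> x))"
      unfolding fluxp by (intro continuous_on_inner continuous_on_scaleR continuous_on_mult continuous_on_const Ec C(2) cr continuous_on_id)
    have c3: "continuous_on UNIV (\<lambda>x. inner (r_flux q (G x)) (gradient \<phi> x))"
      unfolding fluxq by (intro continuous_on_inner continuous_on_scaleR continuous_on_mult continuous_on_const Ec C(2) continuous_on_id)
    have "set_lebesgue_integral lebesgue \<Omega> (\<lambda>x. u x powr (s - 1) * \<phi> x) = (LBINT x. u x powr (s - 1) * \<phi> x)"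
      by (rule set_integral_lebesgue_eq_lborel[OF borel_measurable_continuous_onI[OF c1]]) (simp add: o)
    also have "\<dots> \<le> (LBINT x. c powr (q - 1) * (Dq x * \<phi> x) + c powr (p - 1) * (Dp x * \<phi> x))"
    proof (rule integral_mono)
      show "integrable lborel (\<lambda>x. u x powr (s - 1) * \<phi> x)"
        by (rule integrable_continuous_compact_support[OF c1 C(3)]) (simp add: not_in_supp[of _ \<phi>])
      show "integrable lborel (\<lambda>x. c powr (q - 1) * (Dq x * \<phi> x) + c powr (p - 1) * (Dp x * \<phi> x))"
        using IP(2) IQ(2) by simp
      show "u x powr (s - 1) * \<phi> x \<le> c powr (q - 1) * (Dq x * \<phi> x) + c powr (p - 1) * (Dp x * \<phi> x)" for x
        using mult_right_mono[OF D[of x] pos[of x]] by (simp add: upow algebra_simps)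
    qed
    also have "\<dots> = c powr (q - 1) * (LBINT x. Dq x * \<phi> x) + c powr (p - 1) * (LBINT x. Dp x * \<phi> x)"
      using IP(2) IQ(2) by simp
    also have "c powr (q - 1) * (LBINT x. Dq x * \<phi> x) =
        set_lebesgue_integral lebesgue \<Omega> (\<lambda>x. inner (r_flux q (G x)) (gradient \<phi> x))"
    proof -
      have "set_lebesgue_integral lebesgue \<Omega> (\<lambda>x. inner (r_flux q (G x)) (gradient \<phi> x)) =
        (LBINT x. inner (r_flux q (G x)) (gradient \<phi> x))"
        by (rule set_integral_lebesgue_eq_lborel[OF borel_measurable_continuous_onI[OF c3]]) (simp add: o)
      also have "\<dots> = (LBINT x. - (c powr (q - 1)) * (E x powr (- a) * (x \<bullet> gradient \<phi> x)))"
        unfolding fluxq by (simp add: mult.assoc)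
      also have "\<dots> = - (c powr (q - 1)) * (LBINT x. E x powr (- a) * (x \<bullet> gradient \<phi> x))"
        by (rule integral_mult_right_zero)
      finally show ?thesis unfolding IQ(1) by simp
    qed
    also have "c powr (p - 1) * (LBINT x. Dp x * \<phi> x) =
        set_lebesgue_integral lebesgue \<Omega> (\<lambda>x. inner (r_flux p (G x)) (gradient \<phi> x))"
    proof -
      have "set_lebesgue_integral lebesgue \<Omega> (\<lambda>x. inner (r_flux p (G x)) (gradient \<phi> x)) =
        (LBINT x. inner (r_flux p (G x)) (gradient \<phi> x))"
        by (rule set_integral_lebesgue_eq_lborel[OF borel_measurable_continuous_onI[OF c2]]) (simp add: o)
      also have "\<dots> = (LBINT x. - (c powr (p - 1)) * (norm x powr \<delta> * E x powr (- b) * (x \<bullet> gradient \<phi> x)))"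
        unfolding fluxp by (simp add: mult.assoc)
      also have "\<dots> = - (c powr (p - 1)) * (LBINT x. norm x powr \<delta> * E x powr (- b) * (x \<bullet> gradient \<phi> x))"
        by (rule integral_mult_right_zero)
      finally show ?thesis unfolding IP(1) by simp
    qed
    finally show ?thesis by simp
  qed
  ultimately have "positive_solution p q s \<Omega> u"
    unfolding positive_solution_def by blast
  then show ?thesis by blast
qed

subsection \<open>Mollification\<close>

lemma outer_regular_borel_finite:
  fixes A :: "'a::euclidean_space set"
  assumes "A \<in> sets borel" "emeasure lborel A < \<infinity>" "e > 0"
  obtains U where "open U" "A \<subseteq> U" "emeasure lborel U < \<infinity>" "measure lborel (U - A) < e"
proof -
  obtain U where U: "open U" "A \<subseteq> U" "emeasure lborel (U - A) < ennreal e"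
    using outer_regular_lborel[OF assms(1,3)] by blast
  have "emeasure lborel U = emeasure lborel (U - A) + emeasure lborel A"
    using U assms(1) by (subst plus_emeasure) (auto intro!: arg_cong[where f="emeasure lborel"])
  then have "emeasure lborel U < \<infinity>" using U(3) assms(2) by (simp add: less_top order_less_trans[OF U(3)])
  moreover have "measure lborel (U - A) < e"
    using U(3) assms(3) unfolding measure_def
    by (metis enn2real_less_iff ennreal_less_top less_trans order_less_imp_le top.not_eq_extremum less_irrefl)
  ultimately show ?thesis using that U by blast
qed

definition L1_continuous :: "('a::euclidean_space \<Rightarrow> 'b::euclidean_space) \<Rightarrow> bool" where
  "L1_continuous f \<longleftrightarrow> ((\<lambda>y. \<integral>x. norm (f (x - y) - f x) \<partial>lborel) \<longlongrightarrow> 0) (at 0)"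

lemma lborel_integrable_shift:
  fixes f :: "'a::euclidean_space \<Rightarrow> 'b::{banach, second_countable_topology}"
  assumes "integrable lborel f"
  shows "integrable lborel (\<lambda>x. f (x - c))"
  using lborel_integrable_translate[OF assms, of "- c"] by simp

lemma lborel_integral_shift:
  fixes f :: "'a::euclidean_space \<Rightarrow> 'b::{banach, second_countable_topology}"
  assumes "f \<in> borel_measurable borel"
  shows "(LBINT x. f (x - c)) = (LBINT x. f x)"
  using lborel_integral_translate[OF assms, of "- c"] by simp

text \<open>A three-epsilon split, in which the two approximation errors coincide by translation
  invariance of the integral.\<close>

lemma L1_continuous_approx:
  fixes f :: "'a::euclidean_space \<Rightarrow> 'b::euclidean_space"
  assumes f: "integrable lborel f"
    and g: "\<And>e. e > 0 \<Longrightarrow> \<exists>g. integrable lborel g \<and> L1_continuous g \<and> (LBINT x. norm (f x - g x)) < e"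
  shows "L1_continuous f"
  unfolding L1_continuous_def
proof (rule tendstoI)
  fix e :: real assume e: "e > 0"
  obtain g where g: "integrable lborel g" "L1_continuous g" "(LBINT x. norm (f x - g x)) < e / 3"
    using g[of "e / 3"] e by auto
  have "eventually (\<lambda>y. dist (LBINT x. norm (g (x - y) - g x)) 0 < e / 3) (at 0)"
    using g(2) e unfolding L1_continuous_def by (intro tendstoD) auto
  then show "eventually (\<lambda>y. dist (LBINT x. norm (f (x - y) - f x)) 0 < e) (at 0)"
  proof eventually_elim
    case (elim y)
    note s = lborel_integrable_shift[OF f, of y] lborel_integrable_shift[OF g(1), of y]
    have "(LBINT x. norm (f (x - y) - f x)) \<le>
      (LBINT x. norm (f (x - y) - g (x - y)) + norm (g (x - y) - g x) + norm (f x - g x))"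
    proof (rule integral_mono)
      fix x
      have "f (x - y) - f x = (f (x - y) - g (x - y)) + (g (x - y) - g x) + (g x - f x)" by simp
      then show "norm (f (x - y) - f x) \<le> norm (f (x - y) - g (x - y)) + norm (g (x - y) - g x) + norm (f x - g x)"
        by (metis norm_triangle_le norm_triangle_ineq add_right_mono norm_minus_commute)
    qed (use f g(1) s in auto)
    also have "\<dots> = (LBINT x. norm (f (x - y) - g (x - y))) + (LBINT x. norm (g (x - y) - g x))
        + (LBINT x. norm (f x - g x))"
      using f g(1) s by simp
    also have "(LBINT x. norm (f (x - y) - g (x - y))) = (LBINT x. norm (f x - g x))"
      using f g(1) by (intro lborel_integral_shift[of "\<lambda>x. norm (f x - g x)"]) auto
    finally show ?case using elim g(3) by simp
  qed
qed

lemma L1_continuous_open_indicator: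
  fixes c :: "'b::euclidean_space" and U :: "'a::euclidean_space set"
  assumes U: "open U" "emeasure lborel U < \<infinity>"
  shows "L1_continuous (\<lambda>x. indicator U x *\<^sub>R c)"
proof -
  let ?i = "indicator U :: 'a \<Rightarrow> real"
  have I: "integrable lborel ?i" using U by simp
  note J = lborel_integrable_shift[OF I]
  text \<open>Since \<open>\<tau>\<^sub>y 1\<^sub>U\<close> and \<open>1\<^sub>U\<close> have the same integral, only the positive part of
    \<open>1\<^sub>U - \<tau>\<^sub>y 1\<^sub>U\<close> matters, and it is dominated by \<open>1\<^sub>U\<close>.\<close>
  have "(LBINT x. norm (?i (x - y) - ?i x)) = 2 * (LBINT x. max 0 (?i x - ?i (x - y)))" for y
  proof -
    have "(LBINT x. norm (?i (x - y) - ?i x)) = (LBINT x. 2 * max 0 (?i x - ?i (x - y)) + (?i (x - y) - ?i x))"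
      by (intro Bochner_Integration.integral_cong) (auto simp: max_def)
    also have "\<dots> = 2 * (LBINT x. max 0 (?i x - ?i (x - y))) + ((LBINT x. ?i (x - y)) - (LBINT x. ?i x))"
      using I J[of y] by simp
    also have "(LBINT x. ?i (x - y)) = (LBINT x. ?i x)"
      using I by (intro lborel_integral_shift) auto
    finally show ?thesis by simp
  qed
  moreover have "((\<lambda>y. \<integral>x. max 0 (?i x - ?i (x - y)) \<partial>lborel) \<longlongrightarrow> 0) (at 0)"
    unfolding tendsto_at_iff_sequentially comp_def
  proof (intro allI impI)
    fix y :: "nat \<Rightarrow> 'a" assume y: "y \<longlonglongrightarrow> 0"
    have "(\<lambda>n. \<integral>x. max 0 (?i x - ?i (x - y n)) \<partial>lborel) \<longlonglongrightarrow> (\<integral>x. 0 \<partial>(lborel :: 'a measure))"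
    proof (rule integral_dominated_convergence[where w="?i"])
      show "integrable lborel ?i" by (rule I)
      show "(\<lambda>x. max 0 (?i x - ?i (x - y n))) \<in> borel_measurable lborel" for n
        using borel_measurable_integrable[OF I] borel_measurable_integrable[OF J[of "y n"]] by measurable
      show "AE x in lborel. norm (max 0 (?i x - ?i (x - y n))) \<le> ?i x" for n
        by (rule AE_I2) (auto simp: max_def indicator_def)
      show "AE x in lborel. (\<lambda>n. max 0 (?i x - ?i (x - y n))) \<longlonglongrightarrow> 0"
      proof (rule AE_I2)
        fix x :: 'a
        show "(\<lambda>n. max 0 (?i x - ?i (x - y n))) \<longlonglongrightarrow> 0"
        \<comment> \<open>At points of \<open>U\<close>, openness keeps \<open>x - y n\<close> in
          \<open>U\<close> eventually; elsewhere the positive part is 0 from the start. Thus the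
          boundary of \<open>U\<close> may be arbitrary.\<close>
        proof (cases "x \<in> U")
          case True
          have "(\<lambda>n. x - y n) \<longlonglongrightarrow> x" using tendsto_diff[OF tendsto_const y, of x] by simp
          then have "eventually (\<lambda>n. x - y n \<in> U) sequentially" using U(1) True by (rule topological_tendstoD)
          then have "eventually (\<lambda>n. max 0 (?i x - ?i (x - y n)) = 0) sequentially"
            by eventually_elim (simp add: True)
          then show ?thesis by (rule tendsto_eventually)
        next
          case False
          then show ?thesis by (simp add: indicator_def)
        qed
      qed
    qed simp
    then show "(\<lambda>n. \<integral>x. max 0 (?i x - ?i (x - y n)) \<partial>lborel) \<longlonglongrightarrow> 0" by simp
  qed
  ultimately have "((\<lambda>y. \<integral>x. norm (?i (x - y) - ?i x) \<partial>lborel) \<longlongrightarrow> 0) (at 0)"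
    using tendsto_mult_right_zero by auto
  from tendsto_mult_right_zero[OF this, of "norm c"]
  have "((\<lambda>y. \<integral>x. norm c * norm (?i (x - y) - ?i x) \<partial>lborel) \<longlongrightarrow> 0) (at 0)" by simp
  moreover have "norm c * norm (?i (x - y) - ?i x) = norm (?i (x - y) *\<^sub>R c - ?i x *\<^sub>R c)" for x y
    by (simp flip: scaleR_diff_left)
  ultimately show ?thesis unfolding L1_continuous_def by (simp only:)
qed

text \<open>Sets of finite measure are approximated from outside by open sets, for which the claim
  is known; sums use the triangle inequality, and limits use approximation in L^1.\<close>

lemma L1_continuous_integrable:
  fixes f :: "'a::euclidean_space \<Rightarrow> 'b::euclidean_space"
  assumes "integrable lborel f"
  shows "L1_continuous f"
  using assms
proof (induction rule: integrable_induct)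
  case (base A c)
  show ?case
  proof (rule L1_continuous_approx)
    show "integrable lborel (\<lambda>x. indicator A x *\<^sub>R c)" using base by simp
    fix e :: real assume e: "e > 0"
    obtain U where U: "open U" "A \<subseteq> U" "emeasure lborel U < \<infinity>" "measure lborel (U - A) < e / (norm c + 1)"
      using outer_regular_borel_finite[of A "e / (norm c + 1)"] base e by (auto simp: add_nonneg_pos)
    have UA: "U - A \<in> sets borel" "emeasure lborel (U - A) < \<infinity>"
      using U base emeasure_mono[of "U - A" U lborel] by (auto intro: le_less_trans)
    have "norm (indicator A x *\<^sub>R c - indicator U x *\<^sub>R c) = norm c * indicator (U - A) x" for x
      using U(2) by (auto simp: indicator_def)
    then have "(LBINT x. norm (indicator A x *\<^sub>R c - indicator U x *\<^sub>R c)) = norm c * measure lborel (U - A)"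
      using UA by simp
    also have "\<dots> \<le> norm c * (e / (norm c + 1))" using U(4) by (intro mult_left_mono) auto
    also have "\<dots> < e" using e mult_strict_left_mono[of "norm c" "norm c + 1" e]
      by (subst times_divide_eq_right, subst pos_divide_less_eq) (auto simp: add_nonneg_pos mult.commute)
    finally show "\<exists>g. integrable lborel g \<and> L1_continuous g \<and>
        (LBINT x. norm (indicator A x *\<^sub>R c - g x)) < e"
      using U L1_continuous_open_indicator[OF U(1,3), of c] by (intro exI[of _ "\<lambda>x. indicator U x *\<^sub>R c"]) auto
  qed
next
  case (add f g)
  have s: "integrable lborel (\<lambda>x. f (x - y))" "integrable lborel (\<lambda>x. g (x - y))" for y
    using add.hyps by (simp_all only: lborel_integrable_shift)
  have "((\<lambda>y. (LBINT x. norm (f (x - y) - f x)) + (LBINT x. norm (g (x - y) - g x))) \<longlongrightarrow> 0 + 0) (at 0)"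
    using add.IH unfolding L1_continuous_def by (rule tendsto_add)
  then have lim: "((\<lambda>y. (LBINT x. norm (f (x - y) - f x)) + (LBINT x. norm (g (x - y) - g x))) \<longlongrightarrow> 0) (at 0)"
    by (simp only: add_0)
  have le: "(LBINT x. norm (f (x - y) + g (x - y) - (f x + g x))) \<le>
     (LBINT x. norm (f (x - y) - f x)) + (LBINT x. norm (g (x - y) - g x))" for y
  proof -
    have "(LBINT x. norm (f (x - y) + g (x - y) - (f x + g x))) \<le>
      (LBINT x. norm (f (x - y) - f x) + norm (g (x - y) - g x))"
    proof (rule integral_mono)
      show "norm (f (x - y) + g (x - y) - (f x + g x)) \<le> norm (f (x - y) - f x) + norm (g (x - y) - g x)" for x
        by (rule norm_diff_triangle_ineq)
    qed (use add.hyps s[of y] in \<open>simp_all\<close>)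
    also have "\<dots> = (LBINT x. norm (f (x - y) - f x)) + (LBINT x. norm (g (x - y) - g x))"
      using add.hyps s[of y] by (intro Bochner_Integration.integral_add) simp_all
    finally show ?thesis .
  qed
  show ?case unfolding L1_continuous_def
    by (rule tendsto_sandwich[OF _ _ tendsto_const lim]; rule always_eventually, rule allI)
       (rule le Bochner_Integration.integral_nonneg norm_ge_zero)+
next
  case (lim f s)
  show ?case
  proof (rule L1_continuous_approx[OF lim.hyps(4)])
    fix e :: real assume e: "e > 0"
    \<comment> \<open>The approximants satisfy \<open>norm (s n x) \<le> 2 * norm (f x)\<close>,
      hence the factor 3 in the dominating function.\<close>
    have "(\<lambda>n. \<integral>x. norm (f x - s n x) \<partial>lborel) \<longlonglongrightarrow> (\<integral>x. 0 \<partial>(lborel :: 'a measure))"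
    proof (rule integral_dominated_convergence[where w="\<lambda>x. 3 * norm (f x)"])
      show "integrable lborel (\<lambda>x. 3 * norm (f x))" using lim.hyps(4) by simp
      show "(\<lambda>x. norm (f x - s n x)) \<in> borel_measurable lborel" for n
        using lim.hyps(1)[of n] lim.hyps(4) by auto
      show "AE x in lborel. (\<lambda>n. norm (f x - s n x)) \<longlonglongrightarrow> 0"
      proof (rule AE_I2)
        fix x :: 'a
        show "(\<lambda>n. norm (f x - s n x)) \<longlonglongrightarrow> 0"
        proof -
          have "(\<lambda>n. norm (f x - s n x)) \<longlonglongrightarrow> norm (f x - f x)"
            by (intro tendsto_norm tendsto_diff tendsto_const lim.hyps(2)) simp
          then show ?thesis by simp
        qed
      qed
      show "AE x in lborel. norm (norm (f x - s n x)) \<le> 3 * norm (f x)" for n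
      proof (rule AE_I2)
        fix x :: 'a
        show "norm (norm (f x - s n x)) \<le> 3 * norm (f x)"
          using lim.hyps(3)[of x n] norm_triangle_ineq4[of "f x" "s n x"] by simp
      qed
    qed simp
    then have "eventually (\<lambda>n. (LBINT x. norm (f x - s n x)) < e) sequentially"
      using e by (intro order_tendstoD(2)[of _ 0]) auto
    then obtain n where "(LBINT x. norm (f x - s n x)) < e"
      by (auto simp: eventually_sequentially)
    then show "\<exists>g. integrable lborel g \<and> L1_continuous g \<and> (LBINT x. norm (f x - g x)) < e"
      using lim.hyps(1) lim.IH by blast
  qed
qed

text \<open>Transfers continuity of translations from \<open>L\<^sup>1\<close> to \<open>L\<^sup>p\<close>, applied to \<open>|f|\<^sup>p\<^sup>-\<^sup>1 f\<close>.\<close>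

lemma norm_diff_powr_le:
  fixes a b :: "'a::real_inner"
  assumes "p \<ge> 1"
  shows "norm (a - b) powr p \<le> 2 powr p * norm (norm a powr (p - 1) *\<^sub>R a - norm b powr (p - 1) *\<^sub>R b)"
proof (cases "a = b")
  case False
  define \<alpha> where "\<alpha> = norm a powr (p - 1)"
  define \<beta> where "\<beta> = norm b powr (p - 1)"
  have d: "norm (a - b) > 0" using False by simp
  \<comment> \<open>Both \<open>t powr (p - 1)\<close> and the square increase with t, so the two
    differences have the same sign. With the polarisation identity below this gives strong
    monotonicity of the map \<open>norm a powr (p - 1) *\<^sub>R a\<close>.\<close>
  have "(\<alpha> - \<beta>) * ((norm a)\<^sup>2 - (norm b)\<^sup>2) \<ge> 0"
  proof (cases "norm a \<le> norm b")
    case True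
    then show ?thesis using assms
      by (intro mult_nonpos_nonpos) (auto simp: \<alpha>_def \<beta>_def intro!: powr_mono2 power_mono)
  next
    case False
    then show ?thesis using assms
      by (intro mult_nonneg_nonneg) (auto simp: \<alpha>_def \<beta>_def intro!: powr_mono2 power_mono)
  qed
  moreover have "2 * ((\<alpha> *\<^sub>R a - \<beta> *\<^sub>R b) \<bullet> (a - b)) = (\<alpha> + \<beta>) * (norm (a - b))\<^sup>2 + (\<alpha> - \<beta>) * ((norm a)\<^sup>2 - (norm b)\<^sup>2)"
    by (simp add: power2_norm_eq_inner inner_diff_left inner_diff_right inner_commute algebra_simps)
  ultimately have 1: "(\<alpha> + \<beta>) * (norm (a - b))\<^sup>2 \<le> 2 * ((\<alpha> *\<^sub>R a - \<beta> *\<^sub>R b) \<bullet> (a - b))" by simp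
  also have "\<dots> \<le> 2 * (norm (\<alpha> *\<^sub>R a - \<beta> *\<^sub>R b) * norm (a - b))"
    using norm_cauchy_schwarz by (intro mult_left_mono) auto
  finally have "((\<alpha> + \<beta>) * norm (a - b)) * norm (a - b) \<le> (2 * norm (\<alpha> *\<^sub>R a - \<beta> *\<^sub>R b)) * norm (a - b)"
    by (simp add: power2_eq_square mult_ac)
  then have 2: "(\<alpha> + \<beta>) * norm (a - b) \<le> 2 * norm (\<alpha> *\<^sub>R a - \<beta> *\<^sub>R b)"
    using d by (simp only: mult_le_cancel_right_pos)
  \<comment> \<open>The longer of the two vectors has at least half the norm of
    \<open>a - b\<close>.\<close>
  have "(norm (a - b) / 2) powr (p - 1) \<le> \<alpha> + \<beta>"
  proof (cases "norm a \<le> norm b")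
    case True
    have "norm (a - b) / 2 \<le> norm b" using True norm_triangle_ineq4[of a b] by simp
    then have "(norm (a - b) / 2) powr (p - 1) \<le> \<beta>" using assms by (auto simp: \<beta>_def intro!: powr_mono2)
    then show ?thesis by (simp add: \<alpha>_def add.commute add_increasing2)
  next
    case False
    have "norm (a - b) / 2 \<le> norm a" using False norm_triangle_ineq4[of a b] by simp
    then have "(norm (a - b) / 2) powr (p - 1) \<le> \<alpha>" using assms by (auto simp: \<alpha>_def intro!: powr_mono2)
    then show ?thesis by (simp add: \<beta>_def add_increasing2)
  qed
  then have "(norm (a - b) / 2) powr (p - 1) * norm (a - b) \<le> (\<alpha> + \<beta>) * norm (a - b)"
    by (rule mult_right_mono) simp
  with 2 have "(norm (a - b) / 2) powr (p - 1) * norm (a - b) \<le> 2 * norm (\<alpha> *\<^sub>R a - \<beta> *\<^sub>R b)"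
    by linarith
  moreover have "norm (a - b) powr p = 2 powr (p - 1) * ((norm (a - b) / 2) powr (p - 1) * norm (a - b))"
    using d powr_add[of "norm (a - b)" "p - 1" 1] by (simp add: powr_divide)
  ultimately have "norm (a - b) powr p \<le> 2 powr (p - 1) * (2 * norm (\<alpha> *\<^sub>R a - \<beta> *\<^sub>R b))"
    by (metis mult_left_mono powr_ge_zero)
  also have "\<dots> = 2 powr p * norm (\<alpha> *\<^sub>R a - \<beta> *\<^sub>R b)" using powr_add[of 2 "p - 1" 1] by simp
  finally show ?thesis by (simp add: \<alpha>_def \<beta>_def)
qed simp

lemma Lp_translation_continuous:
  fixes f :: "'a::euclidean_space \<Rightarrow> 'b::euclidean_space"
  assumes p: "p \<ge> 1" and f[measurable]: "f \<in> borel_measurable borel"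
    and fp: "integrable lborel (\<lambda>x. norm (f x) powr p)" and e: "e > 0"
  obtains d where "d > 0" "\<And>y. norm y < d \<Longrightarrow> (\<integral>\<^sup>+x. ennreal (norm (f (x - y) - f x) powr p) \<partial>lborel) \<le> ennreal e"
proof -
  define F where "F x = norm (f x) powr (p - 1) *\<^sub>R f x" for x
  have Fn: "norm (F x) = norm (f x) powr p" for x
    unfolding F_def by (cases "f x = 0") (use powr_add[of "norm (f x)" "p - 1" 1] in auto)
  have F[measurable]: "F \<in> borel_measurable borel" unfolding F_def by measurable
  have IF: "integrable lborel F"
    by (rule Bochner_Integration.integrable_bound[OF fp]) (auto simp: Fn)
  have "eventually (\<lambda>y. dist (LBINT x. norm (F (x - y) - F x)) 0 < e / 2 powr p) (at 0)"
    using L1_continuous_integrable[OF IF] e unfolding L1_continuous_def by (intro tendstoD) auto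
  then obtain d where d: "d > 0" and
    D: "\<And>y. y \<noteq> 0 \<Longrightarrow> norm y < d \<Longrightarrow> (LBINT x. norm (F (x - y) - F x)) < e / 2 powr p"
    by (auto simp: eventually_at dist_norm)
  have "(\<integral>\<^sup>+x. ennreal (norm (f (x - y) - f x) powr p) \<partial>lborel) \<le> ennreal e" if y: "norm y < d" for y
  proof (cases "y = 0")
    case False
    have I: "integrable lborel (\<lambda>x. norm (F (x - y) - F x))"
      using IF lborel_integrable_shift[OF IF, of y] by simp
    have "(\<integral>\<^sup>+x. ennreal (norm (f (x - y) - f x) powr p) \<partial>lborel) \<le>
       (\<integral>\<^sup>+x. ennreal (2 powr p * norm (F (x - y) - F x)) \<partial>lborel)"
      using norm_diff_powr_le[OF p] unfolding F_def by (intro nn_integral_mono ennreal_leI) auto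
    also have "\<dots> = ennreal (2 powr p * (LBINT x. norm (F (x - y) - F x)))"
      using I by (subst nn_integral_eq_integral) auto
    also have "\<dots> \<le> ennreal e" using D[OF False y] by (intro ennreal_leI) (simp add: field_simps)
    finally show ?thesis .
  qed simp
  then show ?thesis using that d by blast
qed

section \<open>Bump functions, mollifiers and differentiation of convolutions\<close>

lemma DERIV_pos_part_power:
  fixes t :: real
  assumes "n \<ge> 2"
  shows "DERIV (\<lambda>t. max 0 t ^ n) t :> real n * max 0 t ^ (n - 1)"
proof -
  consider "t > 0" | "t < 0" | "t = 0" by linarith
  then show ?thesis
  proof cases
    case 1
    have "DERIV (\<lambda>t. t ^ n) t :> real n * t ^ (n - 1)" by (auto intro!: derivative_eq_intros)
    then have "DERIV (\<lambda>t. max 0 t ^ n) t :> real n * t ^ (n - 1)"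
      by (rule has_field_derivative_transform_within_open[where S="{0<..}"]) (use 1 in auto)
    then show ?thesis using 1 by simp
  next
    case 2
    have "DERIV (\<lambda>t. 0) t :> 0" by simp
    then have "DERIV (\<lambda>t. max 0 t ^ n) t :> 0"
      by (rule has_field_derivative_transform_within_open[where S="{..<0}"]) (use 2 assms in auto)
    then show ?thesis using 2 assms by (simp add: max_def power_0_left)
  next
    case 3
    have "((\<lambda>h::real. max 0 h ^ (n - 1)) \<longlongrightarrow> max 0 0 ^ (n - 1)) (at 0)"
      by (intro tendsto_intros)
    moreover have "max 0 0 ^ (n - 1) = (0::real)" using assms by (simp add: power_0_left)
    ultimately have lim: "((\<lambda>h::real. max 0 h ^ (n - 1)) \<longlongrightarrow> 0) (at 0)" by (simp only:)
    have eq: "max 0 h ^ (n - 1) = max 0 h ^ n / h" if "h \<noteq> 0" for h :: real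
      using that assms by (cases "h > 0") (auto simp: max_def power_eq_if)
    have "eventually (\<lambda>h::real. max 0 h ^ (n - 1) = max 0 h ^ n / h) (at 0)"
      unfolding eventually_at using eq by (intro exI[of _ 1]) auto
    then have "((\<lambda>h::real. max 0 h ^ n / h) \<longlongrightarrow> 0) (at 0)"
      by (rule Lim_transform_eventually[OF lim])
    then show ?thesis using 3 assms by (simp add: DERIV_def power_0_left)
  qed
qed

text \<open>A power of a truncated paraboloid instead of a smooth bump: its gradient is an explicit
  multiple of the next lower power. If z is the base, Young's inequality leaves
  \<open>z powr (n - r)\<close>, so a large exponent \<open>n\<close> allows cutoff errors to be
  absorbed.\<close>

definition bump :: "'a::euclidean_space \<Rightarrow> real \<Rightarrow> nat \<Rightarrow> 'a \<Rightarrow> real" where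
  "bump c \<rho> n x = max 0 (1 - (norm (x - c) / \<rho>)\<^sup>2) ^ n"

lemma bump_nonneg: "bump c \<rho> n x \<ge> 0"
  by (simp add: bump_def)

lemma bump_eq_0:
  assumes "\<rho> > 0" "n > 0" "norm (x - c) \<ge> \<rho>"
  shows "bump c \<rho> n x = 0"
proof -
  have "(norm (x - c) / \<rho>)\<^sup>2 \<ge> 1" using assms by (intro one_le_power) (simp add: le_divide_eq_1)
  then have "max 0 (1 - (norm (x - c) / \<rho>)\<^sup>2) = 0" by (intro max_absorb1) linarith
  then show ?thesis using assms by (simp add: bump_def)
qed

lemma bump_C1_c:
  fixes c :: "'a::euclidean_space"
  assumes \<rho>: "\<rho> > 0" and n: "n \<ge> 2" and sub: "cball c \<rho> \<subseteq> \<Omega>"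
  shows "bump c \<rho> n \<in> C1_c \<Omega>"
    and "gradient (bump c \<rho> n) = (\<lambda>x. (- (2 * real n / \<rho>\<^sup>2) * bump c \<rho> (n - 1) x) *\<^sub>R (x - c))"
proof -
  have G: "GDERIV (bump c \<rho> n) x :> (- (2 * real n / \<rho>\<^sup>2) * bump c \<rho> (n - 1) x) *\<^sub>R (x - c)" for x
  proof -
    have "GDERIV (\<lambda>x. 1 - (norm (x - c) / \<rho>)\<^sup>2) x :> (- 2 / \<rho>\<^sup>2) *\<^sub>R (x - c)"
    proof -
      have "GDERIV (\<lambda>x. (x - c) \<bullet> (x - c)) x :> 2 *\<^sub>R (x - c)"
        unfolding gderiv_def by (auto intro!: derivative_eq_intros simp: inner_commute)
      from GDERIV_diff[OF GDERIV_const[of 1] GDERIV_mult[OF GDERIV_const[of "1 / \<rho>\<^sup>2"] this]]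
      show ?thesis by (simp add: power_divide power2_norm_eq_inner)
    qed
    from GDERIV_DERIV_compose[OF this DERIV_pos_part_power[OF n]]
    show ?thesis unfolding bump_def by (simp add: mult_ac)
  qed
  have cb: "continuous_on UNIV (bump c \<rho> m)" for m
    unfolding bump_def using \<rho> by (intro continuous_intros) auto
  have Gc: "continuous_on UNIV (\<lambda>x. (- (2 * real n / \<rho>\<^sup>2) * bump c \<rho> (n - 1) x) *\<^sub>R (x - c))"
    by (intro continuous_intros cb)
  have out: "bump c \<rho> n x = 0" if "x \<notin> cball c \<rho>" for x
    using that bump_eq_0[OF \<rho>, of n x c] n by (auto simp: dist_norm norm_minus_commute)
  show "bump c \<rho> n \<in> C1_c \<Omega>"
    by (rule C1_cI(1)[OF G Gc compact_cball sub]) (rule out)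
  show "gradient (bump c \<rho> n) = (\<lambda>x. (- (2 * real n / \<rho>\<^sup>2) * bump c \<rho> (n - 1) x) *\<^sub>R (x - c))"
    by (rule C1_cI(2)[OF G Gc compact_cball sub]) (rule out)
qed

lemma bump_ge_inside:
  assumes "\<rho> > 0" "norm (x - c) \<le> \<rho> / 2"
  shows "bump c \<rho> n x \<ge> (3/4) ^ n"
proof -
  have "(norm (x - c) / \<rho>)\<^sup>2 \<le> (1/2)\<^sup>2" using assms by (intro power_mono) (auto simp: field_simps)
  then have "3 / 4 \<le> max 0 (1 - (norm (x - c) / \<rho>)\<^sup>2)" by (simp add: power2_eq_square le_max_iff_disj)
  then show ?thesis unfolding bump_def by (rule power_mono) simp
qed

lemma measure_ball_eq:
  fixes c :: "'a::euclidean_space"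
  assumes "r \<ge> 0"
  shows "measure lborel (ball c r) = unit_ball_vol (DIM('a)) * r ^ DIM('a)"
  using emeasure_ball[OF assms, of c] assms by (simp add: measure_def)

lemma bump_integral_ge:
  fixes c :: "'a::euclidean_space"
  assumes "\<rho> > 0" "n \<ge> 2"
  shows "(LBINT x. bump c \<rho> n x) \<ge> (3/4) ^ n * unit_ball_vol (DIM('a)) * (\<rho> / 2) ^ DIM('a)"
proof -
  have "(3/4) ^ n * measure lborel (ball c (\<rho> / 2)) = (LBINT x. (3/4) ^ n * indicator (ball c (\<rho> / 2)) x)"
    by simp
  also have "\<dots> \<le> (LBINT x. bump c \<rho> n x)"
  proof (rule integral_mono)
    show "integrable lborel (\<lambda>x. (3/4) ^ n * indicator (ball c (\<rho> / 2)) x :: real)"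
      using emeasure_ball[of "\<rho> / 2" c] assms by simp
    show "integrable lborel (bump c \<rho> n)"
      using C1_c_integrable(2) bump_C1_c(1)[OF assms subset_UNIV] by blast
    show "(3/4) ^ n * indicator (ball c (\<rho> / 2)) x \<le> bump c \<rho> n x" for x
      using bump_ge_inside[OF assms(1), of x c n] bump_nonneg[of c \<rho> n x]
      by (cases "x \<in> ball c (\<rho> / 2)") (simp_all add: dist_norm norm_minus_commute)
  qed
  finally show ?thesis using assms measure_ball_eq[of "\<rho> / 2" c] by simp
qed

definition mollifier :: "real \<Rightarrow> ('a::euclidean_space \<Rightarrow> real) \<Rightarrow> bool" where
  "mollifier \<epsilon> j \<longleftrightarrow> j \<in> C1_c UNIV \<and> (\<forall>y. j y \<ge> 0) \<and> (\<forall>y. norm y \<ge> \<epsilon> \<longrightarrow> j y = 0) \<and> (LBINT y. j y) = 1"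

lemma mollifier_exists:
  assumes "\<epsilon> > 0"
  shows "\<exists>j :: 'a::euclidean_space \<Rightarrow> real. mollifier \<epsilon> j"
proof -
  define I where "I = (LBINT y. bump (0::'a) \<epsilon> 2 y)"
  have "I > 0"
    unfolding I_def by (rule less_le_trans[OF _ bump_integral_ge]) (use assms in \<open>auto intro!: mult_pos_pos\<close>)
  define j where "j y = (1 / I) * bump (0::'a) \<epsilon> 2 y" for y
  note b = bump_C1_c(1)[OF assms order_refl[of 2] subset_UNIV, of "0::'a"]
  have "j \<in> C1_c UNIV"
    unfolding j_def by (rule C1_c_mult(1)[OF b open_UNIV subset_UNIV GDERIV_const continuous_on_const])
  moreover have "j y \<ge> 0" for y using \<open>I > 0\<close> bump_nonneg[of "0::'a"] by (simp add: j_def)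
  moreover have "j y = 0" if "norm y \<ge> \<epsilon>" for y using bump_eq_0[OF assms, of 2 y "0::'a"] that by (simp add: j_def)
  moreover have "(LBINT y. j y) = 1"
    using \<open>I > 0\<close> by (simp add: j_def I_def[symmetric])
  ultimately show ?thesis unfolding mollifier_def by blast
qed

lemma C1_c_gradient_uniformly_continuous:
  fixes j :: "'a::euclidean_space \<Rightarrow> real"
  assumes j: "j \<in> C1_c \<Omega>" and e: "e > 0"
  obtains d where "d > 0" "\<And>x y. norm (x - y) < d \<Longrightarrow> norm (gradient j x - gradient j y) < e"
proof -
  note C = C1_cD[OF j]
  obtain R where R: "\<And>x. x \<in> supp j \<Longrightarrow> norm x \<le> R"
    using C(3) compact_imp_bounded bounded_iff by metis
  have "uniformly_continuous_on (cball 0 (R + 1)) (gradient j)"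
    by (rule compact_uniformly_continuous[OF continuous_on_subset[OF C(2)]]) auto
  then obtain d where d: "d > 0"
    "\<And>x y. norm x \<le> R + 1 \<Longrightarrow> norm y \<le> R + 1 \<Longrightarrow> dist y x < d \<Longrightarrow> dist (gradient j y) (gradient j x) < e"
    unfolding uniformly_continuous_on_def using e by (metis mem_cball_0)
  \<comment> \<open>Two points at distance below 1 either both lie in the ball of radius
    \<open>R + 1\<close> or both lie off the support.\<close>
  have "norm (gradient j x - gradient j y) < e" if xy: "norm (x - y) < min d 1" for x y
  proof (cases "norm x \<le> R + 1 \<and> norm y \<le> R + 1")
    case True
    then show ?thesis using d(2)[of y x] xy by (simp add: dist_norm)
  next
    case False
    then have "norm x > R" "norm y > R"
      using xy norm_triangle_ineq2[of x y] norm_triangle_ineq2[of y x] by (auto simp: norm_minus_commute)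
    then have "x \<notin> supp j" "y \<notin> supp j" using R by force+
    then show ?thesis using e by (simp add: gradient_outside_supp)
  qed
  then show ?thesis using that[of "min d 1"] d(1) by auto
qed

lemma integrable_bounded_mult:
  fixes f :: "'a::euclidean_space \<Rightarrow> 'b::euclidean_space" and g :: "'a \<Rightarrow> real"
  assumes "integrable lborel f" "g \<in> borel_measurable borel" "\<And>x. \<bar>g x\<bar> \<le> L"
  shows "integrable lborel (\<lambda>x. g x *\<^sub>R f x)"
proof (rule Bochner_Integration.integrable_bound)
  show "integrable lborel (\<lambda>x. L *\<^sub>R f x)" using assms(1) by simp
  have "\<bar>g x\<bar> * norm (f x) \<le> \<bar>L\<bar> * norm (f x)" for x
    using assms(3)[of x] by (intro mult_right_mono) auto
  then show "AE x in lborel. norm (g x *\<^sub>R f x) \<le> norm (L *\<^sub>R f x)" by simp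
qed (use assms in measurable)

lemma integrable_bounded_mult_vec:
  fixes f :: "'a::euclidean_space \<Rightarrow> real" and g :: "'a \<Rightarrow> 'b::euclidean_space"
  assumes "integrable lborel f" "g \<in> borel_measurable borel" "\<And>x. norm (g x) \<le> L"
  shows "integrable lborel (\<lambda>x. f x *\<^sub>R g x)"
proof (rule Bochner_Integration.integrable_bound)
  show "integrable lborel (\<lambda>x. L * f x)" using assms(1) by simp
  have "\<bar>f x\<bar> * norm (g x) \<le> \<bar>f x\<bar> * \<bar>L\<bar>" for x
    using assms(3)[of x] by (intro mult_left_mono) auto
  then show "AE x in lborel. norm (f x *\<^sub>R g x) \<le> norm (L * f x)" by (simp add: abs_mult mult.commute)
qed (use assms in measurable)

text \<open>The modulus of continuity of the gradient bounds the remainder uniformly in the base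
  point, as is required for integrating it against an L^1 function.\<close>

lemma C1_c_taylor:
  fixes j :: "'a::euclidean_space \<Rightarrow> real"
  assumes j: "j \<in> C1_c \<Omega>" and d: "\<And>x y. norm (x - y) < d \<Longrightarrow> norm (gradient j x - gradient j y) < e"
    and h: "norm (z' - z) < d"
  shows "\<bar>j z' - j z - (z' - z) \<bullet> gradient j z\<bar> \<le> e * norm (z' - z)"
proof -
  have "norm (j z' - j z - (\<lambda>h. h \<bullet> gradient j z) (z' - z)) \<le> norm (z' - z) * e"
  proof (rule differentiable_bound_linearization[where S="ball z d" and f'="\<lambda>x h. h \<bullet> gradient j x"])
    show "z + t *\<^sub>R (z' - z) \<in> ball z d" if "t \<in> {0..1}" for t
      using that h mult_left_le_one_le[of "norm (z' - z)" t] by (simp add: dist_norm)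
    show "(j has_derivative (\<lambda>h. h \<bullet> gradient j x)) (at x within ball z d)" for x
      using C1_cD(1)[OF j, of x] unfolding gderiv_def by (rule has_derivative_at_withinI)
    show "z \<in> ball z d" using h norm_ge_zero[of "z' - z"] by (simp del: norm_ge_zero)
    fix x assume "x \<in> ball z d"
    then have g: "norm (gradient j x - gradient j z) < e" by (intro d) (simp add: dist_norm norm_minus_commute)
    show "onorm ((\<lambda>h. h \<bullet> gradient j x) - (\<lambda>h. h \<bullet> gradient j z)) \<le> e"
    proof (rule onorm_bound)
      show "0 \<le> e" using g norm_ge_zero[of "gradient j x - gradient j z"] by linarith
      fix h
      have "norm (h \<bullet> (gradient j x - gradient j z)) \<le> norm h * norm (gradient j x - gradient j z)"
        using Cauchy_Schwarz_ineq2 by simp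
      also have "\<dots> \<le> norm h * e" using g by (intro mult_left_mono) auto
      finally show "norm (((\<lambda>h. h \<bullet> gradient j x) - (\<lambda>h. h \<bullet> gradient j z)) h) \<le> e * norm h"
        by (simp add: inner_diff_right mult.commute)
    qed
  qed
  then show ?thesis by (simp add: mult.commute)
qed

lemma GDERIV_convolution:
  fixes f j :: "'a::euclidean_space \<Rightarrow> real"
  assumes f: "integrable lborel f" and j: "j \<in> C1_c \<Omega>"
  shows "GDERIV (\<lambda>x. \<integral>y. f y * j (x - y) \<partial>lborel) x :> (LBINT y. f y *\<^sub>R gradient j (x - y))"
    and "continuous_on UNIV (\<lambda>x. \<integral>y. f y *\<^sub>R gradient j (x - y) \<partial>lborel)"
proof -
  note C = C1_cD[OF j]
  obtain L where L: "\<And>x. norm (gradient j x) \<le> L" "\<And>x. \<bar>j x\<bar> \<le> L" using C1_c_bounded[OF j] by metis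
  have [measurable]: "j \<in> borel_measurable borel" "gradient j \<in> borel_measurable borel"
    by (rule C(6,7))+
  have Ij: "integrable lborel (\<lambda>y. f y * j (x - y))" for x
    using integrable_bounded_mult_vec[OF f, of "\<lambda>y. j (x - y)" L] L by simp
  have Ig: "integrable lborel (\<lambda>y. f y *\<^sub>R gradient j (x - y))" for x
    using integrable_bounded_mult_vec[OF f, of "\<lambda>y. gradient j (x - y)" L] L by simp
  \<comment> \<open>The L^1 norm plus 1, so that division by \<open>A\<close> is possible also when
    \<open>f\<close> is null.\<close>
  define A where "A = (LBINT y. \<bar>f y\<bar>) + 1"
  have A: "A > 0" unfolding A_def by (intro add_nonneg_pos Bochner_Integration.integral_nonneg) auto
  have fA: "(LBINT y. \<bar>f y\<bar> * c) \<le> A * c" if "c \<ge> 0" for c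
    using that f by (simp add: A_def algebra_simps)
  show "GDERIV (\<lambda>x. \<integral>y. f y * j (x - y) \<partial>lborel) x :> (LBINT y. f y *\<^sub>R gradient j (x - y))"
    unfolding gderiv_def has_derivative_at_alt
  proof (intro conjI allI impI)
    fix e :: real assume e: "e > 0"
    obtain d where d: "d > 0" "\<And>x y. norm (x - y) < d \<Longrightarrow> norm (gradient j x - gradient j y) < e / A"
      using C1_c_gradient_uniformly_continuous[OF j, of "e / A"] e A by auto
    have "norm ((LBINT y. f y * j (x' - y)) - (LBINT y. f y * j (x - y))
        - (x' - x) \<bullet> (LBINT y. f y *\<^sub>R gradient j (x - y))) \<le> e * norm (x' - x)" if x': "norm (x' - x) < d" for x'
    proof -
      have "(x' - x) \<bullet> (LBINT y. f y *\<^sub>R gradient j (x - y)) = (LBINT y. f y * ((x' - x) \<bullet> gradient j (x - y)))"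
        using Ig[of x] by (simp flip: integral_inner_right)
      moreover have "integrable lborel (\<lambda>y. f y * ((x' - x) \<bullet> gradient j (x - y)))"
        using integrable_inner_right[OF Ig[of x], of "x' - x"] by simp
      ultimately have "(LBINT y. f y * j (x' - y)) - (LBINT y. f y * j (x - y))
        - (x' - x) \<bullet> (LBINT y. f y *\<^sub>R gradient j (x - y)) =
        (LBINT y. f y * (j (x' - y) - j (x - y) - (x' - x) \<bullet> gradient j (x - y)))"
        using Ij[of x] Ij[of x'] by (simp add: right_diff_distrib)
      also have "norm \<dots> \<le> (LBINT y. \<bar>f y\<bar> * (e / A * norm (x' - x)))"
      proof (rule Bochner_Integration.integral_norm_bound_integral)
        show "integrable lborel (\<lambda>y. f y * (j (x' - y) - j (x - y) - (x' - x) \<bullet> gradient j (x - y)))"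
          using Ij[of x] Ij[of x'] \<open>integrable lborel (\<lambda>y. f y * ((x' - x) \<bullet> gradient j (x - y)))\<close>
          by (simp add: right_diff_distrib)
        show "integrable lborel (\<lambda>y. \<bar>f y\<bar> * (e / A * norm (x' - x)))" using f by simp
        fix y
        have "\<bar>j (x' - y) - j (x - y) - (x' - x) \<bullet> gradient j (x - y)\<bar> \<le> e / A * norm (x' - x)"
          using C1_c_taylor[OF j d(2), where z'="x' - y" and z="x - y"] x' by simp
        then show "norm (f y * (j (x' - y) - j (x - y) - (x' - x) \<bullet> gradient j (x - y))) \<le> \<bar>f y\<bar> * (e / A * norm (x' - x))"
          by (simp only: real_norm_def abs_mult mult_left_mono abs_ge_zero)
      qed
      also have "\<dots> \<le> A * (e / A * norm (x' - x))" using e A by (intro fA) auto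
      also have "\<dots> = e * norm (x' - x)" using A by simp
      finally show ?thesis .
    qed
    then show "\<exists>d>0. \<forall>x'. norm (x' - x) < d \<longrightarrow> norm ((LBINT y. f y * j (x' - y)) - (LBINT y. f y * j (x - y))
        - (x' - x) \<bullet> (LBINT y. f y *\<^sub>R gradient j (x - y))) \<le> e * norm (x' - x)"
      using d(1) by blast
  qed (rule bounded_linear_inner_left)
  show "continuous_on UNIV (\<lambda>x. \<integral>y. f y *\<^sub>R gradient j (x - y) \<partial>lborel)"
    unfolding continuous_on_iff
  proof (intro ballI allI impI)
    fix x :: 'a and e :: real assume e: "e > 0"
    obtain d where d: "d > 0" "\<And>x y. norm (x - y) < d \<Longrightarrow> norm (gradient j x - gradient j y) < e / (2 * A)"
      using C1_c_gradient_uniformly_continuous[OF j, of "e / (2 * A)"] e A by auto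
    have "dist (LBINT y. f y *\<^sub>R gradient j (x' - y)) (LBINT y. f y *\<^sub>R gradient j (x - y)) < e"
      if "dist x' x < d" for x'
    proof -
      have "(LBINT y. f y *\<^sub>R gradient j (x' - y)) - (LBINT y. f y *\<^sub>R gradient j (x - y)) =
         (LBINT y. f y *\<^sub>R (gradient j (x' - y) - gradient j (x - y)))"
        using Ig[of x] Ig[of x'] by (simp add: scaleR_diff_right)
      also have "norm \<dots> \<le> (LBINT y. \<bar>f y\<bar> * (e / (2 * A)))"
      proof (rule Bochner_Integration.integral_norm_bound_integral)
        show "integrable lborel (\<lambda>y. f y *\<^sub>R (gradient j (x' - y) - gradient j (x - y)))"
          using Ig[of x] Ig[of x'] by (simp add: scaleR_diff_right)
        show "integrable lborel (\<lambda>y. \<bar>f y\<bar> * (e / (2 * A)))" using f by simp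
        fix y
        have "norm (gradient j (x' - y) - gradient j (x - y)) \<le> e / (2 * A)"
          using d(2)[of "x' - y" "x - y"] that by (simp add: dist_norm)
        then show "norm (f y *\<^sub>R (gradient j (x' - y) - gradient j (x - y))) \<le> \<bar>f y\<bar> * (e / (2 * A))"
          by (simp only: norm_scaleR mult_left_mono abs_ge_zero)
      qed
      also have "\<dots> \<le> A * (e / (2 * A))" using e A by (intro fA) auto
      also have "\<dots> < e" using A e by simp
      finally show ?thesis by (simp add: dist_norm)
    qed
    then show "\<exists>d>0. \<forall>x'\<in>UNIV. dist x' x < d \<longrightarrow>
        dist (LBINT y. f y *\<^sub>R gradient j (x' - y)) (LBINT y. f y *\<^sub>R gradient j (x - y)) < e"
      using d(1) by blast
  qed
qed


text \<open>Young's inequality without optimal constants: if \<open>B <= A v\<close> the first term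
  suffices, otherwise \<open>v < B / A\<close> and the second does. \<open>A\<close> is the
  coefficient of the gradient term that has to absorb the cross term.\<close>

lemma young_powr:
  fixes A B v r :: real
  assumes "v \<ge> 0" "B \<ge> 0" "A > 0" "r > 1"
  shows "B * v powr (r - 1) \<le> A * v powr r + B powr r * A powr (1 - r)"
proof (cases "B \<le> A * v")
  case True
  have "B * v powr (r - 1) \<le> A * v * v powr (r - 1)" using True by (intro mult_right_mono) auto
  also have "\<dots> = A * v powr r"
    using assms powr_add[of v "r - 1" 1] by (cases "v = 0") (auto simp: mult_ac)
  also have "\<dots> \<le> A * v powr r + B powr r * A powr (1 - r)" by simp
  finally show ?thesis .
next
  case False
  then have B: "B > 0" using assms mult_nonneg_nonneg[of A v] by linarith
  have "v \<le> B / A" using False assms by (simp add: field_simps)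
  then have "B * v powr (r - 1) \<le> B * (B / A) powr (r - 1)"
    using assms by (intro mult_left_mono powr_mono2) auto
  also have "\<dots> = (B powr 1 * B powr (r - 1)) * A powr (- (r - 1))"
  proof -
    have "A powr (- (r - 1)) = inverse (A powr (r - 1))" by (rule powr_minus)
    then show ?thesis using assms B by (simp add: powr_divide field_simps)
  qed
  also have "\<dots> = B powr r * A powr (1 - r)" unfolding powr_add[symmetric] by simp
  also have "\<dots> \<le> A * v powr r + B powr r * A powr (1 - r)" using assms by simp
  finally show ?thesis .
qed

section \<open>Convergence of mollifications\<close>

lemma lborel_distr_reflect:
  fixes x :: "'a::euclidean_space"
  shows "distr lborel borel (\<lambda>y. x - y) = lborel"
  using lborel_affine[of "- 1" x] by (simp add: density_1)

lemma nn_integral_reflect: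
  fixes g :: "'a::euclidean_space \<Rightarrow> ennreal"
  assumes [measurable]: "g \<in> borel_measurable borel"
  shows "(\<integral>\<^sup>+y. g (x - y) \<partial>lborel) = (\<integral>\<^sup>+y. g y \<partial>lborel)"
proof -
  have "(\<integral>\<^sup>+y. g y \<partial>lborel) = (\<integral>\<^sup>+y. g y \<partial>distr lborel borel (\<lambda>y. x - y))"
    by (simp only: lborel_distr_reflect)
  also have "\<dots> = (\<integral>\<^sup>+y. g (x - y) \<partial>lborel)" by (subst nn_integral_distr) auto
  finally show ?thesis by simp
qed

lemma mollifier_reflect:
  assumes "mollifier \<epsilon> j"
  shows "integrable lborel (\<lambda>y. j (x - y))" "(LBINT y. j (x - y)) = 1" "(\<integral>\<^sup>+y. ennreal (j y) \<partial>lborel) = 1"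
proof -
  have C: "j \<in> C1_c UNIV" "\<And>y. j y \<ge> 0" "(LBINT y. j y) = 1" using assms by (auto simp: mollifier_def)
  have [measurable]: "j \<in> borel_measurable borel"
    by (rule C1_cD(6)[OF C(1)])
  have I: "integrable lborel j" by (rule C1_c_integrable[OF C(1)])
  have "integrable (distr lborel borel (\<lambda>y. x - y)) j" using I by (simp only: lborel_distr_reflect)
  then show "integrable lborel (\<lambda>y. j (x - y))" by (subst (asm) integrable_distr_eq) auto
  have "(LBINT y. j y) = (\<integral>y. j y \<partial>distr lborel borel (\<lambda>y. x - y))"
    by (simp only: lborel_distr_reflect)
  also have "\<dots> = (LBINT y. j (x - y))" by (subst integral_distr) auto
  finally show "(LBINT y. j (x - y)) = 1" using C(3) by simp
  show "(\<integral>\<^sup>+y. ennreal (j y) \<partial>lborel) = 1" using nn_integral_eq_integral[OF I] C by simp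
qed

text \<open>The kernel has integral 1, so \<open>f x\<close> can be put under the integral; the
  reflection of y into x - y then turns the error into an average of translation
  differences.\<close>

lemma mollify_norm_diff_le:
  fixes f :: "'a::euclidean_space \<Rightarrow> 'b::euclidean_space"
  assumes f: "integrable lborel f" and j: "mollifier \<epsilon> j"
  shows "ennreal (norm ((LBINT y. j (x - y) *\<^sub>R f y) - f x)) \<le>
    (\<integral>\<^sup>+y. ennreal (j y) * ennreal (norm (f (x - y) - f x)) \<partial>lborel)"
proof -
  have C: "j \<in> C1_c UNIV" "\<And>y. j y \<ge> 0" using j by (auto simp: mollifier_def)
  have [measurable]: "j \<in> borel_measurable borel" "f \<in> borel_measurable borel"
    using C1_cD(6)[OF C(1)] borel_measurable_integrable[OF f] by auto
  obtain L where L: "\<And>x. \<bar>j x\<bar> \<le> L" using C1_c_bounded[OF C(1)] by metis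
  note R = mollifier_reflect[OF j]
  have I1: "integrable lborel (\<lambda>y. j (x - y) *\<^sub>R f y)"
    using integrable_bounded_mult[OF f, of "\<lambda>y. j (x - y)" L] L by simp
  have I2: "integrable lborel (\<lambda>y. j (x - y) *\<^sub>R f x)" using R(1) by simp
  have "(LBINT y. j (x - y) *\<^sub>R f y) - f x = (LBINT y. j (x - y) *\<^sub>R f y - j (x - y) *\<^sub>R f x)"
    using I1 I2 R(1,2) by simp
  then have "(LBINT y. j (x - y) *\<^sub>R f y) - f x = (LBINT y. j (x - y) *\<^sub>R (f y - f x))"
    by (simp only: scaleR_diff_right)
  moreover have "integrable lborel (\<lambda>y. j (x - y) *\<^sub>R (f y - f x))"
    unfolding scaleR_diff_right using I1 I2 by (rule Bochner_Integration.integrable_diff)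
  ultimately have "ennreal (norm ((LBINT y. j (x - y) *\<^sub>R f y) - f x)) \<le> (\<integral>\<^sup>+y. norm (j (x - y) *\<^sub>R (f y - f x)) \<partial>lborel)"
    using integral_norm_bound_ennreal by metis
  also have "\<dots> = (\<integral>\<^sup>+y. ennreal (j (x - y)) * ennreal (norm (f (x - (x - y)) - f x)) \<partial>lborel)"
    using C(2) by (intro nn_integral_cong) (simp add: ennreal_mult)
  also have "\<dots> = (\<integral>\<^sup>+y. ennreal (j y) * ennreal (norm (f (x - y) - f x)) \<partial>lborel)"
    by (rule nn_integral_reflect[of "\<lambda>y. ennreal (j y) * ennreal (norm (f (x - y) - f x))"]) measurable
  finally show ?thesis .
qed

text \<open>The weight \<open>V powr (p - 1)\<close> is the growth of the flux, so this is the form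
  in which convergence of mollified gradients is needed. Young's inequality separates
  \<open>V\<close> from the translation differences; after the integrals are exchanged, the latter
  are small by continuity of translations in L^p.\<close>

lemma mollify_Lp_limit:
  fixes f :: "'a::euclidean_space \<Rightarrow> 'b::euclidean_space" and V :: "'a \<Rightarrow> real"
  assumes p: "p > 1" and f: "integrable lborel f" and fp: "integrable lborel (\<lambda>x. norm (f x) powr p)"
    and V[measurable]: "V \<in> borel_measurable borel" and V0: "\<And>x. V x \<ge> 0"
    and Vp: "integrable lborel (\<lambda>x. V x powr p)"
    and j: "\<And>n. mollifier (\<epsilon> n) (j n)" and \<epsilon>: "\<epsilon> \<longlonglongrightarrow> 0" and \<delta>: "\<delta> > 0"
  shows "eventually (\<lambda>n. (\<integral>\<^sup>+x. ennreal (V x powr (p - 1) * norm ((LBINT y. j n (x - y) *\<^sub>R f y) - f x)) \<partial>lborel)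
    \<le> ennreal \<delta>) sequentially"
proof -
  have [measurable]: "f \<in> borel_measurable borel" using borel_measurable_integrable[OF f] by simp
  define A where "A = (LBINT x. V x powr p) + 1"
  have A: "A > 0" unfolding A_def by (intro add_nonneg_pos Bochner_Integration.integral_nonneg) auto
  \<comment> \<open>\<eta> and \<open>e\<close> are chosen so that each of the two summands from
    Young's inequality contributes at most \<open>\<delta> / 2\<close>.\<close>
  define \<eta> where "\<eta> = \<delta> / (2 * A)"
  have \<eta>: "\<eta> > 0" using A \<delta> by (simp add: \<eta>_def)
  define e where "e = \<delta> / 2 / \<eta> powr (1 - p)"
  have e: "e > 0" using \<eta> \<delta> by (simp add: e_def)
  obtain d where d: "d > 0" "\<And>y. norm y < d \<Longrightarrow> (\<integral>\<^sup>+x. ennreal (norm (f (x - y) - f x) powr p) \<partial>lborel) \<le> ennreal e"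
    using Lp_translation_continuous[of p f e] p fp e by auto
  let ?F = "\<lambda>x y. ennreal (\<eta> * V x powr p) + ennreal (\<eta> powr (1 - p) * norm (f (x - y) - f x) powr p)"
  let ?N = "\<lambda>n x. norm ((LBINT y. j n (x - y) *\<^sub>R f y) - f x)"
  have "eventually (\<lambda>n. \<epsilon> n < d) sequentially" using \<epsilon> d(1) by (rule order_tendstoD(2))
  then show ?thesis
  proof eventually_elim
    case (elim n)
    have C: "j n \<in> C1_c UNIV" "\<And>y. j n y \<ge> 0" "\<And>y. norm y \<ge> d \<Longrightarrow> j n y = 0"
      using j[of n] elim by (auto simp: mollifier_def)
    have [measurable]: "j n \<in> borel_measurable borel"
      by (rule C1_cD(6)[OF C(1)])
    have "(\<integral>\<^sup>+x. ennreal (V x powr (p - 1) * ?N n x) \<partial>lborel) \<le>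
      (\<integral>\<^sup>+x. (\<integral>\<^sup>+y. ennreal (j n y) * ?F x y \<partial>lborel) \<partial>lborel)"
    proof (rule nn_integral_mono)
      fix x :: 'a
      have "ennreal (V x powr (p - 1) * ?N n x) \<le>
        ennreal (V x powr (p - 1)) * (\<integral>\<^sup>+y. ennreal (j n y) * ennreal (norm (f (x - y) - f x)) \<partial>lborel)"
        unfolding ennreal_mult'[OF powr_ge_zero]
        by (rule mult_left_mono[OF mollify_norm_diff_le[OF f j]]) simp
      also have "\<dots> = (\<integral>\<^sup>+y. ennreal (V x powr (p - 1)) * (ennreal (j n y) * ennreal (norm (f (x - y) - f x))) \<partial>lborel)"
        by (rule nn_integral_cmult[symmetric]) measurable
      also have "\<dots> \<le> (\<integral>\<^sup>+y. ennreal (j n y) * ?F x y \<partial>lborel)"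
      proof (rule nn_integral_mono)
        fix y :: 'a
        have "norm (f (x - y) - f x) * V x powr (p - 1) \<le> \<eta> * V x powr p + norm (f (x - y) - f x) powr p * \<eta> powr (1 - p)"
          using young_powr[OF V0 norm_ge_zero \<eta> p] .
        then have "ennreal (V x powr (p - 1)) * ennreal (norm (f (x - y) - f x)) \<le>
          ?F x y"
          using \<eta> by (simp add: ennreal_mult'[symmetric] ennreal_plus[symmetric] mult.commute del: ennreal_plus)
        then have "ennreal (j n y) * (ennreal (V x powr (p - 1)) * ennreal (norm (f (x - y) - f x))) \<le>
          ennreal (j n y) * ?F x y"
          by (rule mult_left_mono) simp
        then show "ennreal (V x powr (p - 1)) * (ennreal (j n y) * ennreal (norm (f (x - y) - f x))) \<le>
          ennreal (j n y) * ?F x y"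
          by (simp only: mult.left_commute)
      qed
      finally show "ennreal (V x powr (p - 1) * ?N n x) \<le>
        (\<integral>\<^sup>+y. ennreal (j n y) * ?F x y \<partial>lborel)" .
    qed
    also have "\<dots> = (\<integral>\<^sup>+y. (\<integral>\<^sup>+x. ennreal (j n y) * ?F x y \<partial>lborel) \<partial>lborel)"
      by (rule lborel_pair.Fubini'[symmetric]) measurable
    also have "\<dots> \<le> (\<integral>\<^sup>+y. ennreal (j n y) * ennreal \<delta> \<partial>(lborel :: 'a measure))"
    proof (rule nn_integral_mono)
      fix y :: 'a
      show "(\<integral>\<^sup>+x. ennreal (j n y) * ?F x y \<partial>lborel)
        \<le> ennreal (j n y) * ennreal \<delta>"
      proof (cases "norm y < d")
        case True
        have "(\<integral>\<^sup>+x. ?F x y \<partial>lborel)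
          = (\<integral>\<^sup>+x. ennreal (\<eta> * V x powr p) \<partial>lborel) + (\<integral>\<^sup>+x. ennreal (\<eta> powr (1 - p) * norm (f (x - y) - f x) powr p) \<partial>lborel)"
          by (rule nn_integral_add) measurable
        also have "(\<integral>\<^sup>+x. ennreal (\<eta> * V x powr p) \<partial>lborel) = ennreal (\<eta> * (LBINT x. V x powr p))"
          using Vp \<eta> by (subst nn_integral_eq_integral) auto
        also have "\<dots> \<le> ennreal (\<delta> / 2)"
        proof (rule ennreal_leI)
          have "\<eta> * (LBINT x. V x powr p) \<le> \<eta> * A" unfolding A_def using \<eta> by (intro mult_left_mono) auto
          also have "\<dots> = \<delta> / 2" using A by (simp add: \<eta>_def)
          finally show "\<eta> * (LBINT x. V x powr p) \<le> \<delta> / 2" .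
        qed
        also have "(\<integral>\<^sup>+x. ennreal (\<eta> powr (1 - p) * norm (f (x - y) - f x) powr p) \<partial>lborel)
          = ennreal (\<eta> powr (1 - p)) * (\<integral>\<^sup>+x. ennreal (norm (f (x - y) - f x) powr p) \<partial>lborel)"
          unfolding ennreal_mult'[OF powr_ge_zero] by (rule nn_integral_cmult) measurable
        also have "\<dots> \<le> ennreal (\<eta> powr (1 - p)) * ennreal e" by (rule mult_left_mono[OF d(2)[OF True]]) simp
        also have "\<dots> = ennreal (\<delta> / 2)" using \<eta> e by (simp add: e_def ennreal_mult'[symmetric])
        also have "ennreal (\<delta> / 2) + ennreal (\<delta> / 2) = ennreal \<delta>"
          using \<delta> by (subst ennreal_plus[symmetric]) auto
        finally have le: "(\<integral>\<^sup>+x. ?F x y \<partial>lborel) \<le> ennreal \<delta>"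
          by (simp add: add_mono)
        show ?thesis by (subst nn_integral_cmult) (auto intro!: mult_left_mono le)
      next
        case False
        then show ?thesis using C(3)[of y] by simp
      qed
    qed
    also have "\<dots> = (\<integral>\<^sup>+y. ennreal (j n y) \<partial>lborel) * ennreal \<delta>" by (rule nn_integral_multc) measurable
    also have "\<dots> = ennreal \<delta>" using mollifier_reflect(3)[OF j[of n]] by simp
    finally show ?case .
  qed
qed

subsection \<open>Composite test functions\<close>

text \<open>Componentwise reduction to the real case; it serves to replace a Lebesgue measurable
  weak gradient by a Borel one.\<close>

lemma completion_ex_borel_measurable_euclidean:
  fixes g :: "'a \<Rightarrow> 'b::euclidean_space"
  assumes g: "g \<in> borel_measurable (completion M)"
  shows "\<exists>g'\<in>borel_measurable M. (AE x in M. g x = g' x)"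
proof -
  have "\<forall>b\<in>Basis. \<exists>g'\<in>borel_measurable M. (AE x in M. g x \<bullet> b = g' x)"
    using g by (intro ballI completion_ex_borel_measurable_real) auto
  then have "\<forall>b\<in>Basis. \<exists>g'. g' \<in> borel_measurable M \<and> (AE x in M. g x \<bullet> b = g' x)"
    unfolding Bex_def .
  from bchoice[OF this] obtain f where f: "\<forall>b\<in>Basis. f b \<in> borel_measurable M \<and> (AE x in M. g x \<bullet> b = f b x)"
    by blast
  have "(\<lambda>x. \<Sum>b\<in>Basis. f b x *\<^sub>R b) \<in> borel_measurable M"
    by (intro borel_measurable_sum borel_measurable_scaleR borel_measurable_const) (simp add: f)
  moreover have "AE x in M. \<forall>b\<in>Basis. g x \<bullet> b = f b x"
    using f by (subst AE_ball_countable) (simp_all add: countable_finite)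
  then have "AE x in M. g x = (\<Sum>b\<in>Basis. f b x *\<^sub>R b)"
  proof eventually_elim
    case (elim x)
    have "g x = (\<Sum>b\<in>Basis. (g x \<bullet> b) *\<^sub>R b)" by (rule euclidean_representation[symmetric])
    also have "\<dots> = (\<Sum>b\<in>Basis. f b x *\<^sub>R b)" using elim by (intro sum.cong) auto
    finally show ?case .
  qed
  ultimately show ?thesis by (intro bexI)
qed

lemma borel_measurable_r_flux [measurable]:
  "r_flux r \<in> borel_measurable (borel :: 'a::euclidean_space measure)"
  unfolding r_flux_def by measurable

lemma norm_r_flux: "norm (r_flux r v) = norm v powr (r - 1)"
  using powr_add[of "norm v" "r - 2" 1] by (cases "v = 0") (auto simp: r_flux_def)

lemma r_flux_inner_self: "r_flux r v \<bullet> v = norm v powr r"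
  using powr_add[of "norm v" "r - 2" 2]
  by (cases "v = 0") (auto simp: r_flux_def power2_norm_eq_inner[symmetric])

lemma set_integral_lebesgue_eq_lborel_AE:
  fixes f g :: "'a::euclidean_space \<Rightarrow> 'b::euclidean_space"
  assumes "g \<in> borel_measurable borel" "AE x in lborel. indicator \<Omega> x *\<^sub>R f x = g x"
  shows "set_lebesgue_integral lebesgue \<Omega> f = (LBINT x. g x)"
proof -
  have g: "g \<in> borel_measurable lebesgue" using assms(1) by (intro measurable_completion) simp
  have ae: "AE x in lebesgue. indicator \<Omega> x *\<^sub>R f x = g x" using assms(2) by (rule AE_completion)
  have f: "(\<lambda>x. indicator \<Omega> x *\<^sub>R f x) \<in> borel_measurable lebesgue"
    by (rule borel_measurable_AE[OF g]) (use ae in auto)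
  have "set_lebesgue_integral lebesgue \<Omega> f = (\<integral>x. g x \<partial>lebesgue)"
    unfolding set_lebesgue_integral_def by (rule integral_cong_AE[OF f g ae])
  also have "\<dots> = (LBINT x. g x)" by (rule integral_completion) (use assms(1) in simp)
  finally show ?thesis .
qed

text \<open>The working form of a positive solution: the gradient is a Borel function and all
  integrals run over the whole space with respect to \<open>lborel\<close>. This is legitimate
  because test functions and their gradients vanish off \<Omega> and null sets do not affect the
  integrals.\<close>

locale supersolution =
  fixes \<Omega> :: "'a::euclidean_space set" and u :: "'a \<Rightarrow> real" and G :: "'a \<Rightarrow> 'a" and p q s :: real
  assumes open_dom: "open \<Omega>" and q1: "1 < q" and qp: "q < p"
    and cont: "continuous_on \<Omega> u" and pos: "\<And>x. x \<in> \<Omega> \<Longrightarrow> u x > 0"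
    and G_meas [measurable]: "G \<in> borel_measurable borel"
    and G_int: "\<And>K. compact K \<Longrightarrow> K \<subseteq> \<Omega> \<Longrightarrow> integrable lborel (\<lambda>x. indicator K x * norm (G x) powr p)"
    and weak: "\<And>\<phi>. \<phi> \<in> C1_c \<Omega> \<Longrightarrow>
      (LBINT x. u x *\<^sub>R gradient \<phi> x) = - (LBINT x. \<phi> x *\<^sub>R G x)"
    and ineq: "\<And>\<phi>. \<phi> \<in> C1_c \<Omega> \<Longrightarrow> (\<And>x. \<phi> x \<ge> 0) \<Longrightarrow>
      (LBINT x. r_flux p (G x) \<bullet> gradient \<phi> x) + (LBINT x. r_flux q (G x) \<bullet> gradient \<phi> x)
      \<ge> (LBINT x. u x powr (s - 1) * \<phi> x)"

lemma positive_solution_supersolution: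
  fixes \<Omega> :: "'a::euclidean_space set"
  assumes sol: "positive_solution p q s \<Omega> u" and pq: "open \<Omega>" "1 < q" "q < p"
  obtains G where "supersolution \<Omega> u G p q s"
proof -
  obtain G where cont: "continuous_on \<Omega> u" and pos: "\<And>x. x \<in> \<Omega> \<Longrightarrow> u x > 0"
    and W: "W1p_loc p \<Omega> u G"
    and ineq: "\<And>\<phi>. \<phi> \<in> C1_c \<Omega> \<Longrightarrow> (\<And>x. \<phi> x \<ge> 0) \<Longrightarrow>
          set_lebesgue_integral lebesgue \<Omega> (\<lambda>x. inner (r_flux p (G x)) (gradient \<phi> x)) +
          set_lebesgue_integral lebesgue \<Omega> (\<lambda>x. inner (r_flux q (G x)) (gradient \<phi> x))
          \<ge> set_lebesgue_integral lebesgue \<Omega> (\<lambda>x. u x powr (s - 1) * \<phi> x)"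
    using sol unfolding positive_solution_def by blast
  have Gm: "(\<lambda>x. indicator \<Omega> x *\<^sub>R G x) \<in> borel_measurable lebesgue"
    and Gp: "\<And>K. compact K \<Longrightarrow> K \<subseteq> \<Omega> \<Longrightarrow> set_integrable lebesgue K (\<lambda>x. norm (G x) powr p)"
    and wg: "\<And>\<phi>. \<phi> \<in> C1_c \<Omega> \<Longrightarrow> set_lebesgue_integral lebesgue \<Omega> (\<lambda>x. u x *\<^sub>R gradient \<phi> x) =
       - set_lebesgue_integral lebesgue \<Omega> (\<lambda>x. \<phi> x *\<^sub>R G x)"
    using W unfolding W1p_loc_def has_weak_gradient_def Lp_loc_def set_borel_measurable_def by auto
  obtain g where g[measurable]: "g \<in> borel_measurable borel"
    and ae: "AE x in lborel. indicator \<Omega> x *\<^sub>R G x = g x"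
    using completion_ex_borel_measurable_euclidean[OF Gm] by (auto simp only: measurable_lborel2)
  have [measurable]: "\<Omega> \<in> sets borel" using pq(1) by simp
  have um: "(\<lambda>x. indicator \<Omega> x *\<^sub>R u x) \<in> borel_measurable borel"
    by (rule borel_measurable_continuous_on_indicator[OF _ cont]) measurable
  have "supersolution \<Omega> u g p q s"
  proof
    show "open \<Omega>" "1 < q" "q < p" "continuous_on \<Omega> u" "g \<in> borel_measurable borel" by fact+
    show "u x > 0" if "x \<in> \<Omega>" for x using that by (rule pos)
  next
    fix K :: "'a set" assume K: "compact K" "K \<subseteq> \<Omega>"
    have [measurable]: "K \<in> sets borel" using K(1) by (simp add: compact_imp_closed)
    have 1: "integrable lebesgue (\<lambda>x. indicator K x * norm (G x) powr p)"
      using Gp[OF K] by (simp add: set_integrable_def)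
    have 2: "(\<lambda>x. indicator K x * norm (g x) powr p) \<in> borel_measurable lborel" by measurable
    have "AE x in lborel. indicator K x * norm (G x) powr p = indicator K x * norm (g x) powr p"
      using ae by eventually_elim (use K(2) in \<open>auto simp: indicator_def split: if_splits\<close>)
    then have "integrable lebesgue (\<lambda>x. indicator K x * norm (g x) powr p)"
      using 1 by (subst integrable_cong_AE[symmetric, OF borel_measurable_integrable[OF 1] measurable_completion[OF 2] AE_completion]) auto
    then show "integrable lborel (\<lambda>x. indicator K x * norm (g x) powr p)"
      using integrable_completion[OF 2] by simp
  next
    fix \<phi> assume phi: "\<phi> \<in> C1_c \<Omega>"
    note C = C1_cD[OF phi]
    have [measurable]: "\<phi> \<in> borel_measurable borel" "gradient \<phi> \<in> borel_measurable borel"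
      by (rule C(6,7))+
    note o = C1_c_outside[OF phi]
    \<comment> \<open>\<open>u\<close> is controlled only on \<Omega>; as the gradient of the test
      function vanishes elsewhere, inserting the indicator changes nothing and yields
      measurability.\<close>
    have e: "u x *\<^sub>R gradient \<phi> x = (indicator \<Omega> x *\<^sub>R u x) *\<^sub>R gradient \<phi> x" for x
      using o(1)[of x] by (cases "x \<in> \<Omega>") auto
    have "set_lebesgue_integral lebesgue \<Omega> (\<lambda>x. u x *\<^sub>R gradient \<phi> x) = (LBINT x. u x *\<^sub>R gradient \<phi> x)"
    proof (rule set_integral_lebesgue_eq_lborel_AE)
      show "(\<lambda>x. u x *\<^sub>R gradient \<phi> x) \<in> borel_measurable borel"
        unfolding e by (intro borel_measurable_scaleR um) simp
      show "AE x in lborel. indicator \<Omega> x *\<^sub>R u x *\<^sub>R gradient \<phi> x = u x *\<^sub>R gradient \<phi> x"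
        unfolding e by (rule AE_I2) (simp add: indicator_def)
    qed
    moreover have "set_lebesgue_integral lebesgue \<Omega> (\<lambda>x. \<phi> x *\<^sub>R G x) = (LBINT x. \<phi> x *\<^sub>R g x)"
    proof (rule set_integral_lebesgue_eq_lborel_AE)
      show "AE x in lborel. indicator \<Omega> x *\<^sub>R \<phi> x *\<^sub>R G x = \<phi> x *\<^sub>R g x"
        using ae by eventually_elim (metis scaleR_left_commute)
      show "(\<lambda>x. \<phi> x *\<^sub>R g x) \<in> borel_measurable borel" by (intro borel_measurable_scaleR) simp_all
    qed
    ultimately show "(LBINT x. u x *\<^sub>R gradient \<phi> x) = - (LBINT x. \<phi> x *\<^sub>R g x)"
      using wg[OF phi] by simp
    assume phi0: "\<And>x. \<phi> x \<ge> 0"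
    have fl: "set_lebesgue_integral lebesgue \<Omega> (\<lambda>x. r_flux r (G x) \<bullet> gradient \<phi> x) =
      (LBINT x. r_flux r (g x) \<bullet> gradient \<phi> x)" for r
    proof (rule set_integral_lebesgue_eq_lborel_AE)
      show "AE x in lborel. indicator \<Omega> x *\<^sub>R (r_flux r (G x) \<bullet> gradient \<phi> x) = r_flux r (g x) \<bullet> gradient \<phi> x"
        using ae
      proof eventually_elim
        case (elim x)
        then show ?case using o(1)[of x] by (cases "x \<in> \<Omega>") auto
      qed
      show "(\<lambda>x. r_flux r (g x) \<bullet> gradient \<phi> x) \<in> borel_measurable borel"
        by (intro borel_measurable_inner measurable_compose[OF g borel_measurable_r_flux]) simp
    qed
    have "set_lebesgue_integral lebesgue \<Omega> (\<lambda>x. u x powr (s - 1) * \<phi> x) = (LBINT x. u x powr (s - 1) * \<phi> x)"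
    proof (rule set_integral_lebesgue_eq_lborel_AE)
      have e: "u x powr (s - 1) * \<phi> x = (indicator \<Omega> x *\<^sub>R u x) powr (s - 1) * \<phi> x" for x
        using o(2)[of x] by (cases "x \<in> \<Omega>") auto
      show "(\<lambda>x. u x powr (s - 1) * \<phi> x) \<in> borel_measurable borel" unfolding e using um by measurable
      show "AE x in lborel. indicator \<Omega> x *\<^sub>R (u x powr (s - 1) * \<phi> x) = u x powr (s - 1) * \<phi> x"
        by (rule AE_I2) (auto simp: indicator_def o(2))
    qed
    then show "(LBINT x. r_flux p (g x) \<bullet> gradient \<phi> x) + (LBINT x. r_flux q (g x) \<bullet> gradient \<phi> x)
      \<ge> (LBINT x. u x powr (s - 1) * \<phi> x)"
      using ineq[OF phi phi0] by (simp add: fl)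
  qed
  then show ?thesis by (rule that)
qed


text \<open>The weak gradient is tested with \<open>j (x - y)\<close> as a function of
  \<open>y\<close>; the minus sign of its gradient cancels the one of integration by parts. The
  kernel lives in \<open>cball x \<epsilon>\<close>, so cutting \<open>u\<close> and
  \<open>G\<close> to \<open>K\<close> is harmless.\<close>

lemma convolution_eq_weak_gradient:
  fixes G :: "'a::euclidean_space \<Rightarrow> 'a" and u :: "'a \<Rightarrow> real"
  assumes weak: "\<And>\<phi>. \<phi> \<in> C1_c \<Omega> \<Longrightarrow>
      (LBINT x. u x *\<^sub>R gradient \<phi> x) = - (LBINT x. \<phi> x *\<^sub>R G x)"
    and j: "mollifier \<epsilon> j" and K: "cball x \<epsilon> \<subseteq> K" "cball x \<epsilon> \<subseteq> \<Omega>"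
  shows "(LBINT y. (indicator K y * u y) *\<^sub>R gradient j (x - y)) = (LBINT y. j (x - y) *\<^sub>R (indicator K y *\<^sub>R G y))"
proof -
  have C: "j \<in> C1_c UNIV" "\<And>y. norm y \<ge> \<epsilon> \<Longrightarrow> j y = 0" using j by (auto simp: mollifier_def)
  note D = C1_cD[OF C(1)]
  have grad0: "gradient j y = 0" if "norm y > \<epsilon>" for y
    by (rule gradient_eqI, rule GDERIV_zero_outside[of "cball 0 \<epsilon>"]) (use that C(2) in auto)
  define \<phi> where "\<phi> y = j (x - y)" for y
  have G\<phi>: "GDERIV \<phi> y :> - gradient j (x - y)" for y
  proof -
    have "((\<lambda>y. x - y) has_derivative (\<lambda>h. - h)) (at y)" by (auto intro!: derivative_eq_intros)
    from has_derivative_compose[OF this D(1)[of "x - y", unfolded gderiv_def]]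
    show ?thesis unfolding \<phi>_def gderiv_def by simp
  qed
  have c: "continuous_on UNIV (\<lambda>y. - gradient j (x - y))"
    by (intro continuous_on_minus continuous_on_compose2[OF D(2)] continuous_intros) auto
  have out: "\<phi> y = 0" if "y \<notin> cball x \<epsilon>" for y
    using that C(2)[of "x - y"] by (simp add: \<phi>_def dist_norm)
  have \<phi>: "\<phi> \<in> C1_c \<Omega>" "gradient \<phi> = (\<lambda>y. - gradient j (x - y))"
    by (rule C1_cI(1)[OF G\<phi> c compact_cball K(2)], rule out, assumption)
       (rule C1_cI(2)[OF G\<phi> c compact_cball K(2)], rule out, assumption)
  have e1: "(indicator K y * u y) *\<^sub>R gradient j (x - y) = - (u y *\<^sub>R gradient \<phi> y)" for y
  proof (cases "y \<in> K")
    case False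
    then have "norm (x - y) > \<epsilon>" using K(1) by (metis dist_norm mem_cball not_le subsetD)
    then show ?thesis using grad0[of "x - y"] by (simp add: \<phi>(2))
  qed (simp add: \<phi>(2))
  have e2: "j (x - y) *\<^sub>R (indicator K y *\<^sub>R G y) = \<phi> y *\<^sub>R G y" for y
  proof (cases "y \<in> K")
    case False
    then have "norm (x - y) > \<epsilon>" using K(1) by (metis dist_norm mem_cball not_le subsetD)
    then show ?thesis using C(2)[of "x - y"] by (simp add: \<phi>_def)
  qed (simp add: \<phi>_def)
  show ?thesis unfolding e1 e2 using weak[OF \<phi>(1)] by simp
qed

text \<open>An average stays between the bounds of its data. This keeps mollified solutions in a
  compact interval of positive numbers, where \<open>h\<close> and \<open>h'\<close> are
  bounded.\<close>

lemma mollifier_average_bounds: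
  fixes u :: "'a::euclidean_space \<Rightarrow> real"
  assumes j: "mollifier \<epsilon> j" and K: "cball x \<epsilon> \<subseteq> K"
    and I: "integrable lborel (\<lambda>y. indicator K y * u y)"
    and b: "\<And>y. y \<in> K \<Longrightarrow> m \<le> u y \<and> u y \<le> M"
  shows "m \<le> (LBINT y. (indicator K y * u y) * j (x - y))" "(LBINT y. (indicator K y * u y) * j (x - y)) \<le> M"
proof -
  have C: "j \<in> C1_c UNIV" "\<And>y. norm y \<ge> \<epsilon> \<Longrightarrow> j y = 0" "\<And>y. j y \<ge> 0" using j by (auto simp: mollifier_def)
  have [measurable]: "j \<in> borel_measurable borel"
    by (rule C1_cD(6)[OF C(1)])
  obtain L where L: "\<And>x. \<bar>j x\<bar> \<le> L" using C1_c_bounded[OF C(1)] by metis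
  note R = mollifier_reflect(1,2)[OF j, of x]
  have I': "integrable lborel (\<lambda>y. (indicator K y * u y) * j (x - y))"
    using integrable_bounded_mult_vec[OF I, of "\<lambda>y. j (x - y)" L] L by simp
  have z: "j (x - y) = 0" if "y \<notin> K" for y
  proof -
    have "norm (x - y) > \<epsilon>" using K that by (metis dist_norm mem_cball not_le subsetD)
    then show ?thesis using C(2)[of "x - y"] by simp
  qed
  have "(LBINT y. m * j (x - y)) \<le> (LBINT y. (indicator K y * u y) * j (x - y))"
  proof (rule integral_mono)
    show "m * j (x - y) \<le> (indicator K y * u y) * j (x - y)" for y
      using z[of y] b[of y] C(3)[of "x - y"] by (cases "y \<in> K") (auto intro: mult_right_mono)
  qed (use R I' in auto)
  then show "m \<le> (LBINT y. (indicator K y * u y) * j (x - y))" using R by simp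
  have "(LBINT y. (indicator K y * u y) * j (x - y)) \<le> (LBINT y. M * j (x - y))"
  proof (rule integral_mono)
    show "(indicator K y * u y) * j (x - y) \<le> M * j (x - y)" for y
      using z[of y] b[of y] C(3)[of "x - y"] by (cases "y \<in> K") (auto intro: mult_right_mono)
  qed (use R I' in auto)
  then show "(LBINT y. (indicator K y * u y) * j (x - y)) \<le> M" using R by simp
qed

lemma mollifier_pointwise_limit:
  fixes f :: "'a::euclidean_space \<Rightarrow> real"
  assumes I: "integrable lborel f" and j: "\<And>n. mollifier (\<epsilon> n) (j n)" and \<epsilon>: "\<epsilon> \<longlonglongrightarrow> 0"
    and c: "isCont f x"
  shows "(\<lambda>n. \<integral>y. f y * j n (x - y) \<partial>lborel) \<longlonglongrightarrow> f x"
proof (rule tendstoI)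
  fix e :: real assume e: "e > 0"
  have [measurable]: "f \<in> borel_measurable borel" using borel_measurable_integrable[OF I] by simp
  obtain d where d: "d > 0" "\<And>y. dist y x < d \<Longrightarrow> dist (f y) (f x) < e / 2"
    using c e unfolding continuous_at_eps_delta by (metis half_gt_zero)
  have "eventually (\<lambda>n. \<epsilon> n < d) sequentially" using \<epsilon> d(1) by (rule order_tendstoD(2))
  then show "eventually (\<lambda>n. dist (LBINT y. f y * j n (x - y)) (f x) < e) sequentially"
  proof eventually_elim
    case (elim n)
    have C: "j n \<in> C1_c UNIV" "\<And>y. norm y \<ge> d \<Longrightarrow> j n y = 0" "\<And>y. j n y \<ge> 0"
      using j[of n] elim by (auto simp: mollifier_def)
    have [measurable]: "j n \<in> borel_measurable borel"
      by (rule C1_cD(6)[OF C(1)])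
    have "ennreal (norm ((LBINT y. j n (x - y) *\<^sub>R f y) - f x)) \<le>
      (\<integral>\<^sup>+y. ennreal (j n y) * ennreal (norm (f (x - y) - f x)) \<partial>lborel)"
      by (rule mollify_norm_diff_le[OF I j])
    also have "\<dots> \<le> (\<integral>\<^sup>+y. ennreal (j n y) * ennreal (e / 2) \<partial>lborel)"
    proof (rule nn_integral_mono)
      fix y :: 'a
      show "ennreal (j n y) * ennreal (norm (f (x - y) - f x)) \<le> ennreal (j n y) * ennreal (e / 2)"
      proof (cases "norm y < d")
        case True
        then have "norm (f (x - y) - f x) \<le> e / 2" using d(2)[of "x - y"] by (simp add: dist_norm)
        then show ?thesis by (intro mult_left_mono ennreal_leI) auto
      next
        case False
        then show ?thesis using C(2)[of y] by simp
      qed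
    qed
    also have "\<dots> = (\<integral>\<^sup>+y. ennreal (j n y) \<partial>lborel) * ennreal (e / 2)" by (rule nn_integral_multc) measurable
    also have "\<dots> = ennreal (e / 2)" using mollifier_reflect(3)[OF j[of n]] by simp
    finally have "norm ((LBINT y. j n (x - y) *\<^sub>R f y) - f x) \<le> e / 2" using e by simp
    then show ?case using e by (simp add: dist_norm mult.commute)
  qed
qed

section \<open>Majorants of the flux and passage to the limit in the test functions\<close>

context supersolution
begin

lemma p1: "1 < p" using q1 qp by simp

text \<open>One majorant for both fluxes: over a base that is at least 1, the exponent q - 1 may be
  raised to p - 1.\<close>

lemma norm_flux_le:
  assumes "r = p \<or> r = q"
  shows "norm (r_flux r (G x)) \<le> (1 + norm (G x)) powr (p - 1)"
proof -
  have "norm (r_flux r (G x)) \<le> (1 + norm (G x)) powr (r - 1)"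
    unfolding norm_r_flux using assms q1 qp by (intro powr_mono2) auto
  also have "\<dots> \<le> (1 + norm (G x)) powr (p - 1)"
    using assms qp by (intro powr_mono) auto
  finally show ?thesis .
qed

lemma one_plus_powr_le: "(1 + t) powr p \<le> 2 powr p * (1 + t powr p)" if "t \<ge> 0" for t :: real
proof -
  have "(1 + t) powr p \<le> (2 * max 1 t) powr p" using that p1 by (intro powr_mono2) auto
  also have "\<dots> = 2 powr p * (max 1 t powr p)" using that by (simp add: powr_mult)
  also have "max 1 t powr p \<le> 1 + t powr p" using that by (auto simp: max_def)
  then have "2 powr p * (max 1 t powr p) \<le> 2 powr p * (1 + t powr p)" by (intro mult_left_mono) auto
  finally show ?thesis .
qed

text \<open>The majorant of the gradient, cut to \<open>K\<close>. It is at least 1 there, so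
  integrability of its p-th power carries over to the power p - 1.\<close>

definition V :: "'a set \<Rightarrow> 'a \<Rightarrow> real" where
  "V K x = indicator K x * (1 + norm (G x))"

lemma V_nonneg: "V K x \<ge> 0" by (simp add: V_def)

lemma V_integrable:
  assumes K: "compact K" "K \<subseteq> \<Omega>"
  shows "integrable lborel (\<lambda>x. V K x powr p)" and "integrable lborel (\<lambda>x. V K x powr (p - 1))"
    and "V K \<in> borel_measurable borel"
proof -
  have Kb[measurable]: "K \<in> sets borel" using K(1) by (simp add: compact_imp_closed)
  show Vm[measurable]: "V K \<in> borel_measurable borel" unfolding V_def by measurable
  have "integrable lborel (\<lambda>x. indicator K x :: real)"
    using K(1) emeasure_compact_finite[of K] by simp
  with G_int[OF K] have I: "integrable lborel (\<lambda>x. 2 powr p * (indicator K x + indicator K x * norm (G x) powr p))"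
    by (intro integrable_mult_right Bochner_Integration.integrable_add)
  have le: "V K x powr p \<le> 2 powr p * (indicator K x + indicator K x * norm (G x) powr p)" for x
    using one_plus_powr_le[of "norm (G x)"] by (simp add: V_def indicator_def)
  show Ip: "integrable lborel (\<lambda>x. V K x powr p)"
    by (rule Bochner_Integration.integrable_bound[OF I]) (use le in \<open>auto intro: order_trans[OF le abs_ge_self]\<close>)
  have "V K x powr (p - 1) \<le> V K x powr p" for x
    using p1 by (cases "x \<in> K") (auto simp: V_def intro!: powr_mono)
  then show "integrable lborel (\<lambda>x. V K x powr (p - 1))"
    by (intro Bochner_Integration.integrable_bound[OF Ip]) auto
qed

lemma flux_inner_integrable:
  assumes K: "compact K" "K \<subseteq> \<Omega>" and r: "r = p \<or> r = q"
    and w[measurable]: "w \<in> borel_measurable borel" and w0: "\<And>x. x \<notin> K \<Longrightarrow> w x = 0" and L: "\<And>x. norm (w x) \<le> L"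
  shows "integrable lborel (\<lambda>x. r_flux r (G x) \<bullet> w x)"
proof (rule Bochner_Integration.integrable_bound)
  show "integrable lborel (\<lambda>x. V K x powr (p - 1) * L)" using V_integrable(2)[OF K] by simp
  have "\<bar>r_flux r (G x) \<bullet> w x\<bar> \<le> V K x powr (p - 1) * L" for x
  proof (cases "x \<in> K")
    case True
    have "\<bar>r_flux r (G x) \<bullet> w x\<bar> \<le> norm (r_flux r (G x)) * norm (w x)" by (rule Cauchy_Schwarz_ineq2)
    also have "\<dots> \<le> (1 + norm (G x)) powr (p - 1) * L"
      by (intro mult_mono norm_flux_le[OF r] L) auto
    finally show ?thesis using True by (simp add: V_def)
  next
    case False
    then show ?thesis using w0 by (simp add: V_def)
  qed
  then show "AE x in lborel. norm (r_flux r (G x) \<bullet> w x) \<le> norm (V K x powr (p - 1) * L)"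
    by (intro AE_I2) (auto intro: order_trans[OF _ abs_ge_self])
  show "(\<lambda>x. r_flux r (G x) \<bullet> w x) \<in> borel_measurable lborel"
    by measurable
qed


text \<open>Justifies the test function \<open>h(u) \<psi>\<close> although \<open>u\<close> is only
  weakly differentiable. The functions \<open>h(w n) \<psi>\<close> with mollifications
  \<open>w n\<close> are C1, and the gradient of \<open>w n\<close> enters linearly against a flux
  of order \<open>V powr (p - 1)\<close>, so strong L^p convergence suffices. In the limit, flux
  times \<open>G\<close> gives the two powers of its norm.\<close>

lemma test_composite:
  assumes psi: "\<psi> \<in> C1_c \<Omega>" and psi0: "\<And>x. \<psi> x \<ge> 0"
    and h: "\<And>t. t > 0 \<Longrightarrow> DERIV h t :> h' t" "continuous_on {0<..} h'" "\<And>t. t > 0 \<Longrightarrow> h t \<ge> 0"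
  defines "I \<equiv> (\<lambda>x. h (u x) * ((r_flux p (G x) + r_flux q (G x)) \<bullet> gradient \<psi> x)
      + (h' (u x) * \<psi> x) * (norm (G x) powr p + norm (G x) powr q))"
  shows "integrable lborel (\<lambda>x. u x powr (s - 1) * (h (u x) * \<psi> x))" and "integrable lborel I"
    and "(LBINT x. u x powr (s - 1) * (h (u x) * \<psi> x)) \<le> (LBINT x. I x)"
proof -
  note C = C1_cD[OF psi]
  define K where "K = supp \<psi>"
  have K: "compact K" "K \<subseteq> \<Omega>" and out: "\<And>x. x \<notin> K \<Longrightarrow> \<psi> x = 0" "\<And>x. x \<notin> K \<Longrightarrow> gradient \<psi> x = 0"
    using C(3,4) not_in_supp[of _ \<psi>] gradient_outside_supp[of _ \<psi>] by (auto simp: K_def)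
  obtain e0 where e0: "e0 > 0" "(\<Union>x\<in>K. cball x e0) \<subseteq> \<Omega>"
    using compact_subset_open_imp_cball_epsilon_subset[OF K(1) open_dom K(2)] by blast
  \<comment> \<open>Half of the room around \<open>K\<close>: mollification of radius at most
    \<open>r\<close> at points of the \<open>r\<close>-neighbourhood \<open>V0\<close> uses only
    values on the compact set \<open>K2\<close> inside \<Omega>.\<close>
  define r where "r = e0 / 2"
  have r: "r > 0" using e0 by (simp add: r_def)
  define K2 where "K2 = (\<Union>x\<in>K. cball x e0)"
  have K2: "compact K2" "K2 \<subseteq> \<Omega>" using compact_minkowski_sum_cball[OF K(1)] e0(2) by (simp_all add: K2_def)
  define V0 where "V0 = (\<Union>x\<in>K. ball x r)"
  have V0: "open V0" "K \<subseteq> V0" using r by (auto simp: V0_def)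
  have cb: "cball x r \<subseteq> K2" if xV: "x \<in> V0" for x
  proof -
    obtain z where z: "z \<in> K" "dist z x < r" using xV by (auto simp: V0_def)
    have "cball x r \<subseteq> cball z e0"
    proof
      fix y assume "y \<in> cball x r"
      then show "y \<in> cball z e0" using z(2) dist_triangle[of z y x] by (simp add: r_def)
    qed
    then show ?thesis using z(1) by (auto simp: K2_def)
  qed
  have KK2: "K \<subseteq> K2" using e0(1) by (auto simp: K2_def intro!: bexI)
  have Kb[measurable]: "K \<in> sets borel" "K2 \<in> sets borel" using K(1) K2(1) by (simp_all add: compact_imp_closed)
  have cont2: "continuous_on K2 u" using cont K2(2) by (rule continuous_on_subset)
  have contK: "continuous_on K u" using cont K(2) by (rule continuous_on_subset)
  \<comment> \<open>\<open>h\<close> is controlled only on positive numbers and may be singular at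
    0, so the range of \<open>u\<close> on \<open>K2\<close> is enclosed in a compact interval away
    from 0.\<close>
  obtain m M where mM: "m > 0" "m \<le> M" and um: "\<And>y. y \<in> K2 \<Longrightarrow> m \<le> u y \<and> u y \<le> M"
  proof (cases "K2 = {}")
    case True
    then show ?thesis using that[of 1 1] by simp
  next
    case False
    obtain y1 where y1: "y1 \<in> K2" "\<And>y. y \<in> K2 \<Longrightarrow> u y1 \<le> u y"
      using continuous_attains_inf[OF K2(1) False cont2] by blast
    obtain y2 where y2: "y2 \<in> K2" "\<And>y. y \<in> K2 \<Longrightarrow> u y \<le> u y2"
      using continuous_attains_sup[OF K2(1) False cont2] by blast
    show ?thesis using that[of "u y1" "u y2"] y1 y2 pos K2(2) by blast
  qed
  have mMsub: "{m..M} \<subseteq> {0<..}" using mM by auto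
  have hc: "continuous_on {0<..} h"
    using h(1) by (auto intro!: continuous_at_imp_continuous_on DERIV_isCont)
  have "bounded (h ` {m..M})" "bounded (h' ` {m..M})"
    using continuous_on_subset[OF hc mMsub] continuous_on_subset[OF h(2) mMsub]
    by (auto intro!: compact_imp_bounded compact_continuous_image)
  then obtain B1 B2 where B12: "\<And>t. t \<in> {m..M} \<Longrightarrow> norm (h t) \<le> B1" "\<And>t. t \<in> {m..M} \<Longrightarrow> norm (h' t) \<le> B2"
    unfolding bounded_iff by blast
  define B where "B = max B1 B2"
  have B: "\<bar>h t\<bar> \<le> B" "\<bar>h' t\<bar> \<le> B" if "m \<le> t" "t \<le> M" for t
    using B12[of t] that by (auto simp: B_def)
  have B0: "B \<ge> 0" using B(1)[of m] mM by simp
  obtain L where L: "L > 0" "\<And>x. norm (gradient \<psi> x) \<le> L" "\<And>x. \<bar>\<psi> x\<bar> \<le> L" using C1_c_bounded[OF psi] by metis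
  have meas[measurable]: "\<psi> \<in> borel_measurable borel" "gradient \<psi> \<in> borel_measurable borel"
    by (rule C(6,7))+

  define \<epsilon> where "\<epsilon> n = r / real (Suc n)" for n
  have \<epsilon>: "\<epsilon> n > 0" "\<epsilon> n \<le> r" for n using r by (auto simp: \<epsilon>_def divide_le_eq mult_le_cancel_left1)
  have \<epsilon>lim: "\<epsilon> \<longlonglongrightarrow> 0" unfolding \<epsilon>_def
    using tendsto_mult_right_zero[OF LIMSEQ_Suc[OF lim_1_over_n], of r] by simp
  obtain j :: "nat \<Rightarrow> 'a \<Rightarrow> real" where j: "\<And>n. mollifier (\<epsilon> n) (j n)"
    using mollifier_exists[OF \<epsilon>(1)] by metis
  define U where "U y = indicator K2 y * u y" for y
  have IU: "integrable lborel U" unfolding U_def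
    using borel_integrable_compact[OF K2(1) cont2] by simp
  define w where "w n x = (LBINT y. U y * j n (x - y))" for n x
  define W where "W n x = (LBINT y. U y *\<^sub>R gradient (j n) (x - y))" for n x
  have jC: "j n \<in> C1_c UNIV" for n using j[of n] by (simp add: mollifier_def)
  have Gw: "GDERIV (w n) x :> W n x" for n x
    unfolding w_def W_def by (rule GDERIV_convolution(1)[OF IU jC])
  have Wc: "continuous_on UNIV (W n)" for n
    unfolding W_def by (rule GDERIV_convolution(2)[OF IU jC])
  have wc: "continuous_on UNIV (w n)" for n
    by (rule GDERIV_continuous_on) (rule Gw)
  define g where "g y = indicator K2 y *\<^sub>R G y" for y
  have gm: "g \<in> borel_measurable borel" unfolding g_def by measurable
  have cbn: "cball x (\<epsilon> n) \<subseteq> K2" "cball x (\<epsilon> n) \<subseteq> \<Omega>" if "x \<in> V0" for x n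
    using cb[OF that] \<epsilon>(2)[of n] K2(2) by (auto simp: subset_iff)
  have Wg: "W n x = (LBINT y. j n (x - y) *\<^sub>R g y)" if "x \<in> V0" for n x
    unfolding W_def U_def g_def by (rule convolution_eq_weak_gradient[OF weak j cbn[OF that]])
  have wb: "m \<le> w n x" "w n x \<le> M" if "x \<in> V0" for n x
    unfolding w_def U_def using mollifier_average_bounds[OF j cbn(1)[OF that] IU[unfolded U_def] um] by auto
  have wlim: "(\<lambda>n. w n x) \<longlonglongrightarrow> u x" if "x \<in> K" for x
  proof -
    have xV: "x \<in> V0" using that V0(2) by blast
    have "isCont U x"
    proof -
      have sub: "ball x r \<subseteq> K2" using cb[OF xV] by (auto simp: subset_iff)
      have "continuous_on (ball x r) u" using cont2 sub by (rule continuous_on_subset)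
      then have "isCont u x" using r by (simp add: continuous_on_eq_continuous_at)
      moreover have "eventually (\<lambda>y. u y = U y) (nhds x)"
        unfolding eventually_nhds using sub r by (intro exI[of _ "ball x r"]) (auto simp: U_def indicator_def subset_iff)
      ultimately show ?thesis using isCont_cong by blast
    qed
    from mollifier_pointwise_limit[OF IU j \<epsilon>lim this] show ?thesis
      using that KK2 unfolding w_def by (auto simp: U_def indicator_def subset_iff)
  qed

  define A where "A x = r_flux p (G x) + r_flux q (G x)" for x
  have Am[measurable]: "A \<in> borel_measurable borel" unfolding A_def by measurable
  have An: "norm (A x) \<le> 2 * V K x powr (p - 1)" if "x \<in> K" for x
  proof -
    have "norm (A x) \<le> norm (r_flux p (G x)) + norm (r_flux q (G x))" unfolding A_def by (rule norm_triangle_ineq)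
    also have "\<dots> \<le> 2 * (1 + norm (G x)) powr (p - 1)" using norm_flux_le[of p x] norm_flux_le[of q x] by simp
    finally show ?thesis using that by (simp add: V_def)
  qed
  have AG: "A x \<bullet> G x = norm (G x) powr p + norm (G x) powr q" for x
    by (simp add: A_def inner_add_left r_flux_inner_self)
  have AGn: "\<bar>A x \<bullet> G x\<bar> \<le> 2 * V K x powr p" if "x \<in> K" for x
  proof -
    have "\<bar>A x \<bullet> G x\<bar> \<le> norm (A x) * norm (G x)" by (rule Cauchy_Schwarz_ineq2)
    also have "\<dots> \<le> (2 * V K x powr (p - 1)) * V K x"
      using An[OF that] that by (intro mult_mono) (auto simp: V_def)
    also have "\<dots> = 2 * V K x powr p" using powr_add[of "V K x" "p - 1" 1] that by (simp add: V_def)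
    finally show ?thesis .
  qed
  note VI = V_integrable[OF K]

  define \<phi> where "\<phi> n x = h (w n x) * \<psi> x" for n x
  have \<phi>: "\<phi> n \<in> C1_c \<Omega>"
    "gradient (\<phi> n) = (\<lambda>x. h (w n x) *\<^sub>R gradient \<psi> x + \<psi> x *\<^sub>R (h' (w n x) *\<^sub>R W n x))" for n
  proof -
    have wpos: "w n x > 0" if "x \<in> V0" for x using wb(1)[OF that, of n] mM(1) by linarith
    have D: "GDERIV (\<lambda>x. h (w n x)) x :> h' (w n x) *\<^sub>R W n x" if "x \<in> V0" for x
      by (rule GDERIV_DERIV_compose[OF Gw h(1)[OF wpos[OF that]]])
    have "continuous_on V0 (\<lambda>x. h' (w n x))"
      by (rule continuous_on_compose2[OF h(2) continuous_on_subset[OF wc]]) (use wpos in auto)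
    then have c: "continuous_on V0 (\<lambda>x. h' (w n x) *\<^sub>R W n x)"
      by (rule continuous_on_scaleR) (rule continuous_on_subset[OF Wc subset_UNIV])
    note M = C1_c_mult[OF psi V0(1) V0(2)[unfolded K_def] D c]
    show "\<phi> n \<in> C1_c \<Omega>" unfolding \<phi>_def by (rule M(1))
    show "gradient (\<phi> n) = (\<lambda>x. h (w n x) *\<^sub>R gradient \<psi> x + \<psi> x *\<^sub>R (h' (w n x) *\<^sub>R W n x))"
      unfolding \<phi>_def by (rule M(2))
  qed
  have \<phi>0: "\<phi> n x \<ge> 0" for n x
  proof (cases "x \<in> K")
    case True
    then have "w n x > 0" using wb(1)[of x n] mM(1) V0(2) by (meson less_le_trans subsetD)
    then show ?thesis using h(3) psi0 by (simp add: \<phi>_def)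
  next
    case False
    then show ?thesis using out(1) by (simp add: \<phi>_def)
  qed
  have IA: "integrable lborel (\<lambda>x. A x \<bullet> gradient (\<phi> n) x)"
    and IAle: "(LBINT x. u x powr (s - 1) * \<phi> n x) \<le> (LBINT x. A x \<bullet> gradient (\<phi> n) x)" for n
  proof -
    obtain L' where L': "\<And>x. norm (gradient (\<phi> n) x) \<le> L'" using C1_c_bounded[OF \<phi>(1)[of n]] by metis
    note gm' = C1_cD(7)[OF \<phi>(1)[of n]]
    have o: "gradient (\<phi> n) x = 0" if "x \<notin> K" for x using out[OF that] by (simp add: \<phi>(2))
    have 1: "integrable lborel (\<lambda>x. r_flux p (G x) \<bullet> gradient (\<phi> n) x)"
      "integrable lborel (\<lambda>x. r_flux q (G x) \<bullet> gradient (\<phi> n) x)"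
      by (rule flux_inner_integrable[OF K _ gm' o L']; simp)+
    show "integrable lborel (\<lambda>x. A x \<bullet> gradient (\<phi> n) x)"
      unfolding A_def inner_add_left using 1 by (rule Bochner_Integration.integrable_add)
    have "(LBINT x. A x \<bullet> gradient (\<phi> n) x) =
      (LBINT x. r_flux p (G x) \<bullet> gradient (\<phi> n) x) + (LBINT x. r_flux q (G x) \<bullet> gradient (\<phi> n) x)"
      unfolding A_def inner_add_left using 1 by (rule Bochner_Integration.integral_add)
    then show "(LBINT x. u x powr (s - 1) * \<phi> n x) \<le> (LBINT x. A x \<bullet> gradient (\<phi> n) x)"
      using ineq[OF \<phi>(1) \<phi>0] by simp
  qed

  \<comment> \<open>Coefficients cut to \<open>K\<close>: globally measurable, bounded uniformly in
    \<open>n\<close>, and convergent at every point.\<close>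
  define a where "a n x = indicator K x *\<^sub>R h (w n x)" for n x
  define b where "b n x = indicator K x *\<^sub>R (h' (w n x) * \<psi> x)" for n x
  define a' where "a' x = indicator K x *\<^sub>R h (u x)" for x
  define b' where "b' x = indicator K x *\<^sub>R (h' (u x) * \<psi> x)" for x
  have psiK: "continuous_on K \<psi>" using C(5) by (rule continuous_on_subset) simp
  have wK: "w n ` K \<subseteq> {0<..}" for n
    using wb(1)[of _ n] mM(1) V0(2) by (auto simp: subset_iff) (meson less_le_trans)
  have uK: "u ` K \<subseteq> {0<..}" using pos K(2) by auto
  have wcK: "continuous_on K (w n)" for n using wc by (rule continuous_on_subset) simp
  have abm[measurable]: "a n \<in> borel_measurable borel" "b n \<in> borel_measurable borel"
    "a' \<in> borel_measurable borel" "b' \<in> borel_measurable borel" for n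
    unfolding a_def b_def a'_def b'_def
    by (rule borel_measurable_continuous_on_indicator[OF Kb(1)]
        continuous_on_mult[OF _ psiK]
        continuous_on_compose2[OF hc wcK wK] continuous_on_compose2[OF h(2) wcK wK]
        continuous_on_compose2[OF hc contK uK] continuous_on_compose2[OF h(2) contK uK])+
  have alim: "(\<lambda>n. a n x) \<longlonglongrightarrow> a' x" "(\<lambda>n. b n x) \<longlonglongrightarrow> b' x" for x
  proof -
    have *: "(\<lambda>n. h (w n x)) \<longlonglongrightarrow> h (u x)" "(\<lambda>n. h' (w n x)) \<longlonglongrightarrow> h' (u x)" if "x \<in> K"
    proof -
      have ux: "u x \<in> {0<..}" using uK that by blast
      have "isCont h (u x)" "isCont h' (u x)"
        using hc h(2) ux by (simp_all only: continuous_on_eq_continuous_at open_greaterThan)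
      then show "(\<lambda>n. h (w n x)) \<longlonglongrightarrow> h (u x)" "(\<lambda>n. h' (w n x)) \<longlonglongrightarrow> h' (u x)"
        using wlim[OF that] by (auto intro: isCont_tendsto_compose)
    qed
    show "(\<lambda>n. a n x) \<longlonglongrightarrow> a' x" "(\<lambda>n. b n x) \<longlonglongrightarrow> b' x"
      using * unfolding a_def b_def a'_def b'_def
      by (cases "x \<in> K"; auto intro!: tendsto_intros)+
  qed
  have ab: "\<bar>a n x\<bar> \<le> B" "\<bar>b n x\<bar> \<le> B * L" "x \<notin> K \<Longrightarrow> a n x = 0" "x \<notin> K \<Longrightarrow> b n x = 0" for n x
  proof -
    show "x \<notin> K \<Longrightarrow> a n x = 0" "x \<notin> K \<Longrightarrow> b n x = 0" by (simp_all add: a_def b_def)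
    have "\<bar>h (w n x)\<bar> \<le> B" "\<bar>h' (w n x) * \<psi> x\<bar> \<le> B * L" if "x \<in> K"
      using B[of "w n x"] wb[of x n] V0(2) that L(3)[of x] B0
      by (auto simp: abs_mult subset_iff intro!: mult_mono)
    then show "\<bar>a n x\<bar> \<le> B" "\<bar>b n x\<bar> \<le> B * L" using B0 L(1)
      by (cases "x \<in> K"; simp add: a_def b_def)+
  qed
  \<comment> \<open>\<open>F n\<close> is \<open>A x \<bullet> gradient (\<phi> n) x\<close> with
    \<open>W n\<close> replaced by \<open>G\<close>. It converges by domination, and the replacement
    error is \<open>b n x * (A x \<bullet> (W n x - G x))\<close> on \<open>K\<close>, which
    \<open>mollify_Lp_limit\<close> controls.\<close>
  define F where "F n x = a n x * (A x \<bullet> gradient \<psi> x) + b n x * (A x \<bullet> G x)" for n x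
  define F' where "F' x = a' x * (A x \<bullet> gradient \<psi> x) + b' x * (A x \<bullet> G x)" for x
  have Fm[measurable]: "F n \<in> borel_measurable borel" "F' \<in> borel_measurable borel" for n
    unfolding F_def F'_def by measurable
  define dom where "dom x = B * (2 * V K x powr (p - 1) * L) + B * L * (2 * V K x powr p)" for x
  have dom: "integrable lborel dom" unfolding dom_def using VI(1,2) by simp
  have Fdom: "\<bar>F n x\<bar> \<le> dom x" for n x
  proof (cases "x \<in> K")
    case True
    have "\<bar>A x \<bullet> gradient \<psi> x\<bar> \<le> norm (A x) * norm (gradient \<psi> x)" by (rule Cauchy_Schwarz_ineq2)
    also have "\<dots> \<le> 2 * V K x powr (p - 1) * L"
      using An[OF True] L(2)[of x] by (intro mult_mono) auto
    finally have "\<bar>a n x\<bar> * \<bar>A x \<bullet> gradient \<psi> x\<bar> \<le> B * (2 * V K x powr (p - 1) * L)"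
      using ab(1) B0 by (intro mult_mono) auto
    moreover have "\<bar>b n x\<bar> * \<bar>A x \<bullet> G x\<bar> \<le> B * L * (2 * V K x powr p)"
      using ab(2)[of n x] AGn[OF True] B0 L(1) by (intro mult_mono) auto
    ultimately show ?thesis unfolding F_def dom_def
      by (intro order_trans[OF abs_triangle_ineq]) (simp only: abs_mult add_mono)
  next
    case False
    then show ?thesis using ab(3,4)[of x n] B0 L(1) by (simp add: F_def dom_def)
  qed
  have IFn: "integrable lborel (F n)" for n
    by (rule Bochner_Integration.integrable_bound[OF dom]) (use Fdom in \<open>auto intro: order_trans[OF _ abs_ge_self]\<close>)
  have Flim: "(\<lambda>n. F n x) \<longlonglongrightarrow> F' x" for x
    unfolding F_def F'_def by (intro tendsto_intros alim)
  have IFn': "integrable lborel F'"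
    and Fint: "(\<lambda>n. \<integral>x. F n x \<partial>lborel) \<longlonglongrightarrow> (LBINT x. F' x)"
    using integrable_dominated_convergence[of F' lborel F dom] integral_dominated_convergence[of F' lborel F dom]
      dom Flim Fdom by simp_all
  have F'I: "F' = I"
  proof
    fix x show "F' x = I x"
      using out[of x] unfolding F'_def I_def AG A_def[symmetric]
      by (cases "x \<in> K") (simp_all add: a'_def b'_def)
  qed

  let ?N = "\<lambda>n x. norm ((LBINT y. j n (x - y) *\<^sub>R g y) - g x)"
  have rem: "(\<lambda>n. (LBINT x. A x \<bullet> gradient (\<phi> n) x) - (LBINT x. F n x)) \<longlonglongrightarrow> 0"
  proof (rule tendstoI)
    fix e :: real assume e: "e > 0"
    define Cc where "Cc = 2 * B * L + 1"
    have Cc: "Cc > 0" using B0 L(1) by (simp add: Cc_def add_nonneg_pos)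
    have gI: "integrable lborel (\<lambda>x. norm (g x) powr p)"
      using G_int[OF K2] by (rule back_subst[of "integrable lborel"]) (auto simp: g_def indicator_def)
    \<comment> \<open>On the compact set \<open>K2\<close>, L^p implies L^1: values of norm at most
      1 are covered by the indicator, larger ones by their p-th power.\<close>
    have gI1: "integrable lborel g"
    proof (rule Bochner_Integration.integrable_bound)
      show "integrable lborel (\<lambda>x. indicator K2 x + norm (g x) powr p)"
        using gI K2(1) emeasure_compact_finite[of K2] by simp
      have "norm (g x) \<le> indicator K2 x + norm (g x) powr p" for x
      proof (cases "x \<in> K2 \<and> norm (g x) > 1")
        case True
        then have "norm (g x) powr 1 \<le> norm (g x) powr p" using p1 by (intro powr_mono) auto
        then show ?thesis using True by simp
      next
        case False
        then have "norm (g x) \<le> indicator K2 x" by (auto simp: g_def indicator_def)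
        then show ?thesis by (rule order_trans) simp
      qed
      then show "AE x in lborel. norm (g x) \<le> norm (indicator K2 x + norm (g x) powr p)"
        by (intro AE_I2) (auto intro: order_trans[OF _ abs_ge_self])
    qed (use gm in simp)
    have "eventually (\<lambda>n. (\<integral>\<^sup>+x. ennreal (V K x powr (p - 1) * ?N n x) \<partial>lborel)
      \<le> ennreal (e / (2 * Cc))) sequentially"
      using Cc e by (intro mollify_Lp_limit[OF p1 gI1 gI VI(3) V_nonneg VI(1) j \<epsilon>lim]) simp
    then show "eventually (\<lambda>n. dist ((LBINT x. A x \<bullet> gradient (\<phi> n) x) - (LBINT x. F n x)) 0 < e) sequentially"
    proof eventually_elim
      case (elim n)
      have "ennreal (norm (LBINT x. A x \<bullet> gradient (\<phi> n) x - F n x)) \<le> (\<integral>\<^sup>+x. norm (A x \<bullet> gradient (\<phi> n) x - F n x) \<partial>lborel)"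
        by (rule integral_norm_bound_ennreal[OF Bochner_Integration.integrable_diff[OF IA IFn]])
      also have "\<dots> \<le> (\<integral>\<^sup>+x. ennreal Cc * ennreal (V K x powr (p - 1) * ?N n x) \<partial>lborel)"
      proof (rule nn_integral_mono)
        fix x :: 'a
        have "\<bar>A x \<bullet> gradient (\<phi> n) x - F n x\<bar> \<le> Cc * (V K x powr (p - 1) * ?N n x)"
        proof (cases "x \<in> K")
          case True
          then have xV: "x \<in> V0" and gG: "g x = G x" using V0(2) KK2 by (auto simp: g_def indicator_def subset_iff)
          have "A x \<bullet> gradient (\<phi> n) x - F n x = b n x * (A x \<bullet> (W n x - G x))"
            using True by (simp add: \<phi>(2) F_def a_def b_def inner_add_right inner_diff_right algebra_simps)
          then have "\<bar>A x \<bullet> gradient (\<phi> n) x - F n x\<bar> = \<bar>b n x\<bar> * \<bar>A x \<bullet> (W n x - G x)\<bar>" by (simp add: abs_mult)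
          also have "\<dots> \<le> (B * L) * (norm (A x) * norm (W n x - G x))"
            using ab(2)[of n x] B0 L(1) by (intro mult_mono Cauchy_Schwarz_ineq2) auto
          also have "\<dots> \<le> (B * L) * ((2 * V K x powr (p - 1)) * norm (W n x - G x))"
            using An[OF True] B0 L(1) by (intro mult_left_mono mult_right_mono) auto
          also have "\<dots> = (2 * B * L) * (V K x powr (p - 1) * norm (W n x - G x))" by simp
          also have "\<dots> \<le> Cc * (V K x powr (p - 1) * norm (W n x - G x))"
            unfolding Cc_def by (intro mult_right_mono) auto
          finally show ?thesis unfolding Wg[OF xV] gG .
        next
          case False
          then show ?thesis using out[OF False] ab(3,4)[OF False] Cc by (simp add: \<phi>(2) F_def)
        qed
        then show "ennreal (norm (A x \<bullet> gradient (\<phi> n) x - F n x)) \<le>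
            ennreal Cc * ennreal (V K x powr (p - 1) * ?N n x)"
          using Cc by (simp add: ennreal_mult[symmetric])
      qed
      also have "\<dots> = ennreal Cc * (\<integral>\<^sup>+x. ennreal (V K x powr (p - 1) * ?N n x) \<partial>lborel)"
      proof (rule nn_integral_cmult)
        have jm: "(\<lambda>x. \<integral>y. j n (x - y) *\<^sub>R g y \<partial>lborel) \<in> borel_measurable borel"
        proof -
          have [measurable]: "j n \<in> borel_measurable borel" "g \<in> borel_measurable borel"
            using C1_cD(6)[OF jC] gm by auto
          show ?thesis by measurable
        qed
        then show "(\<lambda>x. ennreal (V K x powr (p - 1) * ?N n x)) \<in> borel_measurable lborel"
          using VI(3) gm by measurable
      qed
      also have "\<dots> \<le> ennreal Cc * ennreal (e / (2 * Cc))" by (rule mult_left_mono[OF elim]) simp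
      also have "\<dots> = ennreal (e / 2)" using Cc e by (simp add: ennreal_mult[symmetric])
      finally have "norm (LBINT x. A x \<bullet> gradient (\<phi> n) x - F n x) \<le> e / 2" using e by simp
      then show ?case using IA[of n] IFn[of n] e by (simp add: dist_norm)
    qed
  qed

  define c where "c x = indicator K x *\<^sub>R (u x powr (s - 1) * \<psi> x)" for x
  have cI: "integrable lborel c" unfolding c_def
    by (rule borel_integrable_compact[OF K(1)], rule continuous_on_mult[OF continuous_on_powr[OF contK continuous_on_const] psiK])
       (use uK in auto)
  have cu: "u x powr (s - 1) * \<phi> n x = c x * a n x" "u x powr (s - 1) * (h (u x) * \<psi> x) = c x * a' x" for n x
    using out(1)[of x] by (cases "x \<in> K"; simp add: c_def a_def a'_def \<phi>_def)+
  have cm[measurable]: "c \<in> borel_measurable borel" using borel_measurable_integrable[OF cI] by simp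
  have cdom: "integrable lborel (\<lambda>x. B * \<bar>c x\<bar>)" using cI by simp
  have cle: "\<bar>c x * a n x\<bar> \<le> B * \<bar>c x\<bar>" for n x
    using mult_right_mono[OF ab(1)[of n x], of "\<bar>c x\<bar>"] by (simp add: abs_mult mult.commute)
  have clim: "(\<lambda>n. c x * a n x) \<longlonglongrightarrow> c x * a' x" for x by (intro tendsto_intros alim)
  have cint: "integrable lborel (\<lambda>x. c x * a' x)"
    and clint: "(\<lambda>n. \<integral>x. c x * a n x \<partial>lborel) \<longlonglongrightarrow> (LBINT x. c x * a' x)"
    using integrable_dominated_convergence[of "\<lambda>x. c x * a' x" lborel "\<lambda>n x. c x * a n x" "\<lambda>x. B * \<bar>c x\<bar>"]
      integral_dominated_convergence[of "\<lambda>x. c x * a' x" lborel "\<lambda>n x. c x * a n x" "\<lambda>x. B * \<bar>c x\<bar>"]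
      cdom cle clim by simp_all
  show "integrable lborel (\<lambda>x. u x powr (s - 1) * (h (u x) * \<psi> x))" unfolding cu by (rule cint)
  show "integrable lborel I" using IFn' F'I by simp
  have "(LBINT x. c x * a' x) \<le> 0 + (LBINT x. F' x)"
  proof (rule LIMSEQ_le[OF clint tendsto_add[OF rem Fint]], intro exI allI impI)
    fix n :: nat
    show "(LBINT x. c x * a n x) \<le> ((LBINT x. A x \<bullet> gradient (\<phi> n) x) - (LBINT x. F n x)) + (LBINT x. F n x)"
      using IAle[of n] unfolding cu by simp
  qed
  then show "(LBINT x. u x powr (s - 1) * (h (u x) * \<psi> x)) \<le> (LBINT x. I x)"
    unfolding cu F'I by simp
qed

end

subsection \<open>Nonexistence\<close>

text \<open>The profile is \<open>1 - ((1 - (t^+)^2)^+)^2\<close>, composed with an affine function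
  of |x|^2. It meets the constants 0 and 1 to second order, so it is C1 and the derivative is
  supported in the annulus.\<close>

lemma radial_cutoff_exists:
  fixes a b :: real
  assumes "0 < a" "a < b"
  obtains \<xi> :: "'a::euclidean_space \<Rightarrow> real" and X where
    "\<And>x. GDERIV \<xi> x :> X x" "continuous_on UNIV X" "\<And>x. 0 \<le> \<xi> x" "\<And>x. \<xi> x \<le> 1"
    "\<And>x. norm x \<le> a \<Longrightarrow> \<xi> x = 0" "\<And>x. norm x > a \<Longrightarrow> \<xi> x > 0"
    "\<And>x. norm x \<ge> b \<Longrightarrow> \<xi> x = 1" "\<And>x. X x \<noteq> 0 \<Longrightarrow> a < norm x \<and> norm x < b"
proof -
  define d where "d = b\<^sup>2 - a\<^sup>2"
  have d: "d > 0" using assms by (simp add: d_def power_strict_mono)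
  define \<tau> where "\<tau> x = (norm x ^ 2 - a\<^sup>2) / d" for x :: 'a
  define \<sigma> where "\<sigma> t = 1 - max 0 (1 - max 0 t ^ 2) ^ 2" for t :: real
  define \<sigma>' where "\<sigma>' t = 4 * (max 0 (1 - max 0 t ^ 2) * max 0 t)" for t :: real
  have D\<sigma>: "DERIV \<sigma> t :> \<sigma>' t" for t
  proof -
    have 1: "DERIV (\<lambda>t. 1 - max 0 t ^ 2) t :> - (2 * max 0 t)"
      using DERIV_diff[OF DERIV_const[of 1] DERIV_pos_part_power[of 2 t]] by simp
    from DERIV_chain2[OF DERIV_pos_part_power[of 2] 1]
    have "DERIV (\<lambda>t. max 0 (1 - max 0 t ^ 2) ^ 2) t :> (2 * max 0 (1 - max 0 t ^ 2)) * - (2 * max 0 t)" by simp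
    from DERIV_diff[OF DERIV_const[of 1] this] show ?thesis
      unfolding \<sigma>_def \<sigma>'_def by simp
  qed
  have G\<tau>: "GDERIV \<tau> x :> (2 / d) *\<^sub>R x" for x
  proof -
    have "GDERIV (\<lambda>x. x \<bullet> x) x :> 2 *\<^sub>R x"
      unfolding gderiv_def by (auto intro!: derivative_eq_intros simp: inner_commute)
    from GDERIV_mult[OF GDERIV_const[of "1 / d"] GDERIV_diff[OF this GDERIV_const[of "a\<^sup>2"]]]
    show ?thesis unfolding \<tau>_def power2_norm_eq_inner by simp
  qed
  define X where "X x = \<sigma>' (\<tau> x) *\<^sub>R ((2 / d) *\<^sub>R x)" for x
  have \<tau>0: "\<tau> x \<le> 0 \<longleftrightarrow> norm x \<le> a" "1 \<le> \<tau> x \<longleftrightarrow> b \<le> norm x" for x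
    using d assms unfolding \<tau>_def
    by (simp_all add: divide_le_0_iff le_divide_eq_1 d_def power2_le_iff_abs_le abs_le_square_iff[symmetric])
  have \<sigma>0: "\<sigma> t = 0" if "t \<le> 0" for t using that by (simp add: \<sigma>_def max_def)
  have \<sigma>1: "\<sigma> t = 1" if "t \<ge> 1" for t
  proof -
    have "1 \<le> t ^ 2" using that by (rule one_le_power)
    moreover have "max 0 t = t" using that by simp
    ultimately have "max 0 (1 - max 0 t ^ 2) = 0" by (intro max_absorb1) (simp only: le_diff_eq diff_le_0_iff_le)
    then show ?thesis unfolding \<sigma>_def by simp
  qed
  have mx: "0 \<le> max 0 (1 - max 0 t ^ 2)" "max 0 (1 - max 0 t ^ 2) \<le> 1" for t :: real by auto
  have \<sigma>01: "0 \<le> \<sigma> t" "\<sigma> t \<le> 1" for t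
    using power_le_one[OF mx, of t 2] unfolding \<sigma>_def by simp_all
  have \<sigma>pos: "\<sigma> t > 0" if "t > 0" for t
  proof -
    have "t ^ 2 > 0" using that by simp
    then have "max 0 (1 - max 0 t ^ 2) < 1" using that by (simp add: max_def)
    then have "max 0 (1 - max 0 t ^ 2) ^ 2 < 1" using mx(1) by (simp add: power_less_one_iff abs_square_less_1)
    then show ?thesis by (simp add: \<sigma>_def)
  qed
  have \<sigma>'0: "\<sigma>' t = 0" if "t \<le> 0 \<or> t \<ge> 1" for t
  proof (cases "t \<le> 0")
    case False
    then have "1 \<le> t ^ 2" using that by (intro one_le_power) simp
    moreover have "max 0 t = t" using False by simp
    ultimately have "max 0 (1 - max 0 t ^ 2) = 0" by (intro max_absorb1) (simp only: diff_le_0_iff_le)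
    then show ?thesis by (simp add: \<sigma>'_def)
  qed (simp add: \<sigma>'_def)
  show ?thesis
  proof
    show "GDERIV (\<lambda>x. \<sigma> (\<tau> x)) x :> X x" for x
      unfolding X_def by (rule GDERIV_DERIV_compose[OF G\<tau> D\<sigma>])
    show "continuous_on UNIV X" unfolding X_def \<sigma>'_def \<tau>_def using d by (intro continuous_intros) auto
    show "0 \<le> \<sigma> (\<tau> x)" "\<sigma> (\<tau> x) \<le> 1" for x by (rule \<sigma>01)+
    show "\<sigma> (\<tau> x) = 0" if "norm x \<le> a" for x using that \<tau>0(1)[of x] \<sigma>0 by blast
    show "\<sigma> (\<tau> x) > 0" if "norm x > a" for x using that \<tau>0(1)[of x] by (intro \<sigma>pos) linarith
    show "\<sigma> (\<tau> x) = 1" if "norm x \<ge> b" for x using that \<tau>0(2)[of x] \<sigma>1 by blast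
    show "a < norm x \<and> norm x < b" if "X x \<noteq> 0" for x
    proof -
      have "\<sigma>' (\<tau> x) \<noteq> 0" using that by (auto simp: X_def)
      then have "\<not> (\<tau> x \<le> 0 \<or> \<tau> x \<ge> 1)" using \<sigma>'0 by blast
      then show ?thesis using \<tau>0[of x] by linarith
    qed
  qed
qed

text \<open>If \<open>c * U powr (S - e) * z powr r\<close> is at least 1, multiplication by it
  produces the first term. Otherwise \<open>U powr e\<close> is at most a constant times z to the
  power \<open>- r e / (S - e)\<close>, and the lower bound on \<open>n\<close> says that the total
  exponent of z is then nonnegative.\<close>

lemma young_absorb_cutoff:
  fixes e S r c :: real
  assumes e: "0 < e" "e < S" and r: "r > 0" and n: "real n \<ge> r * S / (S - e)" and c: "c > 0"
  obtains C where "C \<ge> 0" "\<And>U z. U > 0 \<Longrightarrow> 0 < z \<Longrightarrow> z \<le> 1 \<Longrightarrow>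
    z powr (real n - r) * U powr e \<le> c * (U powr S * z ^ n) + C"
proof
  let ?C = "c powr (- (e / (S - e)))"
  show "?C \<ge> 0" by simp
  fix U z :: real assume U: "U > 0" and z: "0 < z" "z \<le> 1"
  show "z powr (real n - r) * U powr e \<le> c * (U powr S * z ^ n) + ?C"
  proof (cases "1 \<le> c * (U powr (S - e) * z powr r)")
    case True
    have "z powr (real n - r) * U powr e \<le> (z powr (real n - r) * U powr e) * (c * (U powr (S - e) * z powr r))"
      using mult_left_mono[OF True, of "z powr (real n - r) * U powr e"] by simp
    also have "\<dots> = c * ((U powr e * U powr (S - e)) * (z powr (real n - r) * z powr r))" by (simp only: mult_ac)
    also have "\<dots> = c * (U powr S * z powr real n)" by (simp flip: powr_add)
    also have "\<dots> = c * (U powr S * z ^ n)" using z by (simp add: powr_realpow)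
    finally show ?thesis by (simp add: add_increasing2)
  next
    case False
    define \<theta> where "\<theta> = e / (S - e)"
    have \<theta>: "\<theta> > 0" using e by (simp add: \<theta>_def)
    have "U powr (S - e) \<le> inverse (c * z powr r)"
      using False c z by (simp add: field_simps)
    then have "(U powr (S - e)) powr \<theta> \<le> inverse (c * z powr r) powr \<theta>"
      using \<theta> by (intro powr_mono2) auto
    also have "(U powr (S - e)) powr \<theta> = U powr e" using e by (simp add: powr_powr \<theta>_def)
    also have "inverse (c * z powr r) powr \<theta> = (c * z powr r) powr (- \<theta>)"
      unfolding powr_minus by (rule inverse_powr)
    also have "\<dots> = c powr (- \<theta>) * z powr (- (r * \<theta>))"
      using c z by (simp add: powr_mult powr_powr)
    finally have "z powr (real n - r) * U powr e \<le> z powr (real n - r) * (c powr (- \<theta>) * z powr (- (r * \<theta>)))"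
      by (intro mult_left_mono) auto
    also have "\<dots> = c powr (- \<theta>) * z powr (real n - r - r * \<theta>)"
      by (simp flip: powr_add add: mult.left_commute)
    also have "\<dots> \<le> c powr (- \<theta>) * 1"
    proof (intro mult_left_mono powr_le1)
      have "r + r * \<theta> = r * S / (S - e)" using e by (simp add: \<theta>_def field_simps)
      then show "0 \<le> real n - r - r * \<theta>" using n by linarith
    qed (use z in auto)
    also have "\<dots> \<le> c * (U powr S * z ^ n) + ?C" using c z by (simp add: \<theta>_def)
    finally show ?thesis .
  qed
qed

text \<open>An arbitrarily small constant is bought with a large coefficient: up to the threshold
  \<open>\<eta> powr (1 / e)\<close> the constant suffices, beyond it the higher power dominates.
  This depends on \<open>e\<close> being strictly positive.\<close>

lemma young_absorb_small:
  fixes e S \<eta> :: real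
  assumes e: "0 < e" "e < S" and \<eta>: "\<eta> > 0"
  obtains C where "C \<ge> 0" "\<And>U. U > 0 \<Longrightarrow> U powr e \<le> \<eta> + C * U powr S"
proof
  let ?C = "(\<eta> powr (1 / e)) powr (e - S)"
  show "?C \<ge> 0" by simp
  fix U :: real assume U: "U > 0"
  show "U powr e \<le> \<eta> + ?C * U powr S"
  proof (cases "U powr e \<le> \<eta>")
    case False
    then have "\<eta> powr (1 / e) \<le> (U powr e) powr (1 / e)" using e \<eta> by (intro powr_mono2) auto
    then have "\<eta> powr (1 / e) \<le> U" using e U by (simp add: powr_powr)
    then have "U powr (e - S) \<le> ?C" using e \<eta> U by (intro powr_mono2') auto
    then have "U powr (e - S) * U powr S \<le> ?C * U powr S" by (rule mult_right_mono) simp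
    moreover have "U powr (e - S) * U powr S = U powr e" by (simp flip: powr_add)
    ultimately show ?thesis using \<eta> by simp
  qed (simp add: add_increasing2)
qed

text \<open>The rescaled variable is \<open>U = \<rho>\<^sup>\<kappa> t\<close>; this is the scaling which leaves
  \<open>-\<Delta>\<^sub>q u = u\<^sup>s\<^sup>-\<^sup>1\<close> invariant.\<close>

lemma weighted_young_term:
  fixes r D z \<tau> \<rho> t \<alpha> \<kappa> :: real
  assumes r: "r > 1" and D: "D > 0" and z: "z > 0" and \<tau>: "\<tau> \<ge> 0" and \<rho>: "\<rho> > 0" and t: "t > 0"
    and \<alpha>: "\<alpha> > 0" and n: "n \<ge> 2"
  defines "U \<equiv> \<rho> powr \<kappa> * t"
  shows "(D * (1 + \<rho> powr (- (\<kappa> * \<alpha>)) * t powr (- \<alpha>)) * ((2 * real n / \<rho>) * \<tau> * z ^ (n - 1))) powr r *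
     (D * (\<alpha> * \<rho> powr (- (\<kappa> * \<alpha>)) * t powr (- \<alpha> - 1)) * z ^ n) powr (1 - r)
   \<le> \<rho> powr (- (\<kappa> * (r - 1) + r)) * (D * \<tau> powr r) * ((4 * real n) powr r * \<alpha> powr (1 - r)) *
      (z powr (real n - r) * (U powr (r - 1 - \<alpha>) + U powr ((\<alpha> + 1) * (r - 1))))"
proof -
  have U: "U > 0" using \<rho> t by (simp add: U_def)
  have U1: "\<rho> powr (- (\<kappa> * \<alpha>)) * t powr (- \<alpha>) = U powr (- \<alpha>)"
    using \<rho> t by (simp add: U_def powr_mult powr_powr)
  have U2: "\<rho> powr (- (\<kappa> * \<alpha>)) * t powr (- \<alpha> - 1) = \<rho> powr \<kappa> * U powr (- \<alpha> - 1)"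
  proof -
    have "\<rho> powr \<kappa> * U powr (- \<alpha> - 1) = (\<rho> powr \<kappa> * \<rho> powr (\<kappa> * (- \<alpha> - 1))) * t powr (- \<alpha> - 1)"
      using \<rho> t by (simp add: U_def powr_mult powr_powr)
    also have "\<rho> powr \<kappa> * \<rho> powr (\<kappa> * (- \<alpha> - 1)) = \<rho> powr (- (\<kappa> * \<alpha>))"
      unfolding powr_add[symmetric] by (simp add: algebra_simps)
    finally show ?thesis by simp
  qed
  have zn: "z ^ n = z powr real n" "z ^ (n - 1) = z powr (real n - 1)"
    using z n by (simp_all add: powr_realpow[symmetric] of_nat_diff)
  define y where "y = 1 + U powr (- \<alpha>)"
  have y: "y > 0" by (simp add: y_def add_pos_nonneg)
  have "(D * y * ((2 * real n / \<rho>) * \<tau> * z powr (real n - 1))) powr r *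
     (D * (\<alpha> * (\<rho> powr \<kappa> * U powr (- \<alpha> - 1))) * z powr real n) powr (1 - r) =
     (D powr r * y powr r * (((2 * real n) powr r * \<rho> powr (- r)) * \<tau> powr r * z powr ((real n - 1) * r))) *
     (D powr (1 - r) * (\<alpha> powr (1 - r) * (\<rho> powr (\<kappa> * (1 - r)) * U powr ((- \<alpha> - 1) * (1 - r)))) * z powr (real n * (1 - r)))"
    using D y \<rho> \<tau> z \<alpha> U by (simp add: powr_mult powr_powr powr_divide powr_minus_divide)
  also have "\<dots> = (D powr r * D powr (1 - r)) * (\<rho> powr (- r) * \<rho> powr (\<kappa> * (1 - r))) *
     (z powr ((real n - 1) * r) * z powr (real n * (1 - r))) *
     ((2 * real n) powr r * \<tau> powr r * \<alpha> powr (1 - r) * (y powr r * U powr ((- \<alpha> - 1) * (1 - r))))"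
    by (simp only: mult_ac)
  also have "D powr r * D powr (1 - r) = D" using D by (simp flip: powr_add)
  also have "\<rho> powr (- r) * \<rho> powr (\<kappa> * (1 - r)) = \<rho> powr (- (\<kappa> * (r - 1) + r))"
    unfolding powr_add[symmetric] by (simp add: algebra_simps)
  also have "z powr ((real n - 1) * r) * z powr (real n * (1 - r)) = z powr (real n - r)"
    unfolding powr_add[symmetric] by (simp add: algebra_simps)
  also have "(- \<alpha> - 1) * (1 - r) = (\<alpha> + 1) * (r - 1)" by (simp add: algebra_simps)
  finally have eq: "(D * y * ((2 * real n / \<rho>) * \<tau> * z powr (real n - 1))) powr r *
     (D * (\<alpha> * (\<rho> powr \<kappa> * U powr (- \<alpha> - 1))) * z powr real n) powr (1 - r) =
     D * \<rho> powr (- (\<kappa> * (r - 1) + r)) * z powr (real n - r) *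
     ((2 * real n) powr r * \<tau> powr r * \<alpha> powr (1 - r) * (y powr r * U powr ((\<alpha> + 1) * (r - 1))))" .
  \<comment> \<open>The two summands of the weight are separated at the cost of
    \<open>2 powr r\<close>; they lead to the exponents \<open>(\<alpha> + 1) * (r - 1)\<close> and
    \<open>r - 1 - \<alpha>\<close> of \<open>U\<close>.\<close>
  have "y powr r \<le> 2 powr r * (1 + U powr (- \<alpha> * r))"
  proof -
    have "y powr r \<le> (2 * max 1 (U powr (- \<alpha>))) powr r"
      unfolding y_def using r by (intro powr_mono2) auto
    also have "\<dots> = 2 powr r * max 1 (U powr (- \<alpha>)) powr r" by (simp add: powr_mult)
    also have "max 1 (U powr (- \<alpha>)) powr r \<le> 1 + U powr (- \<alpha> * r)"
      by (auto simp: max_def powr_powr)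
    then have "2 powr r * max 1 (U powr (- \<alpha>)) powr r \<le> 2 powr r * (1 + U powr (- \<alpha> * r))"
      by (intro mult_left_mono) auto
    finally show ?thesis .
  qed
  then have "y powr r * U powr ((\<alpha> + 1) * (r - 1)) \<le> 2 powr r * (1 + U powr (- \<alpha> * r)) * U powr ((\<alpha> + 1) * (r - 1))"
    by (rule mult_right_mono) simp
  also have "\<dots> = 2 powr r * (U powr ((\<alpha> + 1) * (r - 1)) + U powr (- \<alpha> * r) * U powr ((\<alpha> + 1) * (r - 1)))"
    by (simp add: algebra_simps)
  also have "U powr (- \<alpha> * r) * U powr ((\<alpha> + 1) * (r - 1)) = U powr (r - 1 - \<alpha>)"
    unfolding powr_add[symmetric] by (simp add: algebra_simps)
  finally have yU: "y powr r * U powr ((\<alpha> + 1) * (r - 1)) \<le> 2 powr r * (U powr (r - 1 - \<alpha>) + U powr ((\<alpha> + 1) * (r - 1)))"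
    by (simp add: add.commute)
  have "D * \<rho> powr (- (\<kappa> * (r - 1) + r)) * z powr (real n - r) *
     ((2 * real n) powr r * \<tau> powr r * \<alpha> powr (1 - r) * (y powr r * U powr ((\<alpha> + 1) * (r - 1)))) \<le>
     D * \<rho> powr (- (\<kappa> * (r - 1) + r)) * z powr (real n - r) *
     ((2 * real n) powr r * \<tau> powr r * \<alpha> powr (1 - r) * (2 powr r * (U powr (r - 1 - \<alpha>) + U powr ((\<alpha> + 1) * (r - 1)))))"
    using D by (intro mult_left_mono yU) auto
  also have "\<dots> = \<rho> powr (- (\<kappa> * (r - 1) + r)) * (D * \<tau> powr r) * ((2 powr r * (2 * real n) powr r) * \<alpha> powr (1 - r)) *
      (z powr (real n - r) * (U powr (r - 1 - \<alpha>) + U powr ((\<alpha> + 1) * (r - 1))))"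
    by (simp only: mult_ac)
  also have "2 powr r * (2 * real n) powr r = (4 * real n) powr r" by (simp flip: powr_mult)
  finally show ?thesis unfolding mult.assoc[of \<alpha>] U1 U2 zn y_def[symmetric] eq .
qed


section \<open>The energy estimate and its two applications\<close>

context supersolution
begin

text \<open>Young's inequality is applied pointwise with coefficient \<open>k x\<close>, a lower
  bound of \<open>- h' (u x) * \<psi> x\<close>; the gradient powers cancel and \<open>G\<close>
  disappears. Where \<open>k x = 0\<close> there is nothing to absorb into, hence the separate
  requirement: \<open>0 powr (1 - p) = 0\<close> would otherwise conceal an infinite error.\<close>

lemma caccioppoli:
  assumes psi: "\<psi> \<in> C1_c \<Omega>" "\<And>x. \<psi> x \<ge> 0"
    and h: "\<And>t. t > 0 \<Longrightarrow> DERIV h t :> h' t" "continuous_on {0<..} h'" "\<And>t. t > 0 \<Longrightarrow> h t \<ge> 0"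
    and k: "\<And>x. x \<in> \<Omega> \<Longrightarrow> 0 \<le> k x" "\<And>x. x \<in> \<Omega> \<Longrightarrow> k x \<le> - h' (u x) * \<psi> x"
      "\<And>x. x \<in> \<Omega> \<Longrightarrow> k x = 0 \<Longrightarrow> h (u x) * norm (gradient \<psi> x) = 0"
    and M: "integrable lborel M" "\<And>x. x \<notin> \<Omega> \<Longrightarrow> 0 \<le> M x"
      "\<And>x. x \<in> \<Omega> \<Longrightarrow> (h (u x) * norm (gradient \<psi> x)) powr p * k x powr (1 - p)
        + (h (u x) * norm (gradient \<psi> x)) powr q * k x powr (1 - q) \<le> M x"
  shows "(LBINT x. u x powr (s - 1) * (h (u x) * \<psi> x)) \<le> (LBINT x. M x)"
proof -
  define I where "I x = h (u x) * ((r_flux p (G x) + r_flux q (G x)) \<bullet> gradient \<psi> x)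
      + (h' (u x) * \<psi> x) * (norm (G x) powr p + norm (G x) powr q)" for x
  note T = test_composite[OF psi h, folded I_def]
  have "I x \<le> M x" for x
  proof (cases "x \<in> \<Omega>")
    case False
    then have "x \<notin> supp \<psi>" using C1_cD(4)[OF psi(1)] by blast
    then have "\<psi> x = 0" "gradient \<psi> x = 0" by (auto intro: not_in_supp gradient_outside_supp)
    then show ?thesis using M(2)[OF False] by (simp add: I_def)
  next
    case True
    define v where "v = norm (G x)"
    define B where "B = h (u x) * norm (gradient \<psi> x)"
    have hu: "h (u x) \<ge> 0" using h(3) pos[OF True] .
    have B0: "B \<ge> 0" using hu by (simp add: B_def)
    have "(r_flux p (G x) + r_flux q (G x)) \<bullet> gradient \<psi> x \<le> norm (r_flux p (G x) + r_flux q (G x)) * norm (gradient \<psi> x)"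
      by (rule norm_cauchy_schwarz)
    also have "\<dots> \<le> (v powr (p - 1) + v powr (q - 1)) * norm (gradient \<psi> x)"
      using norm_triangle_ineq[of "r_flux p (G x)" "r_flux q (G x)"]
      by (intro mult_right_mono) (auto simp: norm_r_flux v_def)
    finally have "h (u x) * ((r_flux p (G x) + r_flux q (G x)) \<bullet> gradient \<psi> x) \<le> B * (v powr (p - 1) + v powr (q - 1))"
      using mult_left_mono[OF _ hu] by (fastforce simp: B_def mult_ac)
    moreover have "(h' (u x) * \<psi> x) * (v powr p + v powr q) \<le> - k x * (v powr p + v powr q)"
      using k(2)[OF True] by (intro mult_right_mono) auto
    ultimately have "I x \<le> (B * v powr (p - 1) - k x * v powr p) + (B * v powr (q - 1) - k x * v powr q)"
      unfolding I_def v_def[symmetric] by (simp add: algebra_simps)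
    also have "\<dots> \<le> M x"
    proof (cases "k x = 0")
      case True': True
      then show ?thesis using k(3)[OF True True'] M(3)[OF True] by (auto simp: B_def)
    next
      case False
      then have kx: "k x > 0" using k(1)[OF True] by simp
      have "B * v powr (p - 1) \<le> k x * v powr p + B powr p * k x powr (1 - p)"
        "B * v powr (q - 1) \<le> k x * v powr q + B powr q * k x powr (1 - q)"
        using p1 q1 by (auto intro!: young_powr B0 kx simp: v_def)
      then show ?thesis using M(3)[OF True] unfolding B_def[symmetric] by linarith
    qed
    finally show ?thesis .
  qed
  then have "(LBINT x. I x) \<le> (LBINT x. M x)" using T(2) M(1) by (intro integral_mono) auto
  with T(3) show ?thesis by simp
qed

text \<open>The Young remainders carry \<open>u powr (r - s)\<close> with r equal to p or q. This
  exponent is negative because p < s, so the lower bound \<open>m\<close> controls them, while the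
  test function is chosen to cancel the nonlinearity on the left.\<close>

lemma not_bounded_below_near_infinity:
  assumes ps: "p < s" and R: "R \<ge> 0" "{x. norm x > R} \<subseteq> \<Omega>"
    and m: "m > 0" "\<And>x. norm x > R \<Longrightarrow> m \<le> u x"
  shows False
proof -
  define n where "n = nat \<lceil>p\<rceil> + 2"
  have n: "n \<ge> 2" "real n \<ge> p" by (auto simp: n_def) linarith
  obtain e :: 'a where e: "e \<in> Basis" using nonempty_Basis by blast
  \<comment> \<open>The constant of the Young remainder with exponent \<open>r\<close>: the bump
    gradient contributes \<open>(2 * real n) powr r\<close>, the factor \<open>s - 1\<close> of
    \<open>- h'\<close> the power \<open>1 - r\<close>, and the solution
    \<open>m powr (r - s)\<close>.\<close>
  define k where "k r = (2 * real n) powr r * (s - 1) powr (1 - r) * m powr (r - s)" for r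
  have k0: "k r \<ge> 0" for r using ps p1 m by (simp add: k_def)
  define \<omega> where "\<omega> = unit_ball_vol (real DIM('a))"
  have \<omega>: "\<omega> > 0" by (simp add: \<omega>_def)
  have main: "(3/4) ^ n / 2 ^ DIM('a) \<le> k p * \<rho> powr (- p) + k q * \<rho> powr (- q)" if \<rho>: "\<rho> > 0" for \<rho>
  proof -
    \<comment> \<open>The centre is so far out that the whole ball of radius \<rho> lies beyond
      \<open>R\<close>.\<close>
    define c where "c = (R + \<rho> + 1) *\<^sub>R e"
    have nc: "norm c = R + \<rho> + 1" using R \<rho> e by (simp add: c_def)
    have far: "norm x > R" if "norm (x - c) \<le> \<rho>" for x
      using that nc norm_triangle_ineq2[of c x] by (simp add: norm_minus_commute)
    have sub: "cball c \<rho> \<subseteq> \<Omega>" using far R(2) by (auto simp: dist_norm norm_minus_commute)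
    let ?b = "bump c \<rho> n"
    note b = bump_C1_c[OF \<rho> n(1) sub]
    define M where "M x = indicator (ball c \<rho>) x * (k p * \<rho> powr (- p) + k q * \<rho> powr (- q))" for x
    have "(LBINT x. u x powr (s - 1) * (u x powr (1 - s) * ?b x)) \<le> (LBINT x. M x)"
    proof (rule caccioppoli[where h'="\<lambda>t. (1 - s) * t powr (- s)" and k="\<lambda>x. (s - 1) * u x powr (- s) * ?b x"])
      show "?b \<in> C1_c \<Omega>" by (rule b(1))
      show "?b x \<ge> 0" for x by (rule bump_nonneg)
      show "DERIV (\<lambda>t. t powr (1 - s)) t :> (1 - s) * t powr (- s)" if "t > 0" for t :: real
        using has_real_derivative_powr[OF that, of "1 - s"] by simp
      show "continuous_on {0<..} (\<lambda>t. (1 - s) * t powr (- s))" by (intro continuous_intros) auto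
      show "0 \<le> (s - 1) * u x powr (- s) * ?b x" for x using ps p1 bump_nonneg[of c \<rho> n x] by simp
      show "(s - 1) * u x powr (- s) * ?b x \<le> - ((1 - s) * u x powr (- s)) * ?b x" for x
        by (simp add: algebra_simps)
      show "integrable lborel M" unfolding M_def using emeasure_ball[of \<rho> c] \<rho> by simp
      show "0 \<le> M x" for x using k0[of p] k0[of q] by (simp add: M_def)
      have g0: "gradient ?b x = 0 \<and> M x \<ge> 0" if "x \<notin> ball c \<rho>" for x
        using bump_eq_0[OF \<rho>, of "n - 1" x c] n that
        by (simp add: b(2) M_def dist_norm norm_minus_commute)
      show "u x powr (1 - s) * norm (gradient ?b x) = 0" if x: "x \<in> \<Omega>" and z: "(s - 1) * u x powr (- s) * ?b x = 0" for x
      proof -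
        have "?b x = 0" using z pos[OF x] ps p1 by simp
        then have "max 0 (1 - (norm (x - c) / \<rho>)\<^sup>2) = 0" using n by (simp add: bump_def)
        then have "bump c \<rho> (n - 1) x = 0" using n by (simp add: bump_def)
        then show ?thesis by (simp add: b(2))
      qed
      fix x assume x: "x \<in> \<Omega>"
      show "(u x powr (1 - s) * norm (gradient ?b x)) powr p * ((s - 1) * u x powr (- s) * ?b x) powr (1 - p) +
         (u x powr (1 - s) * norm (gradient ?b x)) powr q * ((s - 1) * u x powr (- s) * ?b x) powr (1 - q) \<le> M x"
      proof (cases "x \<in> ball c \<rho>")
        case False
        then show ?thesis using g0[OF False] by simp
      next
        case True
        then have nx: "norm (x - c) < \<rho>" by (simp add: dist_norm norm_minus_commute)
        define z where "z = max 0 (1 - (norm (x - c) / \<rho>)\<^sup>2)"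
        have "(norm (x - c) / \<rho>)\<^sup>2 < 1" using nx \<rho> by (simp add: power_less_one_iff abs_square_less_1)
        then have z: "0 < z" "z \<le> 1" by (auto simp: z_def)
        have um: "u x \<ge> m" using m(2) far nx by simp
        have N: "norm (gradient ?b x) \<le> (2 * real n / \<rho>) * z ^ (n - 1)"
        proof -
          have "norm (gradient ?b x) = (2 * real n / \<rho>\<^sup>2) * z ^ (n - 1) * norm (x - c)"
            unfolding b(2) bump_def z_def[symmetric] using z by (simp add: abs_mult)
          also have "\<dots> \<le> (2 * real n / \<rho>\<^sup>2) * z ^ (n - 1) * \<rho>" using nx z by (intro mult_left_mono) auto
          also have "\<dots> = (2 * real n / \<rho>) * z ^ (n - 1)" using \<rho> by (simp add: power2_eq_square)
          finally show ?thesis .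
        qed
        have tm: "(u x powr (1 - s) * norm (gradient ?b x)) powr r * ((s - 1) * u x powr (- s) * ?b x) powr (1 - r) \<le> k r * \<rho> powr (- r)"
          if r: "r > 1" "r \<le> p" for r
        proof -
          have u0: "u x > 0" using m(1) um by linarith
          have zn: "?b x = z powr real n" "z ^ (n - 1) = z powr (real n - 1)"
            using z n(1) by (simp_all add: bump_def z_def[symmetric] powr_realpow[symmetric] of_nat_diff)
          have "(u x powr (1 - s) * norm (gradient ?b x)) powr r \<le> (u x powr (1 - s) * ((2 * real n / \<rho>) * z powr (real n - 1))) powr r"
            using r N unfolding zn by (intro powr_mono2 mult_left_mono) auto
          then have "(u x powr (1 - s) * norm (gradient ?b x)) powr r * ((s - 1) * u x powr (- s) * ?b x) powr (1 - r) \<le>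
             (u x powr (1 - s) * ((2 * real n / \<rho>) * z powr (real n - 1))) powr r * ((s - 1) * u x powr (- s) * z powr real n) powr (1 - r)"
            unfolding zn(1) by (rule mult_right_mono) simp
          also have "\<dots> = (u x powr ((1 - s) * r) * (((2 * real n) powr r * \<rho> powr (- r)) * z powr ((real n - 1) * r))) *
             ((s - 1) powr (1 - r) * u x powr (- s * (1 - r)) * z powr (real n * (1 - r)))"
            using u0 z \<rho> ps p1 by (simp add: powr_mult powr_powr powr_divide powr_minus_divide)
          also have "\<dots> = ((2 * real n) powr r * (s - 1) powr (1 - r) * (u x powr ((1 - s) * r) * u x powr (- s * (1 - r)))) *
             \<rho> powr (- r) * (z powr ((real n - 1) * r) * z powr (real n * (1 - r)))" by (simp only: mult_ac)
          also have "u x powr ((1 - s) * r) * u x powr (- s * (1 - r)) = u x powr (r - s)"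
            unfolding powr_add[symmetric] by (simp add: algebra_simps)
          also have "z powr ((real n - 1) * r) * z powr (real n * (1 - r)) = z powr (real n - r)"
            unfolding powr_add[symmetric] by (simp add: algebra_simps)
          also have "((2 * real n) powr r * (s - 1) powr (1 - r) * u x powr (r - s)) * \<rho> powr (- r) * z powr (real n - r) \<le>
            ((2 * real n) powr r * (s - 1) powr (1 - r) * m powr (r - s)) * \<rho> powr (- r) * 1"
          proof -
            have "u x powr (r - s) \<le> m powr (r - s)" using r ps m(1) um by (intro powr_mono2') auto
            moreover have "z powr (real n - r) \<le> 1" using z r n by (intro powr_le1) auto
            ultimately show ?thesis by (intro mult_mono) (auto intro!: mult_nonneg_nonneg)
          qed
          finally show ?thesis by (simp add: k_def)
        qed
        show ?thesis using tm[of p] tm[of q] p1 q1 qp True by (simp add: M_def)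
      qed
    qed auto
    moreover have "u x powr (s - 1) * (u x powr (1 - s) * ?b x) = ?b x" for x
    proof (cases "norm (x - c) < \<rho>")
      case True
      then have "u x > 0" using m(2)[OF far, of x] m(1) by simp
      then have "u x powr (s - 1) * u x powr (1 - s) = 1" by (simp flip: powr_add)
      then show ?thesis by (simp flip: mult.assoc)
    next
      case False
      then show ?thesis using bump_eq_0[OF \<rho>, of n x c] n by simp
    qed
    ultimately have "(LBINT x. ?b x) \<le> (LBINT x. M x)" by simp
    also have "\<dots> = (k p * \<rho> powr (- p) + k q * \<rho> powr (- q)) * measure lborel (ball c \<rho>)"
      unfolding M_def using emeasure_ball[of \<rho> c] \<rho> by simp
    also have "measure lborel (ball c \<rho>) = \<omega> * \<rho> ^ DIM('a)"
      using measure_ball_eq[of \<rho> c] \<rho> by (simp add: \<omega>_def)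
    finally have "(3/4) ^ n * \<omega> * (\<rho> / 2) ^ DIM('a) \<le> (k p * \<rho> powr (- p) + k q * \<rho> powr (- q)) * (\<omega> * \<rho> ^ DIM('a))"
      using bump_integral_ge[OF \<rho> n(1), of c, folded \<omega>_def] by linarith
    then have "((3/4) ^ n / 2 ^ DIM('a)) * (\<omega> * \<rho> ^ DIM('a)) \<le> (k p * \<rho> powr (- p) + k q * \<rho> powr (- q)) * (\<omega> * \<rho> ^ DIM('a))"
      by (simp add: power_divide mult_ac)
    then show ?thesis using \<omega> \<rho> by (simp only: mult_le_cancel_right_pos mult_pos_pos zero_less_power)
  qed
  have "((\<lambda>\<rho>. k p * \<rho> powr (- p) + k q * \<rho> powr (- q)) \<longlongrightarrow> k p * 0 + k q * 0) at_top"
    using p1 q1 by (intro tendsto_intros tendsto_neg_powr filterlim_ident) auto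
  then have "eventually (\<lambda>\<rho>. k p * \<rho> powr (- p) + k q * \<rho> powr (- q) < (3/4) ^ n / 2 ^ DIM('a)) at_top"
    by (rule order_tendstoD(2)) simp
  then have "eventually (\<lambda>\<rho>::real. False) at_top"
    using eventually_gt_at_top[of 0] by eventually_elim (use main in force)
  then show False by simp
qed


text \<open>One estimate, \<open>main\<close>, is used with two majorants: first with half of its
  own left side, which bounds the integral of \<open>E\<close> independently of the radius, then
  with a small constant plus a term whose integral tends to 0. Together they force \<open>E\<close>
  to vanish almost everywhere.\<close>

lemma bounded_below_near_infinity:
  assumes ps: "p < s" and qN: "q < real DIM('a)"
    and crit: "s \<le> q * (real DIM('a) - 1) / (real DIM('a) - q)"
    and R: "R > 0" "{x. norm x > R} \<subseteq> \<Omega>"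
  shows "\<exists>m>0. \<forall>x. norm x > R + 2 \<longrightarrow> m \<le> u x"
proof -

  \<comment> \<open>Exponents and absorption constants\<close>
  define N where "N = real DIM('a)"
  define S where "S = s - 1"
  define \<kappa> where "\<kappa> = q / (s - q)"
  have sq: "s - q > 0" using ps qp by simp
  have S: "S > 0" using ps p1 by (simp add: S_def)
  have \<kappa>: "\<kappa> > 0" using sq q1 by (simp add: \<kappa>_def)
  \<comment> \<open>The criticality assumption becomes \<open>N <= \<kappa> * S\<close>. The
    identity \<open>\<kappa>q\<close> is the homogeneity that singles out \<kappa>: q-Laplacian and
    nonlinearity scale alike.\<close>
  have "s * (N - q) \<le> q * (N - 1)" using crit qN by (simp add: N_def pos_le_divide_eq)
  then have "N * (s - q) \<le> q * (s - 1)" by (simp add: algebra_simps)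
  then have \<kappa>N: "N \<le> \<kappa> * S" using sq by (simp add: \<kappa>_def S_def pos_le_divide_eq)
  have \<kappa>q: "\<kappa> * S = \<kappa> * (q - 1) + q" using sq by (simp add: \<kappa>_def S_def field_simps)
  \<comment> \<open>The first entry keeps \<open>r - 1 - \<alpha>\<close> positive for r >= q, the
    second keeps \<open>(\<alpha> + 1) * (p - 1)\<close> below \<open>S\<close>; both absorption
    lemmas ask for exponents strictly between 0 and \<open>S\<close>.\<close>
  define \<alpha> where "\<alpha> = min ((q - 1) / 2) ((s - p) / (2 * (p - 1)))"
  have "\<alpha> \<le> (q - 1) / 2" unfolding \<alpha>_def by (rule min.cobounded1)
  moreover have "\<alpha> > 0" using q1 p1 ps by (simp add: \<alpha>_def)
  ultimately have \<alpha>: "\<alpha> > 0" "\<alpha> < q - 1" using q1 by auto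
  have "(\<alpha> + 1) * (p - 1) \<le> ((s - p) / (2 * (p - 1)) + 1) * (p - 1)"
    using p1 by (intro mult_right_mono) (auto simp: \<alpha>_def)
  also have "\<dots> = (s - p) / 2 + (p - 1)" using p1 by (simp add: field_simps)
  also have "\<dots> < S" using ps by (simp add: S_def field_simps)
  finally have fS: "(\<alpha> + 1) * (p - 1) < S" .
  define f where "f r = (\<alpha> + 1) * (r - 1)" for r
  define e where "e r = r - 1 - \<alpha>" for r
  have fle: "f r \<le> f p" if "r \<le> p" for r using that \<alpha> by (simp add: f_def)
  have ef: "0 < e r" "e r \<le> f r" "0 < f r" if "q \<le> r" for r
  proof -
    show "0 < e r" using that \<alpha> by (simp add: e_def)
    have "0 \<le> \<alpha> * (r - 1)" using that \<alpha> q1 by simp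
    then have "r - 1 \<le> f r" by (simp add: f_def algebra_simps)
    then show "e r \<le> f r" "0 < f r" using \<alpha> that q1 by (auto simp: e_def)
  qed
  have fpS: "f p < S" using fS by (simp add: f_def)
  obtain n0 :: nat where n0: "p * S / (S - f p) \<le> real n0" using real_arch_simple by blast
  \<comment> \<open>\<open>n0\<close> serves all four absorptions, since
    \<open>r * S / (S - t)\<close> grows with r and t; the added 2 makes the bump C1.\<close>
  define n where "n = n0 + 2"
  have n: "n \<ge> 2" "p * S / (S - f p) \<le> real n" using n0 by (auto simp: n_def)
  have nr: "r * S / (S - t) \<le> real n" if "q \<le> r" "r \<le> p" "t \<le> f p" for r t
  proof -
    have "r * S / (S - t) \<le> p * S / (S - f p)"
      using that fpS S q1 by (intro frac_le mult_right_mono mult_nonneg_nonneg) auto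
    then show ?thesis using n(2) by simp
  qed
  have np: "p \<le> real n"
  proof -
    have "p \<le> p * S / (S - f p)" using p1 fpS ef(3)[of p] qp by (simp add: pos_le_divide_eq)
    then show ?thesis using n(2) by simp
  qed
  define W where "W = (4 * real n) powr p * \<alpha> powr (1 - p) + (4 * real n) powr q * \<alpha> powr (1 - q)"
  have W: "W > 0" using n \<alpha> by (simp add: W_def add_pos_pos)
  define \<Phi> where "\<Phi> z U = z powr (real n - p) * (U powr e p + U powr f p) + z powr (real n - q) * (U powr e q + U powr f q)" for z U
  \<comment> \<open>Each of the four terms is allowed the share 1/8, so that half of the left side
    remains after absorption.\<close>
  obtain C1 where C1: "C1 \<ge> 0" "\<And>z U. 0 < z \<Longrightarrow> z \<le> 1 \<Longrightarrow> U > 0 \<Longrightarrow> W * \<Phi> z U \<le> 1/2 * (U powr S * z ^ n) + C1"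
  proof -
    have c: "1 / (8 * W) > 0" using W by simp
    obtain c1 where c1: "c1 \<ge> 0" "\<And>U z. U > 0 \<Longrightarrow> 0 < z \<Longrightarrow> z \<le> 1 \<Longrightarrow> z powr (real n - p) * U powr e p \<le> 1 / (8 * W) * (U powr S * z ^ n) + c1"
      using young_absorb_cutoff[of "e p" S p n "1 / (8 * W)"] ef[of p] nr[of p "e p"] fpS qp p1 c by auto
    obtain c2 where c2: "c2 \<ge> 0" "\<And>U z. U > 0 \<Longrightarrow> 0 < z \<Longrightarrow> z \<le> 1 \<Longrightarrow> z powr (real n - p) * U powr f p \<le> 1 / (8 * W) * (U powr S * z ^ n) + c2"
      using young_absorb_cutoff[of "f p" S p n "1 / (8 * W)"] ef[of p] nr[of p "f p"] fpS qp p1 c by auto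
    obtain c3 where c3: "c3 \<ge> 0" "\<And>U z. U > 0 \<Longrightarrow> 0 < z \<Longrightarrow> z \<le> 1 \<Longrightarrow> z powr (real n - q) * U powr e q \<le> 1 / (8 * W) * (U powr S * z ^ n) + c3"
      using young_absorb_cutoff[of "e q" S q n "1 / (8 * W)"] ef[of q] nr[of q "e q"] fpS fle[of q] qp q1 c by auto
    obtain c4 where c4: "c4 \<ge> 0" "\<And>U z. U > 0 \<Longrightarrow> 0 < z \<Longrightarrow> z \<le> 1 \<Longrightarrow> z powr (real n - q) * U powr f q \<le> 1 / (8 * W) * (U powr S * z ^ n) + c4"
      using young_absorb_cutoff[of "f q" S q n "1 / (8 * W)"] ef[of q] nr[of q "f q"] fpS fle[of q] qp q1 c by auto
    show ?thesis
    proof (rule that[of "W * (c1 + c2 + c3 + c4)"])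
      show "W * (c1 + c2 + c3 + c4) \<ge> 0" using W c1 c2 c3 c4 by simp
      fix z U :: real assume zU: "0 < z" "z \<le> 1" "U > 0"
      have "\<Phi> z U \<le> 4 * (1 / (8 * W) * (U powr S * z ^ n)) + (c1 + c2 + c3 + c4)"
        using c1(2)[OF zU(3,1,2)] c2(2)[OF zU(3,1,2)] c3(2)[OF zU(3,1,2)] c4(2)[OF zU(3,1,2)]
        unfolding \<Phi>_def distrib_left by linarith
      then have "W * \<Phi> z U \<le> W * (4 * (1 / (8 * W) * (U powr S * z ^ n)) + (c1 + c2 + c3 + c4))"
        using W by (intro mult_left_mono) auto
      also have "\<dots> = 1/2 * (U powr S * z ^ n) + W * (c1 + c2 + c3 + c4)" using W by (simp add: distrib_left)
      finally show "W * \<Phi> z U \<le> 1/2 * (U powr S * z ^ n) + W * (c1 + c2 + c3 + c4)" .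
    qed
  qed
  \<comment> \<open>Here the cutoff powers are just bounded by 1, and in return the constant \<eta>
    is at free disposal.\<close>
  have C2: "\<exists>C\<ge>0. \<forall>z U. 0 < z \<longrightarrow> z \<le> 1 \<longrightarrow> U > 0 \<longrightarrow> W * \<Phi> z U \<le> \<eta> + C * U powr S" if \<eta>: "\<eta> > 0" for \<eta>
  proof -
    have c: "\<eta> / (4 * W) > 0" using W \<eta> by simp
    obtain c1 where c1: "c1 \<ge> 0" "\<And>U. U > 0 \<Longrightarrow> U powr e p \<le> \<eta> / (4 * W) + c1 * U powr S"
      using young_absorb_small[of "e p" S "\<eta> / (4 * W)"] ef[of p] fpS qp c by auto
    obtain c2 where c2: "c2 \<ge> 0" "\<And>U. U > 0 \<Longrightarrow> U powr f p \<le> \<eta> / (4 * W) + c2 * U powr S"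
      using young_absorb_small[of "f p" S "\<eta> / (4 * W)"] ef[of p] fpS qp c by auto
    obtain c3 where c3: "c3 \<ge> 0" "\<And>U. U > 0 \<Longrightarrow> U powr e q \<le> \<eta> / (4 * W) + c3 * U powr S"
      using young_absorb_small[of "e q" S "\<eta> / (4 * W)"] ef[of q] fpS fle[of q] qp c by auto
    obtain c4 where c4: "c4 \<ge> 0" "\<And>U. U > 0 \<Longrightarrow> U powr f q \<le> \<eta> / (4 * W) + c4 * U powr S"
      using young_absorb_small[of "f q" S "\<eta> / (4 * W)"] ef[of q] fpS fle[of q] qp c by auto
    have "W * \<Phi> z U \<le> \<eta> + (W * (c1 + c2 + c3 + c4)) * U powr S" if zU: "0 < z" "z \<le> 1" "U > 0" for z U
    proof -
      have z1: "z powr (real n - r) * t \<le> t" if "r \<le> p" "t \<ge> 0" for r t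
        using that np zU(1,2) by (intro mult_left_le_one_le powr_le1) auto
      have "\<Phi> z U \<le> (U powr e p + U powr f p) + (U powr e q + U powr f q)"
        unfolding \<Phi>_def using qp by (intro add_mono z1) auto
      also have "\<dots> \<le> 4 * (\<eta> / (4 * W)) + (c1 + c2 + c3 + c4) * U powr S"
        using c1(2)[OF zU(3)] c2(2)[OF zU(3)] c3(2)[OF zU(3)] c4(2)[OF zU(3)]
        by (simp add: distrib_right)
      finally have "W * \<Phi> z U \<le> W * (4 * (\<eta> / (4 * W)) + (c1 + c2 + c3 + c4) * U powr S)"
        using W by (intro mult_left_mono) auto
      also have "\<dots> = \<eta> + (W * (c1 + c2 + c3 + c4)) * U powr S" using W by (simp add: distrib_left)
      finally show ?thesis .
    qed
    then show ?thesis using W c1(1) c2(1) c3(1) c4(1)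
      by (intro exI[of _ "W * (c1 + c2 + c3 + c4)"]) simp
  qed

  \<comment> \<open>The closed annulus between \<open>a\<close> and \<open>b\<close> stays away from
    radius \<open>R\<close>, so it lies in \<Omega> and \<open>u\<close> has a positive minimum on
    it; its outer radius is the \<open>R + 2\<close> of the conclusion.\<close>
  define a where "a = R + 1"
  define b where "b = R + 2"
  have ab: "0 < a" "a < b" "R < a" using R by (auto simp: a_def b_def)
  obtain \<xi> :: "'a \<Rightarrow> real" and X where \<xi>: "\<And>x. GDERIV \<xi> x :> X x" "continuous_on UNIV X" "\<And>x. 0 \<le> \<xi> x" "\<And>x. \<xi> x \<le> 1"
    "\<And>x. norm x \<le> a \<Longrightarrow> \<xi> x = 0" "\<And>x. norm x > a \<Longrightarrow> \<xi> x > 0"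
    "\<And>x. norm x \<ge> b \<Longrightarrow> \<xi> x = 1" "\<And>x. X x \<noteq> 0 \<Longrightarrow> a < norm x \<and> norm x < b"
    using radial_cutoff_exists[OF ab(1,2)] by metis
  have \<xi>c: "continuous_on UNIV \<xi>"
    by (rule GDERIV_continuous_on) (rule \<xi>(1))
  have in\<Omega>: "x \<in> \<Omega>" if "norm x \<ge> a" for x using that ab R(2) by auto
  obtain m where m: "m > 0" "\<And>x. a \<le> norm x \<Longrightarrow> norm x \<le> b \<Longrightarrow> m \<le> u x"
  proof -
    have cA: "compact (cball (0::'a) b - ball 0 a)" by (intro compact_diff) auto
    obtain v :: 'a where v: "v \<in> Basis" using nonempty_Basis by blast
    have "b *\<^sub>R v \<in> cball 0 b - ball 0 a" using v ab by simp
    then have ne: "cball (0::'a) b - ball 0 a \<noteq> {}" by blast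
    have sub: "cball 0 b - ball 0 a \<subseteq> \<Omega>" using in\<Omega> by auto
    obtain y where "y \<in> cball 0 b - ball 0 a" "\<And>x. x \<in> cball 0 b - ball 0 a \<Longrightarrow> u y \<le> u x"
      using continuous_attains_inf[OF cA ne continuous_on_subset[OF cont sub]] by blast
    then show ?thesis using that[of "u y"] pos sub by auto
  qed
  \<comment> \<open>Truncation and inner cutoff combined: \<open>D\<close> vanishes where
    \<open>u >= m\<close>, in particular wherever \<xi> varies.\<close>
  define D where "D x = max 0 (m - u x) ^ 2 * \<xi> x" for x
  have D0: "D x \<ge> 0" for x using \<xi>(3) by (simp add: D_def)
  have Dout: "D x = 0" if "x \<notin> \<Omega>" for x
    using that in\<Omega>[of x] \<xi>(5)[of x] by (cases "norm x \<le> a") (auto simp: D_def)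
  have Dm: "D x \<le> m\<^sup>2" for x
  proof (cases "x \<in> \<Omega>")
    case True
    have "max 0 (m - u x) ^ 2 \<le> m\<^sup>2" using pos[OF True] m(1) by (intro power_mono) auto
    then have "max 0 (m - u x) ^ 2 * \<xi> x \<le> m\<^sup>2 * 1" using \<xi>(3,4) by (intro mult_mono) auto
    then show ?thesis by (simp add: D_def)
  qed (simp add: Dout)
  define E where "E x = u x powr S * D x" for x
  have E0: "E x \<ge> 0" for x using D0 by (simp add: E_def)
  have Ec: "continuous_on \<Omega> E"
  proof -
    have "\<forall>x\<in>\<Omega>. u x \<noteq> 0" using pos by force
    then show ?thesis unfolding E_def D_def
      by (intro continuous_intros cont continuous_on_powr continuous_on_subset[OF \<xi>c]) auto
  qed
  have Em[measurable]: "E \<in> borel_measurable borel"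
  proof -
    have "(\<lambda>x. indicator \<Omega> x *\<^sub>R E x) \<in> borel_measurable borel"
      by (rule borel_measurable_continuous_on_indicator[OF _ Ec]) (use open_dom in simp)
    moreover have "indicator \<Omega> x *\<^sub>R E x = E x" for x using Dout[of x] by (cases "x \<in> \<Omega>") (simp_all add: E_def)
    ultimately show ?thesis by (simp only:)
  qed

  \<comment> \<open>\<open>M\<close> is any integrable majorant of the Young remainders. The factor
    \<open>(norm x / \<rho>) powr q\<close> comes from the bump gradient, which is proportional to
    x; it is bounded by 1 in the first pass and decisive in the second.\<close>
  have main: "integrable lborel (\<lambda>x. E x * bump 0 \<rho> n x) \<and> (LBINT x. E x * bump 0 \<rho> n x) \<le> (LBINT x. M x)"
    if \<rho>: "\<rho> \<ge> 1" and M: "integrable lborel M" "\<And>x. M x \<ge> 0"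
      and le: "\<And>x z U. norm x < \<rho> \<Longrightarrow> x \<in> \<Omega> \<Longrightarrow> D x > 0 \<Longrightarrow> z > 0 \<Longrightarrow> z \<le> 1 \<Longrightarrow> z ^ n = bump 0 \<rho> n x \<Longrightarrow>
        U = \<rho> powr \<kappa> * u x \<Longrightarrow>
        \<rho> powr (- (\<kappa> * S)) * (D x * (norm x / \<rho>) powr q) * (W * \<Phi> z U) \<le> M x" for \<rho> and M :: "'a \<Rightarrow> real"
  proof -
    have \<rho>0: "\<rho> > 0" using \<rho> by simp
    let ?b = "bump (0::'a) \<rho> n"
    define \<delta> where "\<delta> = \<rho> powr (- (\<kappa> * \<alpha>))"
    have \<delta>: "\<delta> > 0" using \<rho>0 by (simp add: \<delta>_def)
    define h where "h t = max 0 (m - t) ^ 2 * (1 + \<delta> * t powr (- \<alpha>))" for t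
    define h' where "h' t = - (2 * max 0 (m - t)) * (1 + \<delta> * t powr (- \<alpha>)) +
      max 0 (m - t) ^ 2 * (\<delta> * (- \<alpha> * t powr (- \<alpha> - 1)))" for t
    have h1: "DERIV h t :> h' t" if "t > 0" for t
    proof -
      have "DERIV (\<lambda>t. m - t) t :> - 1" by (auto intro!: derivative_eq_intros)
      from DERIV_chain2[OF DERIV_pos_part_power[of 2] this]
      have 1: "DERIV (\<lambda>t. max 0 (m - t) ^ 2) t :> - (2 * max 0 (m - t))" by simp
      have 2: "DERIV (\<lambda>t. 1 + \<delta> * t powr (- \<alpha>)) t :> \<delta> * (- \<alpha> * t powr (- \<alpha> - 1))"
        using DERIV_add[OF DERIV_const[of 1] DERIV_cmult[OF has_real_derivative_powr[OF that, of "- \<alpha>"], of \<delta>]] by simp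
      show ?thesis unfolding h_def h'_def using DERIV_mult[OF 1 2] by (simp add: add.commute mult.commute)
    qed
    have h2: "continuous_on {0<..} h'" unfolding h'_def by (intro continuous_intros) auto
    have h3: "h t \<ge> 0" if "t > 0" for t using \<delta> by (simp add: h_def)
    note b = bump_C1_c[OF \<rho>0 n(1) subset_UNIV, of "0::'a"]
    define \<psi> where "\<psi> x = \<xi> x * ?b x" for x
    have P: "\<psi> \<in> C1_c UNIV" "gradient \<psi> = (\<lambda>x. \<xi> x *\<^sub>R gradient ?b x + ?b x *\<^sub>R X x)"
      unfolding \<psi>_def by (rule C1_c_mult[OF b(1) open_UNIV subset_UNIV \<xi>(1) \<xi>(2)])+
    have psi: "\<psi> \<in> C1_c \<Omega>"
    proof (rule C1_cI(1)[OF C1_cD(1)[OF P(1)] C1_cD(2)[OF P(1)]])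
      show "compact (cball (0::'a) \<rho> - ball 0 a)" by (intro compact_diff) auto
      show "cball 0 \<rho> - ball 0 a \<subseteq> \<Omega>" using in\<Omega> by auto
      show "\<psi> x = 0" if "x \<notin> cball 0 \<rho> - ball 0 a" for x
        using that \<xi>(5)[of x] bump_eq_0[OF \<rho>0, of n x 0] n by (auto simp: \<psi>_def)
    qed
    have psi0: "\<psi> x \<ge> 0" for x using \<xi>(3) bump_nonneg[of 0 \<rho> n x] by (simp add: \<psi>_def)
    \<comment> \<open>Only the derivative of the weight is kept for absorption; the derivative of
      the truncation has the favourable sign and is dropped.\<close>
    define k where "k x = D x * (\<alpha> * \<delta> * u x powr (- \<alpha> - 1)) * ?b x" for x
    define z where "z x = max 0 (1 - (norm x / \<rho>)\<^sup>2)" for x :: 'a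
    have bz: "bump 0 \<rho> i x = z x ^ i" for i x by (simp add: bump_def z_def)
    have ng: "norm (gradient ?b x) = (2 * real n / \<rho>) * (norm x / \<rho>) * z x ^ (n - 1)" for x
      unfolding b(2) bz by (simp add: z_def abs_mult power2_eq_square)
    have hN: "h (u x) * norm (gradient \<psi> x) = D x * (1 + \<delta> * u x powr (- \<alpha>)) * ((2 * real n / \<rho>) * (norm x / \<rho>) * z x ^ (n - 1))" for x
    proof (cases "max 0 (m - u x) = 0")
      case True
      then show ?thesis by (simp add: h_def D_def)
    next
      case False
      \<comment> \<open>A nonzero gradient of \<xi> would place x in the annulus, where
        \<open>u >= m\<close>, against the case assumption.\<close>
      then have "X x = 0" using \<xi>(8)[of x] m(2)[of x] by fastforce
      then have "norm (gradient \<psi> x) = \<xi> x * norm (gradient ?b x)" using \<xi>(3) by (simp add: P(2))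
      then show ?thesis unfolding ng by (simp add: h_def D_def)
    qed
    have C: "(LBINT x. u x powr (s - 1) * (h (u x) * \<psi> x)) \<le> (LBINT x. M x)"
    proof (rule caccioppoli[OF psi psi0 h1 h2 h3, where k=k])
      fix x assume x: "x \<in> \<Omega>"
      have ux: "u x > 0" by (rule pos[OF x])
      show "0 \<le> k x" using D0[of x] \<alpha> \<delta> bump_nonneg[of 0 \<rho> n x] by (simp add: k_def)
      show "k x \<le> - h' (u x) * \<psi> x"
      proof -
        have "0 \<le> 2 * max 0 (m - u x) * (1 + \<delta> * u x powr (- \<alpha>)) * \<psi> x"
          using psi0[of x] \<delta> by (simp add: add_nonneg_nonneg)
        moreover have "- h' (u x) * \<psi> x = 2 * max 0 (m - u x) * (1 + \<delta> * u x powr (- \<alpha>)) * \<psi> x + k x"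
          unfolding h'_def k_def D_def \<psi>_def by (simp add: algebra_simps)
        ultimately show ?thesis by linarith
      qed
      have z0: "h (u x) * norm (gradient \<psi> x) = 0" if "D x = 0 \<or> z x = 0"
        using that n unfolding hN by auto
      show "h (u x) * norm (gradient \<psi> x) = 0" if "k x = 0"
        using that \<alpha> \<delta> ux by (intro z0) (auto simp: k_def bz)
      show "(h (u x) * norm (gradient \<psi> x)) powr p * k x powr (1 - p)
        + (h (u x) * norm (gradient \<psi> x)) powr q * k x powr (1 - q) \<le> M x"
      proof (cases "D x = 0 \<or> z x = 0")
        case True
        show ?thesis unfolding z0[OF True] using M(2)[of x] by simp
      next
        case False
        then have Dx: "D x > 0" and zx: "z x > 0" using D0[of x] by (auto simp: z_def)
        have z1: "z x \<le> 1" by (simp add: z_def)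
        have nx: "norm x < \<rho>" using bump_eq_0[OF \<rho>0, of n x 0] n zx by (force simp: bz)
        define \<tau> where "\<tau> = norm x / \<rho>"
        have \<tau>: "0 \<le> \<tau>" "\<tau> \<le> 1" using nx \<rho>0 by (auto simp: \<tau>_def)
        define U where "U = \<rho> powr \<kappa> * u x"
        have tm: "(h (u x) * norm (gradient \<psi> x)) powr r * k x powr (1 - r) \<le>
          \<rho> powr (- (\<kappa> * S)) * (D x * \<tau> powr q) * (W * (z x powr (real n - r) * (U powr e r + U powr f r)))"
          if r: "r = p \<or> r = q" for r
        proof -
          have r1: "r > 1" "q \<le> r" using r p1 q1 qp by auto
          have "(h (u x) * norm (gradient \<psi> x)) powr r * k x powr (1 - r) \<le>
             \<rho> powr (- (\<kappa> * (r - 1) + r)) * (D x * \<tau> powr r) * ((4 * real n) powr r * \<alpha> powr (1 - r)) *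
             (z x powr (real n - r) * (U powr e r + U powr f r))"
            unfolding hN k_def bz e_def f_def \<delta>_def U_def \<tau>_def[symmetric]
            by (rule weighted_young_term[OF r1(1) Dx zx \<tau>(1) \<rho>0 ux \<alpha>(1) n(1)])
          also have "\<dots> \<le> \<rho> powr (- (\<kappa> * S)) * (D x * \<tau> powr q) * W * (z x powr (real n - r) * (U powr e r + U powr f r))"
          proof (intro mult_right_mono mult_mono mult_left_mono)
            \<comment> \<open>For \<rho> >= 1 the p-term is dominated by the scaling of the q-term,
              whose exponent is \<open>- (\<kappa> * S)\<close>.\<close>
            show "\<rho> powr (- (\<kappa> * (r - 1) + r)) \<le> \<rho> powr (- (\<kappa> * S))"
            proof (rule powr_mono[OF _ \<rho>])
              have "\<kappa> * (q - 1) \<le> \<kappa> * (r - 1)" using r1(2) \<kappa> by (intro mult_left_mono) auto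
              then show "- (\<kappa> * (r - 1) + r) \<le> - (\<kappa> * S)" unfolding \<kappa>q using r1(2) by linarith
            qed
            show "\<tau> powr r \<le> \<tau> powr q" using \<tau> r1 by (intro powr_mono') auto
            show "(4 * real n) powr r * \<alpha> powr (1 - r) \<le> W" using r by (auto simp: W_def)
          qed (use D0[of x] in auto)
          finally show ?thesis by (simp only: mult.assoc)
        qed
        have "(h (u x) * norm (gradient \<psi> x)) powr p * k x powr (1 - p)
          + (h (u x) * norm (gradient \<psi> x)) powr q * k x powr (1 - q) \<le>
          \<rho> powr (- (\<kappa> * S)) * (D x * \<tau> powr q) * (W * \<Phi> (z x) U)"
          using tm[of p] tm[of q] unfolding \<Phi>_def by (simp add: distrib_left)
        also have "\<dots> \<le> M x"
          unfolding \<tau>_def by (rule le[OF nx x Dx zx z1 bz[symmetric] U_def])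
        finally show ?thesis .
      qed
    qed (use M in auto)
    have I: "integrable lborel (\<lambda>x. u x powr (s - 1) * (h (u x) * \<psi> x))"
      by (rule test_composite(1)[OF psi psi0 h1 h2 h3])
    have le': "E x * ?b x \<le> u x powr (s - 1) * (h (u x) * \<psi> x)" for x
    proof -
      have "max 0 (m - u x) ^ 2 \<le> h (u x)" unfolding h_def using \<delta>
        by (simp add: mult_le_cancel_left1)
      then have "max 0 (m - u x) ^ 2 * \<psi> x \<le> h (u x) * \<psi> x" using psi0 by (rule mult_right_mono)
      from mult_left_mono[OF this, of "u x powr S"] show ?thesis
        by (simp add: E_def D_def \<psi>_def S_def mult_ac)
    qed
    have Eb0: "E x * ?b x \<ge> 0" for x using E0 bump_nonneg[of 0 \<rho> n x] by simp
    note bm = C1_cD(6)[OF b(1)]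
    have IE: "integrable lborel (\<lambda>x. E x * ?b x)"
      by (rule Bochner_Integration.integrable_bound[OF I])
         (use bm le' Eb0 in \<open>auto intro!: AE_I2 order_trans[OF le' abs_ge_self]\<close>)
    have "(LBINT x. E x * ?b x) \<le> (LBINT x. u x powr (s - 1) * (h (u x) * \<psi> x))"
      by (rule integral_mono[OF IE I le'])
    with C IE show ?thesis by simp
  qed

  define \<omega> where "\<omega> = unit_ball_vol (real DIM('a))"
  have \<omega>: "\<omega> > 0" by (simp add: \<omega>_def)
  \<comment> \<open>This is where \<open>N <= \<kappa> * S\<close> is used. In the case of equality
    the product is exactly \<omega>, so nothing better than boundedness holds.\<close>
  have ball_scale: "\<rho> powr (- (\<kappa> * S)) * measure lborel (ball (0::'a) \<rho>) \<le> \<omega>" if \<rho>: "\<rho> \<ge> 1" for \<rho>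
  proof -
    have "measure lborel (ball (0::'a) \<rho>) = \<omega> * \<rho> powr N"
      using measure_ball_eq[of \<rho> "0::'a"] \<rho> by (simp add: \<omega>_def N_def powr_realpow)
    then have "\<rho> powr (- (\<kappa> * S)) * measure lborel (ball (0::'a) \<rho>) = \<omega> * \<rho> powr (N - \<kappa> * S)"
      by (simp flip: powr_add)
    also have "\<dots> \<le> \<omega> * \<rho> powr 0" using \<omega> \<rho> \<kappa>N by (intro mult_left_mono powr_mono) auto
    finally show ?thesis using \<rho> by simp
  qed
  have IB: "integrable lborel (\<lambda>x::'a. c * indicator (ball 0 \<rho>) x :: real)" if "\<rho> > 0" for c \<rho>
    using emeasure_ball[of \<rho> "0::'a"] that by simp
  have scaleU: "\<rho> powr (- (\<kappa> * S)) * (\<rho> powr \<kappa> * u x) powr S = u x powr S" if "\<rho> > 0" "x \<in> \<Omega>" for \<rho> x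
    using that pos[OF that(2)] by (simp add: powr_mult powr_powr mult.assoc[symmetric] powr_add[symmetric])

  \<comment> \<open>First pass: uniform bound and integrability of \<open>E\<close>\<close>
  have pass1: "integrable lborel (\<lambda>x. E x * bump 0 \<rho> n x)" "(LBINT x. E x * bump 0 \<rho> n x) \<le> 2 * C1 * m\<^sup>2 * \<omega>" if \<rho>: "\<rho> \<ge> 1" for \<rho>
  proof -
    have \<rho>0: "\<rho> > 0" using \<rho> by simp
    \<comment> \<open>Finiteness must be known beforehand, because half of this integral is moved to
      the left side.\<close>
    have I0: "integrable lborel (\<lambda>x. E x * bump 0 \<rho> n x)"
    proof -
      have sub: "cball 0 \<rho> - ball 0 a \<subseteq> \<Omega>" using in\<Omega> by auto
      have "compact (cball (0::'a) \<rho> - ball 0 a)" by (intro compact_diff) auto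
      moreover have "continuous_on (cball 0 \<rho> - ball 0 a) (\<lambda>x. E x * bump 0 \<rho> n x)"
        using continuous_on_subset[OF Ec sub] C1_cD(5)[OF bump_C1_c(1)[OF \<rho>0 n(1) subset_UNIV, of "0::'a"]]
        by (intro continuous_on_mult) (auto intro: continuous_on_subset)
      ultimately have "integrable lborel (\<lambda>x. indicator (cball 0 \<rho> - ball 0 a) x *\<^sub>R (E x * bump 0 \<rho> n x))"
        by (rule borel_integrable_compact)
      moreover have "indicator (cball 0 \<rho> - ball 0 a) x *\<^sub>R (E x * bump 0 \<rho> n x) = E x * bump 0 \<rho> n x" for x
        using bump_eq_0[OF \<rho>0, of n x 0] n \<xi>(5)[of x] by (force simp: indicator_def E_def D_def)
      ultimately show ?thesis by (simp only:)
    qed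
    define M where "M x = 1/2 * (E x * bump 0 \<rho> n x) + (\<rho> powr (- (\<kappa> * S)) * C1 * m\<^sup>2) * indicator (ball 0 \<rho>) x" for x :: 'a
    have "integrable lborel (\<lambda>x. E x * bump 0 \<rho> n x) \<and> (LBINT x. E x * bump 0 \<rho> n x) \<le> (LBINT x. M x)"
    proof (rule main[OF \<rho>])
      show "integrable lborel M" unfolding M_def using I0 IB[OF \<rho>0] by (intro Bochner_Integration.integrable_add integrable_mult_right) auto
      show "M x \<ge> 0" for x using E0[of x] bump_nonneg[of 0 \<rho> n x] C1(1) by (simp add: M_def)
      fix x :: 'a and z U :: real
      assume x: "norm x < \<rho>" "x \<in> \<Omega>" "D x > 0" and z: "z > 0" "z \<le> 1" "z ^ n = bump 0 \<rho> n x" and U: "U = \<rho> powr \<kappa> * u x"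
      have U0: "U > 0" using \<rho>0 pos[OF x(2)] by (simp add: U)
      have \<tau>: "(norm x / \<rho>) powr q \<le> 1" using x(1) \<rho>0 q1 by (intro powr_le1) auto
      have "\<rho> powr (- (\<kappa> * S)) * (D x * (norm x / \<rho>) powr q) * (W * \<Phi> z U) \<le>
        \<rho> powr (- (\<kappa> * S)) * (D x * 1) * (1/2 * (U powr S * z ^ n) + C1)"
        using \<tau> D0[of x] C1(1) C1(2)[OF z(1,2) U0] W z(1)
        by (intro mult_mono mult_left_mono) (auto simp: \<Phi>_def intro!: mult_nonneg_nonneg add_nonneg_nonneg)
      also have "\<dots> = 1/2 * ((\<rho> powr (- (\<kappa> * S)) * U powr S) * D x * z ^ n) + (\<rho> powr (- (\<kappa> * S)) * C1) * D x"
        by (simp add: algebra_simps)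
      also have "\<rho> powr (- (\<kappa> * S)) * U powr S = u x powr S" unfolding U by (rule scaleU[OF \<rho>0 x(2)])
      also have "(\<rho> powr (- (\<kappa> * S)) * C1) * D x \<le> (\<rho> powr (- (\<kappa> * S)) * C1) * m\<^sup>2"
        using Dm C1(1) by (intro mult_left_mono) auto
      finally show "\<rho> powr (- (\<kappa> * S)) * (D x * (norm x / \<rho>) powr q) * (W * \<Phi> z U) \<le> M x"
        using x(1) by (simp add: M_def E_def z(3))
    qed
    then have "(LBINT x. E x * bump 0 \<rho> n x) \<le> (LBINT x. M x)" by simp
    also have "\<dots> = 1/2 * (LBINT x. E x * bump 0 \<rho> n x) + (\<rho> powr (- (\<kappa> * S)) * C1 * m\<^sup>2) * measure lborel (ball (0::'a) \<rho>)"
      unfolding M_def using I0 IB[OF \<rho>0] by simp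
    finally have "(LBINT x. E x * bump 0 \<rho> n x) \<le> 2 * ((\<rho> powr (- (\<kappa> * S)) * C1 * m\<^sup>2) * measure lborel (ball (0::'a) \<rho>))"
      by linarith
    also have "\<dots> = 2 * C1 * m\<^sup>2 * (\<rho> powr (- (\<kappa> * S)) * measure lborel (ball (0::'a) \<rho>))"
      by (simp only: mult_ac)
    finally have "(LBINT x. E x * bump 0 \<rho> n x) \<le> 2 * C1 * m\<^sup>2 * (\<rho> powr (- (\<kappa> * S)) * measure lborel (ball (0::'a) \<rho>))" .
    also have "\<dots> \<le> 2 * C1 * m\<^sup>2 * \<omega>" using ball_scale[OF \<rho>] C1(1) by (intro mult_left_mono) auto
    finally show "(LBINT x. E x * bump 0 \<rho> n x) \<le> 2 * C1 * m\<^sup>2 * \<omega>" .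
    show "integrable lborel (\<lambda>x. E x * bump 0 \<rho> n x)" by (rule I0)
  qed

  define \<rho> where "\<rho> i = real (Suc i)" for i
  have \<rho>1: "\<rho> i \<ge> 1" "\<rho> i > 0" for i by (auto simp: \<rho>_def)
  have bl: "(\<lambda>i. bump 0 (\<rho> i) n x) \<longlonglongrightarrow> 1" for x :: 'a
  proof -
    have "(\<lambda>i. 1 / \<rho> i) \<longlonglongrightarrow> 0"
      unfolding \<rho>_def by (rule LIMSEQ_Suc[OF lim_1_over_n])
    then have "(\<lambda>i. max 0 (1 - (norm x * (1 / \<rho> i))\<^sup>2) ^ n) \<longlonglongrightarrow> max 0 (1 - (norm x * 0)\<^sup>2) ^ n"
      by (intro tendsto_intros)
    then show ?thesis by (simp add: bump_def)
  qed
  have bump1: "bump 0 (\<rho> i) n x \<le> 1" for i and x :: 'a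
    unfolding bump_def by (intro power_le_one) auto
  \<comment> \<open>Fatou's lemma along the integer radii, since the bumps tend to 1
    pointwise.\<close>
  have IE: "integrable lborel E"
  proof (rule integrableI_nonneg)
    show "AE x in lborel. 0 \<le> E x" using E0 by simp
    have "(\<integral>\<^sup>+x. ennreal (E x) \<partial>lborel) = (\<integral>\<^sup>+x. liminf (\<lambda>i. ennreal (E x * bump 0 (\<rho> i) n x)) \<partial>lborel)"
    proof (rule nn_integral_cong)
      fix x :: 'a
      have "(\<lambda>i. ennreal (E x * bump 0 (\<rho> i) n x)) \<longlonglongrightarrow> ennreal (E x * 1)"
        by (intro tendsto_ennrealI tendsto_intros bl)
      from lim_imp_Liminf[OF _ this] show "ennreal (E x) = liminf (\<lambda>i. ennreal (E x * bump 0 (\<rho> i) n x))" by simp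
    qed
    also have "\<dots> \<le> liminf (\<lambda>i. \<integral>\<^sup>+x. ennreal (E x * bump 0 (\<rho> i) n x) \<partial>lborel)"
    proof (rule nn_integral_liminf)
      fix i
      have "(\<lambda>x. E x * bump 0 (\<rho> i) n x) \<in> borel_measurable lborel"
        using pass1(1)[OF \<rho>1(1)[of i]] by (rule borel_measurable_integrable)
      then show "(\<lambda>x. ennreal (E x * bump 0 (\<rho> i) n x)) \<in> borel_measurable lborel" by measurable
    qed
    also have "\<dots> \<le> limsup (\<lambda>i. \<integral>\<^sup>+x. ennreal (E x * bump 0 (\<rho> i) n x) \<partial>lborel)"
      by (rule Liminf_le_Limsup) simp
    also have "\<dots> \<le> ennreal (2 * C1 * m\<^sup>2 * \<omega>)"
    proof (rule Limsup_bounded, rule always_eventually, rule allI)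
      fix i
      have "(\<integral>\<^sup>+x. ennreal (E x * bump 0 (\<rho> i) n x) \<partial>lborel) = ennreal (LBINT x. E x * bump 0 (\<rho> i) n x)"
        by (rule nn_integral_eq_integral[OF pass1(1)[OF \<rho>1(1)]], rule AE_I2, rule mult_nonneg_nonneg[OF E0 bump_nonneg])
      also have "\<dots> \<le> ennreal (2 * C1 * m\<^sup>2 * \<omega>)" by (rule ennreal_leI[OF pass1(2)[OF \<rho>1(1)]])
      finally show "(\<integral>\<^sup>+x. ennreal (E x * bump 0 (\<rho> i) n x) \<partial>lborel) \<le> ennreal (2 * C1 * m\<^sup>2 * \<omega>)" .
    qed
    finally show "(\<integral>\<^sup>+x. ennreal (E x) \<partial>lborel) < \<infinity>" by (rule le_less_trans) simp
  qed simp

  \<comment> \<open>Second pass: the integral of \<open>E\<close> vanishes\<close>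
  have limE: "(\<lambda>i. \<integral>x. E x * bump 0 (\<rho> i) n x \<partial>lborel) \<longlonglongrightarrow> (LBINT x. E x)"
  proof (rule integral_dominated_convergence[where w=E])
    show "(\<lambda>x. E x * bump 0 (\<rho> i) n x) \<in> borel_measurable lborel" for i
      using pass1(1)[OF \<rho>1(1)[of i]] by (rule borel_measurable_integrable)
    show "AE x in lborel. (\<lambda>i. E x * bump 0 (\<rho> i) n x) \<longlonglongrightarrow> E x"
    proof (rule AE_I2)
      fix x :: 'a
      show "(\<lambda>i. E x * bump 0 (\<rho> i) n x) \<longlonglongrightarrow> E x" using tendsto_mult[OF tendsto_const[of "E x"] bl[of x]] by simp
    qed
    show "AE x in lborel. norm (E x * bump 0 (\<rho> i) n x) \<le> E x" for i
    proof (rule AE_I2)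
      fix x :: 'a
      show "norm (E x * bump 0 (\<rho> i) n x) \<le> E x"
        using mult_left_mono[OF bump1[of i x] E0[of x]] E0[of x] bump_nonneg[of 0 "\<rho> i" n x] by (simp add: abs_mult)
    qed
  qed (use IE in auto)
  \<comment> \<open>What \<open>U powr S\<close> becomes after rescaling, with the factor from the
    bump gradient. It is dominated by \<open>E\<close> and tends to 0 at every point because
    \<open>norm x / \<rho> i\<close> does, so integrability of \<open>E\<close> makes its integral
    tend to 0.\<close>
  define T where "T i x = E x * ((norm x / \<rho> i) powr q * indicator (ball 0 (\<rho> i)) x)" for i x
  have T01: "0 \<le> (norm x / \<rho> i) powr q * indicator (ball 0 (\<rho> i)) x" "(norm x / \<rho> i) powr q * indicator (ball 0 (\<rho> i)) x \<le> (1::real)" for i and x :: 'a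
    using \<rho>1(2)[of i] q1 by (auto simp: indicator_def intro!: powr_le1)
  have [measurable]: "ball (0::'a) (\<rho> i) \<in> sets borel" for i by simp
  have Tm[measurable]: "T i \<in> borel_measurable borel" for i unfolding T_def by measurable
  have Tle: "norm (T i x) \<le> E x" for i x
    using mult_left_mono[OF T01(2)[of x i] E0[of x]] mult_nonneg_nonneg[OF E0[of x] T01(1)[of x i]]
    unfolding T_def real_norm_def by simp
  have IT: "integrable lborel (T i)" for i
    by (rule Bochner_Integration.integrable_bound[OF IE]) (use Tle E0 in auto)
  have limT: "(\<lambda>i. \<integral>x. T i x \<partial>lborel) \<longlonglongrightarrow> (\<integral>x. 0 \<partial>(lborel :: 'a measure))"
  proof (rule integral_dominated_convergence[where w=E])
    show "AE x in lborel. (\<lambda>i. T i x) \<longlonglongrightarrow> 0"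
    proof (rule AE_I2)
      fix x :: 'a
      have "(\<lambda>i. norm x * (1 / \<rho> i)) \<longlonglongrightarrow> norm x * 0"
        unfolding \<rho>_def by (intro tendsto_mult tendsto_const LIMSEQ_Suc[OF lim_1_over_n])
      then have "(\<lambda>i. (norm x * (1 / \<rho> i)) powr q) \<longlonglongrightarrow> (norm x * 0) powr q"
        using q1 \<rho>1(2) by (intro tendsto_powr' tendsto_const) (auto intro!: always_eventually simp: less_imp_le)
      then have "(\<lambda>i. E x * (norm x / \<rho> i) powr q) \<longlonglongrightarrow> E x * 0" by (intro tendsto_mult tendsto_const) simp
      then have l: "(\<lambda>i. E x * (norm x / \<rho> i) powr q) \<longlonglongrightarrow> 0" by simp
      have "norm (T i x) \<le> E x * (norm x / \<rho> i) powr q" for i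
        using E0[of x] by (simp add: T_def indicator_def)
      then show "(\<lambda>i. T i x) \<longlonglongrightarrow> 0"
        by (intro Lim_null_comparison[OF _ l] always_eventually allI)
    qed
    show "AE x in lborel. norm (T i x) \<le> E x" for i using Tle by (intro AE_I2)
  qed (use IE in auto)

  \<comment> \<open>\<eta> is fixed first and the radius sent to infinity afterwards;
    \<open>C\<close> depends on \<eta> but not on \<open>i\<close>.\<close>
  have "(LBINT x. E x) \<le> \<eta> * (m\<^sup>2 * \<omega>)" if \<eta>: "\<eta> > 0" for \<eta>
  proof -
    obtain C where C: "C \<ge> 0" "\<And>z U. 0 < z \<Longrightarrow> z \<le> 1 \<Longrightarrow> U > 0 \<Longrightarrow> W * \<Phi> z U \<le> \<eta> + C * U powr S"
      using C2[OF \<eta>] by blast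
    have step: "(LBINT x. E x * bump 0 (\<rho> i) n x) \<le> \<eta> * (m\<^sup>2 * \<omega>) + C * (LBINT x. T i x)" for i
    proof -
      define M where "M x = (\<eta> * m\<^sup>2 * \<rho> i powr (- (\<kappa> * S))) * indicator (ball 0 (\<rho> i)) x + C * T i x" for x
      have "(LBINT x. E x * bump 0 (\<rho> i) n x) \<le> (LBINT x. M x)"
      proof (rule main[OF \<rho>1(1), THEN conjunct2])
        show "integrable lborel M" unfolding M_def using IT IB[OF \<rho>1(2)] by (intro Bochner_Integration.integrable_add integrable_mult_right) auto
        show "M x \<ge> 0" for x unfolding M_def T_def using \<eta> C(1) E0[of x] T01(1)[of x i]
          by (intro add_nonneg_nonneg mult_nonneg_nonneg) auto
        fix x :: 'a and z U :: real
        assume x: "norm x < \<rho> i" "x \<in> \<Omega>" "D x > 0" and z: "z > 0" "z \<le> 1" and U: "U = \<rho> i powr \<kappa> * u x"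
        have U0: "U > 0" using \<rho>1(2)[of i] pos[OF x(2)] by (simp add: U)
        define t where "t = (norm x / \<rho> i) powr q"
        have t: "0 \<le> t" "t \<le> 1" using x(1) \<rho>1(2)[of i] q1 by (auto simp: t_def intro!: powr_le1)
        have "\<rho> i powr (- (\<kappa> * S)) * (D x * t) * (W * \<Phi> z U) \<le>
          \<rho> i powr (- (\<kappa> * S)) * (D x * t) * (\<eta> + C * U powr S)"
          using D0[of x] t C(2)[OF z(1,2) U0] by (intro mult_left_mono) auto
        also have "\<dots> = (\<eta> * \<rho> i powr (- (\<kappa> * S))) * (D x * t) + C * ((\<rho> i powr (- (\<kappa> * S)) * U powr S) * D x * t)"
          by (simp add: algebra_simps)
        also have "\<rho> i powr (- (\<kappa> * S)) * U powr S = u x powr S" unfolding U by (rule scaleU[OF \<rho>1(2) x(2)])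
        also have "(\<eta> * \<rho> i powr (- (\<kappa> * S))) * (D x * t) \<le> (\<eta> * \<rho> i powr (- (\<kappa> * S))) * (m\<^sup>2 * 1)"
          using Dm[of x] D0[of x] t \<eta> by (intro mult_left_mono mult_mono) auto
        finally show "\<rho> i powr (- (\<kappa> * S)) * (D x * (norm x / \<rho> i) powr q) * (W * \<Phi> z U) \<le> M x"
          using x(1) by (simp add: M_def T_def E_def t_def mult_ac)
      qed
      also have "\<dots> = (\<eta> * m\<^sup>2) * (\<rho> i powr (- (\<kappa> * S)) * measure lborel (ball (0::'a) (\<rho> i))) + C * (LBINT x. T i x)"
        unfolding M_def using IT IB[OF \<rho>1(2)] by simp
      also have "\<dots> \<le> (\<eta> * m\<^sup>2) * \<omega> + C * (LBINT x. T i x)"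
        using ball_scale[OF \<rho>1(1)] \<eta> by (intro add_right_mono mult_left_mono) auto
      finally show ?thesis by (simp add: mult.assoc)
    qed
    have "(\<lambda>i. \<eta> * (m\<^sup>2 * \<omega>) + C * (LBINT x. T i x)) \<longlonglongrightarrow> \<eta> * (m\<^sup>2 * \<omega>) + C * 0"
      using limT by (intro tendsto_intros) simp
    from LIMSEQ_le[OF limE this] show ?thesis using step by auto
  qed
  note small = this
  have "(LBINT x. E x) \<le> 0"
  proof (rule field_le_epsilon)
    fix e' :: real assume e': "e' > 0"
    have mw: "m\<^sup>2 * \<omega> > 0" using m(1) \<omega> by simp
    have cancel: "t / w * w = t" if "w > 0" for t w :: real using that by simp
    have "e' / (m\<^sup>2 * \<omega>) * (m\<^sup>2 * \<omega>) = e'" by (rule cancel[OF mw])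
    then show "(LBINT x. E x) \<le> 0 + e'" using small[of "e' / (m\<^sup>2 * \<omega>)"] e' mw by (simp only: divide_pos_pos add_0)
  qed
  moreover have "(LBINT x. E x) \<ge> 0" using E0 by (intro Bochner_Integration.integral_nonneg) auto
  ultimately have "(LBINT x. E x) = 0" by simp
  then have AE0: "AE x in lborel. E x = 0"
    using integral_nonneg_eq_0_iff_AE[OF IE] E0 by simp

  \<comment> \<open>From almost every point to every point\<close>
  have "m \<le> u x" if x: "norm x > b" for x
  proof (rule ccontr)
    assume "\<not> m \<le> u x"
    have bO: "{x. norm x > b} \<subseteq> \<Omega>" using in\<Omega> ab by auto
    have op: "open {x::'a. norm x > b}" by (simp add: open_Collect_less continuous_on_norm_id)
    \<comment> \<open>By continuity a violation at one point persists on a nonempty open set, which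
      is not null, while \<open>E\<close> is nonzero on it.\<close>
    have "open ({x. norm x > b} \<inter> u -` {..<m})"
      by (rule continuous_open_preimage[OF continuous_on_subset[OF cont bO] op]) simp
    moreover have "{x. norm x > b} \<inter> u -` {..<m} \<noteq> {}" using x \<open>\<not> m \<le> u x\<close> by auto
    ultimately have "\<not> negligible ({x. norm x > b} \<inter> u -` {..<m})" by (rule open_not_negligible)
    moreover have "negligible ({x. norm x > b} \<inter> u -` {..<m})"
    proof -
      have nz: "E y \<noteq> 0" if y: "norm y > b" "u y < m" for y
      proof -
        have "u y > 0" "\<xi> y = 1" using pos bO y \<xi>(7)[of y] by auto
        then show ?thesis using y by (simp add: E_def D_def)
      qed
      have "AE y in lborel. y \<notin> {x. norm x > b} \<inter> u -` {..<m}"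
        using AE0 by eventually_elim (use nz in auto)
      then have "AE y in lebesgue. y \<notin> {x. norm x > b} \<inter> u -` {..<m}" by (rule AE_completion)
      then show ?thesis
        using \<open>open ({x. norm x > b} \<inter> u -` {..<m})\<close>
        by (subst negligible_iff_null_sets) (simp add: AE_iff_null_sets)
    qed
    ultimately show False by blast
  qed
  then show ?thesis using m(1) by (auto simp: b_def)
qed

lemma supercritical:
  assumes "p < s" "q < real DIM('a)" "R > 0" "{x. norm x > R} \<subseteq> \<Omega>"
  shows "s > q * (real DIM('a) - 1) / (real DIM('a) - q)"
proof (rule ccontr)
  assume "\<not> ?thesis"
  then have "s \<le> q * (real DIM('a) - 1) / (real DIM('a) - q)" by simp
  from bounded_below_near_infinity[OF assms(1,2) this assms(3,4)]
  obtain m where "m > 0" "\<And>x. norm x > R + 2 \<Longrightarrow> m \<le> u x" by blast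
  then show False using not_bounded_below_near_infinity[OF assms(1), of "R + 2" m] assms(3,4) by force
qed

end

theorem corollary1p5:
  fixes \<Omega> :: "(real ^ 'n) set" and p q s :: real
  assumes "exterior_domain \<Omega>"
    and "1 < q" and "q < real CARD('n)"
    and "q < p" and "p < s"
  shows "(\<exists>u. positive_solution p q s \<Omega> u) \<longleftrightarrow>
         s > q * (real CARD('n) - 1) / (real CARD('n) - q)"
proof
  obtain R where R: "R > 0" "{x. norm x > R} \<subseteq> \<Omega>" and \<Omega>: "open \<Omega>"
    using assms(1) by (auto simp: exterior_domain_def)
  show "s > q * (real CARD('n) - 1) / (real CARD('n) - q)" if ex: "\<exists>u. positive_solution p q s \<Omega> u"
  proof -
    obtain u where u: "positive_solution p q s \<Omega> u" using ex by blast
    obtain G where "supersolution \<Omega> u G p q s"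
      using positive_solution_supersolution[OF u \<Omega> assms(2,4)] .
    from supersolution.supercritical[OF this assms(5) _ R] assms(3) show ?thesis by simp
  qed
  show "\<exists>u. positive_solution p q s \<Omega> u" if "s > q * (real CARD('n) - 1) / (real CARD('n) - q)"
    using positive_solution_exists[OF \<Omega> assms(2,4,5)] assms(3) that by simp
qed

end
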